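(* Let $G$ be a 2-connected graph with $n\ge 6$ nodes and $G\ne K_{3,3}$ (that is, $G$ is not isomorphic to $K_{3,3}$). Then the following assertions are equivalent: (i) $\mathrm{egd}(G)\le 2$. (ii) $G$ has no minor isomorphic to $F_3$ or $H_3$. (iii) $\mathrm{la}_{\boxtimes}(G)\le 2$, i.e., $G$ is a minor of $T\boxtimes K_2$ for some tree $T$.
   Context: All graphs are finite and simple. A graph is 2-connected if it is connected and has no cut node. Notation: $[n]=\{1,\dots,n\}$; $X\succeq 0$ means $X$ is a real symmetric positive semidefinite matrix. Extreme Gram dimension: for a graph $G=([n],E)$, $\mathrm{egd}(G)$ is the smallest integer $r\ge 1$ such that for every $w\in\mathbb{R}^E$ the semidefinite program $\max\ \sum_{ij\in E}w_{ij}X_{ij}$ subject to $X_{ii}=1$ $(i\in[n])$, $X\succeq 0$ ($X$ an $n\times n$ symmetric matrix) has an optimal solution of rank at most $r$. A graph $M$ is a minor of $G$ if it can be obtained from $G$ by a series of edge deletions, edge contractions and node deletions. Strong product: for graphs $G=(V,E)$, $G'=(V',E')$, $G\boxtimes G'$ has node set $V\times V'$, and distinct nodes $(i,i'),(j,j')$ are adjacent when ($i=j$ or $\{i,j\}\in E$) and ($i'=j'$ or $\{i',j'\}\in E'$). The strong largeur d'arborescence $\mathrm{la}_{\boxtimes}(G)$ is the smallest integer $k\ge 1$ for which $G$ is a minor of $T\boxtimes K_k$ for some tree $T$. The graph $F_3$ has 6 nodes $v_1,v_2,v_3,v_{12},v_{13},v_{23}$; its edges are the three edges of the triangle on $\{v_1,v_2,v_3\}$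 together with the edges $\{v_i,v_{ij}\}$ and $\{v_j,v_{ij}\}$ for $1\le i<j\le 3$. The graph $H_3$ is obtained from the complete graph $K_4$ on nodes $v_1,v_2,v_3,v_{13}$ by subdividing the edge $\{v_1,v_2\}$ with a new node $v_{12}$ and the edge $\{v_2,v_3\}$ with a new node $v_{23}$. *)

theory Defs
  imports "Graph_Theory.Graph_Theory" "Jordan_Normal_Form.DL_Rank"
begin

text \<open>
  A finite simple graph is a \<^locale>\<open>pair_graph\<close>: a finite, symmetric, loop-free digraph in which an
  undirected edge \<open>uv\<close> is the pair of arcs \<open>(u, v)\<close>, \<open>(v, u)\<close>.
\<close>

type_synonym 'a ugraph = "'a pair_pre_digraph"

definition complete_on :: "'a set \<Rightarrow> 'a ugraph" where
  "complete_on S = \<lparr>pverts = S, parcs = {(i, j). i \<in> S \<and> j \<in> S \<and> i \<noteq> j}\<rparr>"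

definition complete_graph :: "nat \<Rightarrow> nat ugraph" where
  "complete_graph k = complete_on {..<k}"

definition delete_edge :: "'a ugraph \<Rightarrow> 'a \<Rightarrow> 'a \<Rightarrow> 'a ugraph" where
  "delete_edge G u v = \<lparr>pverts = pverts G, parcs = parcs G - {(u, v), (v, u)}\<rparr>"

definition delete_node :: "'a ugraph \<Rightarrow> 'a \<Rightarrow> 'a ugraph" where
  "delete_node G v =
     \<lparr>pverts = pverts G - {v}, parcs = {(a, b) \<in> parcs G. a \<noteq> v \<and> b \<noteq> v}\<rparr>"

text \<open>The merged node keeps the name \<open>u\<close>; the resulting loop is dropped and parallel edges coincide.\<close>

definition contract_edge :: "'a ugraph \<Rightarrow> 'a \<Rightarrow> 'a \<Rightarrow> 'a ugraph" where
  "contract_edge G u v =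
     (let f = (\<lambda>x. if x = v then u else x) in
      \<lparr>pverts = f ` pverts G,
       parcs = {(f a, f b) |a b. (a, b) \<in> parcs G \<and> f a \<noteq> f b}\<rparr>)"

inductive minor_step :: "'a ugraph \<Rightarrow> 'a ugraph \<Rightarrow> bool" where
  edge_deletion: "(u, v) \<in> parcs G \<Longrightarrow> minor_step G (delete_edge G u v)"
| edge_contraction: "(u, v) \<in> parcs G \<Longrightarrow> minor_step G (contract_edge G u v)"
| node_deletion: "v \<in> pverts G \<Longrightarrow> minor_step G (delete_node G v)"

text \<open>Minors are taken up to isomorphism.\<close>

definition is_minor :: "'b ugraph \<Rightarrow> 'a ugraph \<Rightarrow> bool" where
  "is_minor M G \<longleftrightarrow> (\<exists>H. minor_step\<^sup>*\<^sup>* G H \<and> digraph_iso (with_proj M) (with_proj H))"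

text \<open>A cut node is one whose deletion disconnects some two nodes of a component of \<open>G\<close>.\<close>

definition cut_node :: "'a ugraph \<Rightarrow> 'a \<Rightarrow> bool" where
  "cut_node G v \<longleftrightarrow> v \<in> pverts G \<and>
     (\<exists>a \<in> pverts G - {v}. \<exists>b \<in> pverts G - {v}.
        reachable (with_proj G) a b \<and> \<not> reachable (with_proj (delete_node G v)) a b)"

definition two_connected :: "'a ugraph \<Rightarrow> bool" where
  "two_connected G \<longleftrightarrow> connected (with_proj G) \<and> (\<forall>v. \<not> cut_node G v)"

text \<open>
  The library's \<^const>\<open>tree\<close> forbids all directed cycles, hence also the 2-cycle \<open>u, v, u\<close> that every
  edge of a symmetric digraph gives rise to. In an undirected tree only cycles of length at least 3
  are excluded.
\<close>

definition undirected_tree :: "'a ugraph \<Rightarrow> bool" where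
  "undirected_tree T \<longleftrightarrow> pair_graph T \<and> connected (with_proj T) \<and>
     \<not> (\<exists>p. pre_digraph.cycle (with_proj T) p \<and> 3 \<le> length p)"

definition strong_product :: "'a ugraph \<Rightarrow> 'b ugraph \<Rightarrow> ('a \<times> 'b) ugraph" where
  "strong_product G G' =
     \<lparr>pverts = pverts G \<times> pverts G',
      parcs = {((i, i'), (j, j')). (i, i') \<in> pverts G \<times> pverts G' \<and> (j, j') \<in> pverts G \<times> pverts G' \<and>
                 (i, i') \<noteq> (j, j') \<and>
                 (i = j \<or> (i, j) \<in> parcs G) \<and> (i' = j' \<or> (i', j') \<in> parcs G')}\<rparr>"

text \<open>Every finite tree is isomorphic to one whose nodes are natural numbers.\<close>

definition la_strong :: "'a ugraph \<Rightarrow> nat" where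
  "la_strong G = (LEAST k. 1 \<le> k \<and>
     (\<exists>T :: nat ugraph. undirected_tree T \<and> is_minor G (strong_product T (complete_graph k))))"

definition psd :: "real mat \<Rightarrow> bool" where
  "psd X \<longleftrightarrow> square_mat X \<and> X\<^sup>T = X \<and> (\<forall>v \<in> carrier_vec (dim_row X). 0 \<le> v \<bullet> (X *\<^sub>v v))"

definition sdp_feasible :: "nat \<Rightarrow> real mat set" where
  "sdp_feasible n = {X \<in> carrier_mat n n. psd X \<and> (\<forall>i<n. X $$ (i, i) = 1)}"

text \<open>
  Each undirected edge is counted once, through its arc \<open>(i, j)\<close> with \<open>i < j\<close>; the values of \<open>w\<close> on
  these arcs are the vector in \<open>\<real>\<^sup>E\<close>.
\<close>

definition sdp_value :: "nat ugraph \<Rightarrow> (nat \<times> nat \<Rightarrow> real) \<Rightarrow> real mat \<Rightarrow> real" where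
  "sdp_value G w X = (\<Sum>e \<in> {(i, j) \<in> parcs G. i < j}. w e * X $$ e)"

definition sdp_optimal :: "nat ugraph \<Rightarrow> (nat \<times> nat \<Rightarrow> real) \<Rightarrow> real mat \<Rightarrow> bool" where
  "sdp_optimal G w X \<longleftrightarrow> X \<in> sdp_feasible (card (pverts G)) \<and>
     (\<forall>Y \<in> sdp_feasible (card (pverts G)). sdp_value G w Y \<le> sdp_value G w X)"

text \<open>For graphs on the node set \<open>{..<n}\<close>, matching the 0-based matrix indices.\<close>

definition egd :: "nat ugraph \<Rightarrow> nat" where
  "egd G = (LEAST r. 1 \<le> r \<and>
     (\<forall>w. \<exists>X. sdp_optimal G w X \<and> vec_space.rank (card (pverts G)) X \<le> r))"

text \<open>The nodes \<open>v\<^sub>i\<close> and \<open>v\<^sub>i\<^sub>j\<close> are encoded as the numerals \<open>i\<close> and \<open>ij\<close>.\<close>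

definition F3 :: "nat ugraph" where
  "F3 = \<lparr>pverts = {1, 2, 3, 12, 13, 23},
         parcs = symcl {(1, 2), (1, 3), (2, 3),
                        (1, 12), (2, 12), (1, 13), (3, 13), (2, 23), (3, 23)}\<rparr>"

definition H3 :: "nat ugraph" where
  "H3 = subdivide (subdivide (complete_on {1, 2, 3, 13}) (1, 2) 12) (2, 3) 23"

end

theory Submission
  imports Defs "HOL-Analysis.Analysis"
begin

text \<open>
  Condition (i) says that every objective has an optimal solution that is the Gram matrix of unit
  vectors in the plane: a positive semidefinite matrix of rank at most two with unit diagonal is of
  this form (\<open>planar_of_rank_2\<close>), and optimal solutions exist by compactness. Condition
  (iii) means that the nodes of the graph are covered by a tree of bags of size at most two, where
  the bags containing a given node are connected in the tree and every edge runs inside a bag or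
  between adjacent bags. Minors are handled throughout as families of disjoint connected branch sets
  (\<open>model\<close>).

  From (iii) to (i). An optimal solution \<open>X\<close> is pulled back along the branch sets to
  the product of the tree with \<open>K\<^sub>2\<close>. Over one tree node there are two unit
  vectors, and over an edge of the tree there are two pairs of them. Each pair lies in a plane;
  projecting one plane to the other is, in complex coordinates, a map \<open>y \<mapsto> \<gamma> y
  + \<delta> cnj y\<close> with \<open>\<bar>\<gamma>\<bar> + \<bar>\<delta>\<bar> \<le> 1\<close>,
  which is a convex combination of isometries of the plane (\<open>planar_contraction\<close>).
  Since the objective is linear, one of these isometries does at least as well as the projection
  (\<open>block_config\<close>). Walking through the tree leaf by leaf, all vectors are moved to the
  plane without loss (\<open>tree_config\<close>). Two equal unit vectors remain equal because 1 is
  an extreme value of the inner product, so the vectors are constant on branch sets.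

  From (i) to (ii). For \<open>F\<^sub>3\<close> and \<open>H\<^sub>3\<close> there are weights
  whose optimum over unit vectors in space exceeds the optimum over unit vectors in the plane by a
  positive gap (\<open>F3_gap\<close>, \<open>H3_gap\<close>). The weights reward the orthogonality
  of three or two pairs of the nodes 1, 2, 3, and for \<open>H\<^sub>3\<close> a vanishing
  combination of four vectors; this is possible in space only. If the graph had such a minor, heavy
  weights on the edges inside branch sets would force a planar optimal solution to be nearly
  constant there, against the gap (\<open>gap_contradiction\<close>).

  From (ii) to (iii). A pair of nodes \<open>a\<close>, \<open>b\<close> is a first bag, and every
  component of the graph without it, a bridge, has to be decomposed below this bag. Suppose that the
  outside of the bridge contracts to a triangle with \<open>a\<close> and \<open>b\<close> in
  different corners. If \<open>b\<close> has only one neighbour \<open>c\<close> in the bridge, the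
  bag moves to \<open>{a, c}\<close>. If both have two neighbours, a node of the bridge that
  separates them produces \<open>F\<^sub>3\<close>, and without such a node two disjoint connectors
  (\<open>two_disjoint_connectors\<close>) produce \<open>H\<^sub>3\<close> unless \<open>a\<close>
  and \<open>b\<close> have the same two neighbours, to which the bag can move
  (\<open>dec_of_fat\<close>). When two nodes separate the graph, the required triangles can be
  arranged; the delicate case is that of nodes of degree two
  (\<open>decomposable_of_two_separator\<close>). When no two nodes separate it, the exclusion of
  \<open>H\<^sub>3\<close> makes any two non-adjacent nodes with a common neighbour have the same
  three neighbours, and the graph is \<open>K\<^sub>3\<^sub>,\<^sub>3\<close>
  (\<open>is_K33\<close>).
\<close>

section \<open>Connected node sets\<close>

text \<open>
  Graphs are bare symmetric arc sets here, so that deleting arcs or nodes changes a set and not a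
  structure. \<open>linked E S\<close> says that \<open>S\<close> induces a connected subgraph; the
  empty set counts as connected.
\<close>

definition linked :: "('a \<times> 'a) set \<Rightarrow> 'a set \<Rightarrow> bool" where
  "linked E S \<longleftrightarrow> (\<forall>x\<in>S. \<forall>y\<in>S. (x, y) \<in> (E \<inter> S \<times> S)\<^sup>*)"

definition adj :: "('a \<times> 'a) set \<Rightarrow> 'a set \<Rightarrow> 'a set \<Rightarrow> bool" where
  "adj E X Y \<longleftrightarrow> (\<exists>x\<in>X. \<exists>y\<in>Y. (x, y) \<in> E)"

lemma adjI: "(x, y) \<in> E \<Longrightarrow> x \<in> X \<Longrightarrow> y \<in> Y \<Longrightarrow> adj E X Y"
  by (auto simp: adj_def)

lemma adj_commute: "sym E \<Longrightarrow> adj E X Y \<longleftrightarrow> adj E Y X"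
  by (auto simp: adj_def dest: symD)

lemma adj_mono: "adj E X Y \<Longrightarrow> X \<subseteq> X' \<Longrightarrow> Y \<subseteq> Y' \<Longrightarrow> adj E X' Y'"
  by (auto simp: adj_def)

lemma adj_single_mono: "adj E {b} X \<Longrightarrow> b \<in> Y \<Longrightarrow> X \<subseteq> X' \<Longrightarrow> adj E Y X'"
  by (auto simp: adj_def)

lemma sym_restrict_rtrancl: "sym E \<Longrightarrow> (x, y) \<in> (E \<inter> S \<times> S)\<^sup>* \<Longrightarrow> (y, x) \<in> (E \<inter> S \<times> S)\<^sup>*"
proof -
  assume "sym E" "(x, y) \<in> (E \<inter> S \<times> S)\<^sup>*"
  moreover have "sym (E \<inter> S \<times> S)" using \<open>sym E\<close> by (auto simp: sym_def)
  ultimately show ?thesis by (meson sym_rtrancl symD)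
qed

lemma restrict_rtrancl_mono: "(x, y) \<in> (E \<inter> S \<times> S)\<^sup>* \<Longrightarrow> S \<subseteq> T \<Longrightarrow> E \<subseteq> F \<Longrightarrow> (x, y) \<in> (F \<inter> T \<times> T)\<^sup>*"
  by (rule subsetD[OF rtrancl_mono]) auto

lemma restrict_rtrancl_in: "(x, y) \<in> (E \<inter> S \<times> S)\<^sup>* \<Longrightarrow> x \<in> S \<Longrightarrow> y \<in> S"
  by (induction rule: rtrancl_induct) auto

lemma restrict_rtrancl_in': "(x, y) \<in> (E \<inter> S \<times> S)\<^sup>* \<Longrightarrow> y \<in> S \<Longrightarrow> x \<in> S"
  by (induction rule: converse_rtrancl_induct) auto

lemma linked_empty [simp]: "linked E {}" by (simp add: linked_def)
lemma linked_singleton [simp]: "linked E {x}" by (simp add: linked_def)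

lemma linkedD: "linked E S \<Longrightarrow> x \<in> S \<Longrightarrow> y \<in> S \<Longrightarrow> (x, y) \<in> (E \<inter> S \<times> S)\<^sup>*"
  by (simp add: linked_def)

lemma linkedI_center:
  assumes "sym E" "\<And>x. x \<in> S \<Longrightarrow> (c, x) \<in> (E \<inter> S \<times> S)\<^sup>*"
  shows "linked E S"
  unfolding linked_def
proof (intro ballI)
  fix x y assume xy: "x \<in> S" "y \<in> S"
  show "(x, y) \<in> (E \<inter> S \<times> S)\<^sup>*"
    by (rule rtrancl_trans[OF sym_restrict_rtrancl[OF assms(1) assms(2)[OF xy(1)]] assms(2)[OF xy(2)]])
qed

lemma linked_mono: "linked E S \<Longrightarrow> E \<subseteq> F \<Longrightarrow> linked F S"
  by (meson linked_def order_refl restrict_rtrancl_mono)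

lemma linked_Un:
  assumes "sym E" "linked E S" "linked E T" "S \<inter> T \<noteq> {}"
  shows "linked E (S \<union> T)"
proof -
  obtain c where c: "c \<in> S" "c \<in> T" using assms by auto
  show ?thesis
  proof (rule linkedI_center[OF assms(1), of _ c])
    fix x assume "x \<in> S \<union> T"
    then show "(c, x) \<in> (E \<inter> (S \<union> T) \<times> (S \<union> T))\<^sup>*"
    proof
      assume "x \<in> S" then show ?thesis
        by (intro restrict_rtrancl_mono[OF linkedD[OF assms(2) c(1)]]) auto
    next
      assume "x \<in> T" then show ?thesis
        by (intro restrict_rtrancl_mono[OF linkedD[OF assms(3) c(2)]]) auto
    qed
  qed
qed

lemma linked_edge:
  assumes "sym E" "(x, y) \<in> E"
  shows "linked E {x, y}"
proof (rule linkedI_center[OF assms(1), of _ x])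
  fix z assume z: "z \<in> {x, y}"
  define S where "S = {x, y}"
  have S: "x \<in> S" "y \<in> S" by (auto simp: S_def)
  then have "(x, y) \<in> E \<inter> S \<times> S" using assms(2) by blast
  moreover from z have "z = x \<or> z = y" by blast
  ultimately have "(x, z) \<in> (E \<inter> S \<times> S)\<^sup>*" by blast
  then show "(x, z) \<in> (E \<inter> {x, y} \<times> {x, y})\<^sup>*" unfolding S_def .
qed

lemma linked_Un_adj:
  assumes "sym E" "linked E S" "linked E T" "adj E S T"
  shows "linked E (S \<union> T)"
proof -
  obtain x y where xy: "x \<in> S" "y \<in> T" "(x, y) \<in> E" using assms by (auto simp: adj_def)
  have 1: "linked E (S \<union> {x, y})"
    by (rule linked_Un[OF assms(1,2) linked_edge[OF assms(1) xy(3)]]) (use xy in blast)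
  have "linked E ((S \<union> {x, y}) \<union> T)"
    by (rule linked_Un[OF assms(1) 1 assms(3)]) (use xy in blast)
  moreover have "(S \<union> {x, y}) \<union> T = S \<union> T" using xy by blast
  ultimately show ?thesis by simp
qed

lemma linked_insert: "sym E \<Longrightarrow> linked E S \<Longrightarrow> y \<in> S \<Longrightarrow> (x, y) \<in> E \<Longrightarrow> linked E (insert x S)"
  using linked_Un_adj[of E "{x}" S] by (auto simp: adj_def)

text \<open>
  The step that every growth argument below takes: a part of a connected set that does not exhaust
  it can be extended along an edge.
\<close>

lemma linked_edge_out:
  assumes "linked E S" "x \<in> S" "x \<in> X" "y \<in> S" "y \<notin> X"
  shows "\<exists>u v. (u, v) \<in> E \<and> u \<in> S \<inter> X \<and> v \<in> S - X"
proof -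
  have "(x, y) \<in> (E \<inter> S \<times> S)\<^sup>*" using assms by (simp add: linked_def)
  then show ?thesis using assms(2,3,5)
    by (induction rule: converse_rtrancl_induct) blast+
qed

text \<open>
  The restriction to \<open>S\<close> is what makes this the component of \<open>x\<close> in the
  subgraph induced by \<open>S\<close>. For \<open>x\<close> outside \<open>S\<close> it is
  \<open>{x}\<close>.
\<close>

definition component :: "('a \<times> 'a) set \<Rightarrow> 'a set \<Rightarrow> 'a \<Rightarrow> 'a set" where
  "component E S x = {y. (x, y) \<in> (E \<inter> S \<times> S)\<^sup>*}"

lemma component_self [simp]: "x \<in> component E S x" by (simp add: component_def)

lemma component_subset: "x \<in> S \<Longrightarrow> component E S x \<subseteq> S"
  unfolding component_def using restrict_rtrancl_in[of x _ E S] by blast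

lemma component_closed:
  assumes "x \<in> S" "y \<in> component E S x" "(y, z) \<in> E" "z \<in> S"
  shows "z \<in> component E S x"
proof -
  have "(x, y) \<in> (E \<inter> S \<times> S)\<^sup>*" using assms by (simp add: component_def)
  moreover have "(y, z) \<in> E \<inter> S \<times> S" using assms component_subset[OF assms(1), of E] by blast
  ultimately show ?thesis unfolding component_def by (simp add: rtrancl_into_rtrancl)
qed

lemma component_linked: assumes "sym E" shows "linked E (component E S x)"
proof (rule linkedI_center[OF assms, of _ x])
  fix y assume "y \<in> component E S x"
  then have "(x, y) \<in> (E \<inter> S \<times> S)\<^sup>*" by (simp add: component_def)
  then show "(x, y) \<in> (E \<inter> component E S x \<times> component E S x)\<^sup>*"
  proof (induction rule: rtrancl_induct)
    case (step y z)
    have "y \<in> component E S x" "z \<in> component E S x"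
      using step by (auto simp: component_def intro: rtrancl_into_rtrancl)
    with step have "(y, z) \<in> E \<inter> component E S x \<times> component E S x" by blast
    with step.IH show ?case by (rule rtrancl_into_rtrancl)
  qed simp
qed

text \<open>
  Nodes of \<open>C\<close> that belong to neither seed are absorbed one at a time: as long as some
  are left, an edge leads from the union of the seeds to one of them.
\<close>

lemma linked_bipartition:
  assumes "sym E" "finite C" "linked E C" "linked E P" "linked E Q"
    "P \<subseteq> C" "Q \<subseteq> C" "P \<inter> Q = {}" "P \<noteq> {}" "Q \<noteq> {}"
  shows "\<exists>P' Q'. P \<subseteq> P' \<and> Q \<subseteq> Q' \<and> P' \<union> Q' = C \<and> P' \<inter> Q' = {} \<and> linked E P' \<and> linked E Q'"
  using assms(4-)
proof (induction "card (C - (P \<union> Q))" arbitrary: P Q rule: less_induct)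
  case less
  show ?case
  proof (cases "P \<union> Q = C")
    case True then show ?thesis using less.prems by blast
  next
    case False
    then obtain y where y: "y \<in> C" "y \<notin> P \<union> Q" using less.prems by blast
    obtain x where x: "x \<in> P" using less.prems by auto
    obtain u v where uv: "(u, v) \<in> E" "u \<in> P \<union> Q" "v \<in> C" "v \<notin> P \<union> Q"
      using linked_edge_out[OF assms(3), of x "P \<union> Q" y] x y less.prems by blast
    have lt: "card (C - (insert v (P \<union> Q))) < card (C - (P \<union> Q))"
      using uv assms(2) by (intro psubset_card_mono) auto
    from uv(1) assms(1) have vu: "(v, u) \<in> E" by (simp add: symD)
    show ?thesis
    proof (cases "u \<in> P")
      case True
      then have "linked E (insert v P)" using less.prems vu linked_insert[OF assms(1)] by blast
      then have "\<exists>P' Q'. insert v P \<subseteq> P' \<and> Q \<subseteq> Q' \<and> P' \<union> Q' = C \<and> P' \<inter> Q' = {} \<and> linked E P' \<and> linked E Q'"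
        using less.prems uv lt by (intro less.hyps) auto
      then show ?thesis by blast
    next
      case False
      then have "linked E (insert v Q)" using less.prems vu uv linked_insert[OF assms(1)] by blast
      then have "\<exists>P' Q'. P \<subseteq> P' \<and> insert v Q \<subseteq> Q' \<and> P' \<union> Q' = C \<and> P' \<inter> Q' = {} \<and> linked E P' \<and> linked E Q'"
        using less.prems uv lt by (intro less.hyps) auto
      then show ?thesis by blast
    qed
  qed
qed

lemma linked_split:
  assumes "sym E" "finite C" "linked E C" "x \<in> C" "y \<in> C" "x \<noteq> y"
  obtains X Y where "x \<in> X" "y \<in> Y" "X \<union> Y = C" "X \<inter> Y = {}" "linked E X" "linked E Y" "adj E X Y"
proof -
  obtain X Y where XY: "{x} \<subseteq> X" "{y} \<subseteq> Y" "X \<union> Y = C" "X \<inter> Y = {}" "linked E X" "linked E Y"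
    using linked_bipartition[of E C "{x}" "{y}"] assms by auto
  obtain u v where "(u, v) \<in> E" "u \<in> C \<inter> X" "v \<in> C - X"
    using linked_edge_out[OF assms(3), of x X y] assms XY by blast
  then have "adj E X Y" using XY by (auto simp: adj_def)
  then show thesis using that XY by auto
qed

text \<open>
  A walk in \<open>C\<close> from a node of \<open>A\<close> to \<open>c\<close> can leave
  \<open>A\<close> only through \<open>c\<close>. Hence each side of a cut node \<open>c\<close>
  stays connected when \<open>c\<close> is added to it.
\<close>

lemma linked_insert_closed:
  assumes "sym E" "linked E C" "c \<in> C" "A \<subseteq> C"
    "\<And>x y. x \<in> A \<Longrightarrow> (x, y) \<in> E \<Longrightarrow> y \<in> C \<Longrightarrow> y \<in> insert c A"
  shows "linked E (insert c A)"
proof -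
  let ?K = "insert c A"
  have "(x, c) \<in> (E \<inter> C \<times> C)\<^sup>* \<Longrightarrow> x \<in> ?K \<Longrightarrow> (x, c) \<in> (E \<inter> ?K \<times> ?K)\<^sup>*" for x
  proof (induction rule: converse_rtrancl_induct)
    case (step x y)
    show ?case
    proof (cases "x = c")
      case False
      then have "x \<in> A" "y \<in> ?K" using step assms by blast+
      then have "(x, y) \<in> E \<inter> ?K \<times> ?K" using step by auto
      then show ?thesis using step.IH[OF \<open>y \<in> ?K\<close>] by (rule converse_rtrancl_into_rtrancl)
    qed simp
  qed simp
  note walk = this
  have *: "(x, c) \<in> (E \<inter> ?K \<times> ?K)\<^sup>*" if "x \<in> ?K" for x
  proof -
    have "x \<in> C" using that assms(3,4) by auto
    from walk[OF linkedD[OF assms(2) this assms(3)] that] show ?thesis .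
  qed
  show ?thesis
    by (rule linkedI_center[OF assms(1)]) (rule sym_restrict_rtrancl[OF assms(1) *])
qed

section \<open>Two disjoint connectors\<close>

text \<open>
  \<open>A\<close> and \<open>B\<close> may reach outside of \<open>C\<close>, as the neighbourhoods
  do that will be used for them.
\<close>

definition joined :: "('a \<times> 'a) set \<Rightarrow> 'a set \<Rightarrow> 'a set \<Rightarrow> 'a set \<Rightarrow> bool" where
  "joined E C A B \<longleftrightarrow> (\<exists>a\<in>A \<inter> C. \<exists>b\<in>B \<inter> C. (a, b) \<in> (E \<inter> C \<times> C)\<^sup>*)"

lemma joinedI: "a \<in> A \<Longrightarrow> a \<in> C \<Longrightarrow> b \<in> B \<Longrightarrow> b \<in> C \<Longrightarrow> (a, b) \<in> (E \<inter> C \<times> C)\<^sup>* \<Longrightarrow> joined E C A B"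
  by (auto simp: joined_def)

lemma joinedE:
  assumes "joined E C A B"
  obtains a b where "a \<in> A" "a \<in> C" "b \<in> B" "b \<in> C" "(a, b) \<in> (E \<inter> C \<times> C)\<^sup>*"
  using assms by (auto simp: joined_def)

lemma joined_sym: "sym E \<Longrightarrow> joined E C A B \<Longrightarrow> joined E C B A"
  by (elim joinedE) (rule joinedI, assumption+, erule sym_restrict_rtrancl, assumption)

lemma joined_commute: "sym E \<Longrightarrow> joined E C A B \<longleftrightarrow> joined E C B A"
  using joined_sym[of E C A B] joined_sym[of E C B A] by blast

lemma joined_mono:
  assumes "joined E C A B" "C \<subseteq> C'" "E \<subseteq> E'"
  shows "joined E' C' A B"
  using assms(1)
proof (rule joinedE)
  fix a b assume *: "a \<in> A" "a \<in> C" "b \<in> B" "b \<in> C" "(a, b) \<in> (E \<inter> C \<times> C)\<^sup>*"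
  show ?thesis
    by (rule joinedI[of a _ _ b]) (use * assms(2,3) restrict_rtrancl_mono[OF *(5) assms(2,3)] in auto)
qed

lemma joined_trans1:
  assumes "joined E C A {v}" "joined E C {v} B" shows "joined E C A B"
  using assms by (elim joinedE) (auto intro: joinedI[OF _ _ _ _ rtrancl_trans])

text \<open>
  The separator exchange in the proof of Menger's theorem by induction on the edges. If deleting the
  edge \<open>xy\<close> makes the single node \<open>s\<close> separate \<open>A\<close> from
  \<open>B\<close>, and \<open>y\<close> is the end of the edge on the side of \<open>B\<close>,
  then a path from \<open>A\<close> to \<open>B\<close> hits \<open>s\<close> or \<open>x\<close>
  before it can use the edge. So a node \<open>c\<close> that does not separate \<open>A\<close>
  from \<open>B\<close> in the graph does not separate \<open>A\<close> from \<open>{s, x}\<close>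
  in the smaller one.
\<close>

lemma joined_via_edge:
  assumes "sym E" and E': "E' = E - {(x, y), (y, x)}"
    and s: "\<not> joined E' (C - {s}) A B" and "x \<noteq> s" "y \<noteq> s" "x \<noteq> y"
    and yB: "joined E' (C - {s}) {y} B"
    and c: "joined E (C - {c}) A B"
  shows "joined E' (C - {c}) A {s, x}"
proof (rule ccontr)
  assume n: "\<not> ?thesis"
  obtain a b where ab: "a \<in> A \<inter> (C - {c})" "b \<in> B \<inter> (C - {c})"
      "(a, b) \<in> (E \<inter> (C - {c}) \<times> (C - {c}))\<^sup>*"
    using c by (auto simp: joined_def)
  have a: "a \<noteq> s" "a \<noteq> x" using n ab(1) by (auto simp: joined_def)
  let ?D = "C - {c} - {s, x}"
  have "(a, b) \<in> (E' \<inter> ?D \<times> ?D)\<^sup>*"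
    using ab(3)
  proof (induction rule: rtrancl_induct)
    case (step u v)
    have u: "u \<in> ?D" using restrict_rtrancl_in[OF step.IH] ab(1) a by auto
    have au: "(a, u) \<in> (E' \<inter> (C - {c}) \<times> (C - {c}))\<^sup>*" "(a, u) \<in> (E' \<inter> (C - {s}) \<times> (C - {s}))\<^sup>*"
      by (rule restrict_rtrancl_mono[OF step.IH]; auto)+
    have "(u, v) \<noteq> (y, x)"
    proof
      assume "(u, v) = (y, x)"
      with au(2) yB have "joined E' (C - {s}) A B"
      proof -
        have "joined E' (C - {s}) A {y}"
          by (rule joinedI[of a _ _ y]) (use ab(1) a au(2) \<open>(u, v) = (y, x)\<close> u in auto)
        then show ?thesis using yB by (rule joined_trans1)
      qed
      with s show False by simp
    qed
    then have E'uv: "(u, v) \<in> E'" using step u by (auto simp: E')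
    have v: "v \<in> C - {c}" using step by auto
    have "v \<notin> {s, x}"
    proof
      assume "v \<in> {s, x}"
      moreover have "(a, v) \<in> (E' \<inter> (C - {c}) \<times> (C - {c}))\<^sup>*"
        by (rule rtrancl_into_rtrancl[OF au(1)]) (use E'uv u v in blast)
      ultimately show False using n ab(1) v joinedI[of a A "C - {c}" v "{s, x}" E'] by blast
    qed
    then have "(u, v) \<in> E' \<inter> ?D \<times> ?D" using E'uv u v by blast
    with step.IH show ?case by (rule rtrancl_into_rtrancl)
  qed simp
  moreover have "b \<in> ?D" using restrict_rtrancl_in[OF calculation] ab(1) a by auto
  ultimately have "joined E' (C - {s}) A B"
    using ab(1,2) a restrict_rtrancl_mono[of a b E' ?D "C - {s}" E']
    by (intro joinedI[of a _ _ b]) auto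
  with s show False by simp
qed

text \<open>
  A connector that ends in the separating node \<open>s\<close> may stray to the other side of
  \<open>s\<close>. Only \<open>s\<close> and one component of the rest that meets \<open>A\<close>
  are kept; they lie on the side of \<open>A\<close>.
\<close>

lemma joined_trim:
  assumes "sym E" "linked E P" "s \<in> P" "a \<in> P" "a \<in> A" "P \<subseteq> C"
  shows "\<exists>P0. linked E P0 \<and> s \<in> P0 \<and> P0 \<subseteq> P \<and> P0 \<inter> A \<noteq> {} \<and>
    (\<forall>v\<in>P0 - {s}. joined E (C - {s}) A {v})"
proof (cases "a = s")
  case True then show ?thesis using assms by (intro exI[of _ "{s}"]) auto
next
  case False
  let ?K = "component E (P - {s}) a"
  have aP: "a \<in> P - {s}" using False assms by auto
  obtain u v where "(u, v) \<in> E" "u \<in> P \<inter> ?K" "v \<in> P - ?K"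
    using linked_edge_out[OF assms(2,4), of ?K s] assms component_subset[OF aP, of E] by auto
  then have "v = s" using component_closed[OF aP, of u E v] by auto
  then have "linked E (insert s ?K)"
    using assms(1) \<open>(u, v) \<in> E\<close> \<open>u \<in> P \<inter> ?K\<close> component_linked[OF assms(1)]
    by (intro linked_insert[of _ _ u]) (auto dest: symD)
  moreover have "joined E (C - {s}) A {v}" if "v \<in> insert s ?K - {s}" for v
  proof -
    have "(a, v) \<in> (E \<inter> (P - {s}) \<times> (P - {s}))\<^sup>*" using that by (auto simp: component_def)
    then have 1: "(a, v) \<in> (E \<inter> (C - {s}) \<times> (C - {s}))\<^sup>*" by (rule restrict_rtrancl_mono) (use assms in auto)
    have "v \<in> C - {s}" using that component_subset[OF aP, of E] assms by auto
    with 1 show ?thesis using assms aP by (auto simp: joined_def)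
  qed
  ultimately show ?thesis
    using component_subset[OF aP, of E] assms component_self[of a E "P - {s}"]
    by (intro exI[of _ "insert s ?K"] conjI ballI) blast+
qed

lemma disjoint_pair_sides:
  "P \<inter> Q = {} \<Longrightarrow> P \<inter> {s, x} \<noteq> {} \<Longrightarrow> Q \<inter> {s, x} \<noteq> {} \<Longrightarrow> s \<in> P \<and> x \<in> Q \<or> s \<in> Q \<and> x \<in> P"
  by auto

text \<open>
  Menger's theorem for two connectors, with connected sets in place of paths. Induction on the
  number of edges inside \<open>C\<close>: if an edge \<open>xy\<close> can be dropped, it is
  dropped. Otherwise dropping it leaves a separating node \<open>s\<close>; the induction hypothesis
  joins \<open>A\<close> to \<open>{s, x}\<close> and \<open>B\<close> to \<open>{s, y}\<close>, and
  the four connectors are glued at \<open>s\<close> and along \<open>xy\<close>.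
\<close>

theorem two_disjoint_connectors:
  assumes "finite E" "sym E" "irrefl E" "finite C"
    "joined E C A B"
    "\<And>c. c \<in> C \<Longrightarrow> joined E (C - {c}) A B"
  shows "\<exists>P Q. P \<subseteq> C \<and> Q \<subseteq> C \<and> P \<inter> Q = {} \<and> linked E P \<and> linked E Q \<and>
     P \<inter> A \<noteq> {} \<and> P \<inter> B \<noteq> {} \<and> Q \<inter> A \<noteq> {} \<and> Q \<inter> B \<noteq> {}"
  using assms(1-3,5-)
proof (induction "card (E \<inter> C \<times> C)" arbitrary: E A B rule: less_induct)
  case less
  note prems = less.prems
  show ?case
  proof (cases "E \<inter> C \<times> C = {}")
    case True
    \<comment> \<open>without edges every path is a single node, and deleting \<open>p\<close> must leave another one\<close>
    obtain p where p: "p \<in> A \<inter> C" "p \<in> B \<inter> C" using prems(4) True by (auto simp: joined_def)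
    have "E \<inter> (C - {p}) \<times> (C - {p}) = {}" using True by auto
    then obtain q where "q \<in> A \<inter> C - {p}" "q \<in> B \<inter> C - {p}" using prems(5)[of p] p True by (auto simp: joined_def)
    then show ?thesis using p by (intro exI[of _ "{p}"] exI[of _ "{q}"]) auto
  next
    case False
    then obtain x y where xy: "(x, y) \<in> E" "x \<in> C" "y \<in> C" by auto
    have ne: "x \<noteq> y" using xy prems(3) by (auto simp: irrefl_def)
    define E' where "E' = E - {(x, y), (y, x)}"
    have E'': "E' = E - {(y, x), (x, y)}" by (auto simp: E'_def)
    have E': "finite E'" "sym E'" "irrefl E'" "E' \<subseteq> E"
      using prems(1-3) by (auto simp: E'_def sym_def irrefl_def)
    have lt: "card (E' \<inter> C \<times> C) < card (E \<inter> C \<times> C)"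
      using xy prems(1) by (intro psubset_card_mono) (auto simp: E'_def)
    note IH = less.hyps[OF lt E'(1-3)]
    show ?thesis
    proof (cases "\<forall>c\<in>C. joined E' (C - {c}) A B")
      case True
      then have "joined E' (C - {x}) A B" using xy by auto
      then have "joined E' C A B" by (rule joined_mono) auto
      from IH[OF this] True obtain P Q where "P \<subseteq> C \<and> Q \<subseteq> C \<and> P \<inter> Q = {} \<and> linked E' P \<and> linked E' Q \<and>
        P \<inter> A \<noteq> {} \<and> P \<inter> B \<noteq> {} \<and> Q \<inter> A \<noteq> {} \<and> Q \<inter> B \<noteq> {}" by blast
      then show ?thesis using linked_mono[OF _ E'(4)] by blast
    next
      case False
      then obtain s where s: "s \<in> C" "\<not> joined E' (C - {s}) A B" by auto
      obtain a b where ab: "a \<in> A \<inter> (C - {s})" "b \<in> B \<inter> (C - {s})"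
          "(a, b) \<in> (E \<inter> (C - {s}) \<times> (C - {s}))\<^sup>*"
        using prems(5)[OF s(1)] by (auto simp: joined_def)
      \<comment> \<open>name the ends of the deleted edge so that \<open>x'\<close> lies on the side of \<open>A\<close>\<close>
      have *: "\<exists>x' y'. {x', y'} = {x, y} \<and> x' \<noteq> s \<and> y' \<noteq> s \<and> joined E' (C - {s}) A {x'} \<and> joined E' (C - {s}) {y'} B"
      proof -
        have aC: "a \<in> C - {s}" using ab by auto
        let ?R = "component E' (C - {s}) a"
        have "b \<notin> ?R" using s(2) ab by (auto simp: joined_def component_def)
        have bR: "\<exists>u v. (u, v) \<in> E \<and> u \<in> ?R \<and> v \<in> C - {s} - ?R \<and> (v, b) \<in> (E' \<inter> (C - {s}) \<times> (C - {s}))\<^sup>*"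
        proof -
          \<comment> \<open>follow the walk backwards from \<open>b\<close> up to the first use of the deleted edge\<close>
          have "(w, b) \<in> (E \<inter> (C - {s}) \<times> (C - {s}))\<^sup>* \<Longrightarrow>
            (w, b) \<in> (E' \<inter> (C - {s}) \<times> (C - {s}))\<^sup>* \<or>
            (\<exists>y'\<in>{x, y}. y' \<in> C - {s} \<and> (y', b) \<in> (E' \<inter> (C - {s}) \<times> (C - {s}))\<^sup>*) " for w
          proof (induction rule: converse_rtrancl_induct)
            case (step w w')
            then show ?case
            proof (cases "(w, w') \<in> E'")
              case True
              then have "(w, w') \<in> E' \<inter> (C - {s}) \<times> (C - {s})" using step by blast
              then show ?thesis using step.IH converse_rtrancl_into_rtrancl by metis
            next
              case False
              then have "w' \<in> {x, y}" using step by (auto simp: E'_def)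
              then show ?thesis using step by auto
            qed
          qed simp
          from this[OF ab(3)] obtain y' where y': "y' \<in> {x, y}" "y' \<in> C - {s}" "(y', b) \<in> (E' \<inter> (C - {s}) \<times> (C - {s}))\<^sup>*"
            using \<open>b \<notin> ?R\<close> by (auto simp: component_def)
          have l: "(a, b) \<in> (E \<inter> (C - {s}) \<times> (C - {s}))\<^sup>*" by fact
          have "\<exists>u v. (u, v) \<in> E \<inter> (C - {s}) \<times> (C - {s}) \<and> u \<in> ?R \<and> v \<notin> ?R"
            using l \<open>b \<notin> ?R\<close> component_self[of a E' "C - {s}"]
            by (induction rule: rtrancl_induct) blast+
          then obtain u v where uv: "(u, v) \<in> E" "u \<in> C - {s}" "v \<in> C - {s}" "u \<in> ?R" "v \<notin> ?R" by auto
          have "(u, v) \<notin> E'" using component_closed[OF aC uv(4) _ uv(3)] uv by auto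
          then have "{u, v} = {x, y}" using uv(1) by (auto simp: E'_def)
          moreover have "y' \<notin> ?R"
          proof
            assume "y' \<in> ?R"
            then have "b \<in> ?R" using y'(3) by (auto simp: component_def intro: rtrancl_trans)
            with \<open>b \<notin> ?R\<close> show False by simp
          qed
          ultimately have "y' = v" using y'(1) uv by auto
          then show ?thesis using uv y' by auto
        qed
        then obtain u v where uv: "(u, v) \<in> E" "u \<in> ?R" "v \<in> C - {s} - ?R" "(v, b) \<in> (E' \<inter> (C - {s}) \<times> (C - {s}))\<^sup>*" by blast
        have "(u, v) \<notin> E'" using component_closed[OF aC uv(2)] uv by auto
        then have "{u, v} = {x, y}" using uv(1) by (auto simp: E'_def)
        moreover have "u \<in> C - {s}" using component_subset[OF aC] uv(2) by blast
        moreover have "joined E' (C - {s}) A {u}" "joined E' (C - {s}) {v} B"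
          using uv ab \<open>u \<in> C - {s}\<close> by (auto simp: joined_def component_def)
        ultimately show ?thesis using uv by blast
      qed
      then obtain x' y' where x'y': "{x', y'} = {x, y}" "x' \<noteq> s" "y' \<noteq> s"
        and jx: "joined E' (C - {s}) A {x'}" and jy: "joined E' (C - {s}) {y'} B" by blast
      have E'2: "E' = E - {(x', y'), (y', x')}" "E' = E - {(y', x'), (x', y')}" "x' \<noteq> y'" "(x', y') \<in> E" "x' \<in> C" "y' \<in> C"
        using x'y'(1) ne xy prems(2) by (auto simp: E'_def doubleton_eq_iff dest: symD)
      have s': "\<not> joined E' (C - {s}) B A" using s joined_commute[OF E'(2)] by blast
      have jA: "joined E' (C - {c}) A {s, x'}" if "c \<in> C" for c
        using joined_via_edge[OF prems(2) E'2(1) s(2) x'y'(2,3) E'2(3) jy prems(5)[OF that]] .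
      have jx': "joined E' (C - {s}) {x'} A" using jx joined_commute[OF E'(2)] by blast
      have jB: "joined E' (C - {c}) B {s, y'}" if "c \<in> C" for c
        using joined_via_edge[OF prems(2) E'2(2) s' x'y'(3,2) E'2(3)[symmetric] jx']
          prems(5)[OF that] joined_commute[OF prems(2)] by blast
      have up: "joined E' (C - {s}) X Y \<Longrightarrow> joined E' C X Y" for X Y
        by (rule joined_mono) auto
      have hA: "\<exists>P Q. P \<subseteq> C \<and> Q \<subseteq> C \<and> P \<inter> Q = {} \<and> linked E' P \<and> linked E' Q \<and>
          P \<inter> A \<noteq> {} \<and> P \<inter> {s, x'} \<noteq> {} \<and> Q \<inter> A \<noteq> {} \<and> Q \<inter> {s, x'} \<noteq> {}"
        by (rule IH[OF up[OF jA[OF s(1)]] jA])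
      obtain P Q where PQ: "P \<subseteq> C" "Q \<subseteq> C" "P \<inter> Q = {}" "linked E' P" "linked E' Q"
          "P \<inter> A \<noteq> {}" "P \<inter> {s, x'} \<noteq> {}" "Q \<inter> A \<noteq> {}" "Q \<inter> {s, x'} \<noteq> {}"
        using hA by (elim exE conjE) (rule that)
      have hB: "\<exists>P Q. P \<subseteq> C \<and> Q \<subseteq> C \<and> P \<inter> Q = {} \<and> linked E' P \<and> linked E' Q \<and>
          P \<inter> B \<noteq> {} \<and> P \<inter> {s, y'} \<noteq> {} \<and> Q \<inter> B \<noteq> {} \<and> Q \<inter> {s, y'} \<noteq> {}"
        by (rule IH[OF up[OF jB[OF s(1)]] jB])
      obtain P' Q' where PQ': "P' \<subseteq> C" "Q' \<subseteq> C" "P' \<inter> Q' = {}" "linked E' P'" "linked E' Q'"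
          "P' \<inter> B \<noteq> {}" "P' \<inter> {s, y'} \<noteq> {}" "Q' \<inter> B \<noteq> {}" "Q' \<inter> {s, y'} \<noteq> {}"
        using hB by (elim exE conjE) (rule that)
      have "\<exists>P Q. P \<subseteq> C \<and> Q \<subseteq> C \<and> P \<inter> Q = {} \<and> linked E' P \<and> linked E' Q \<and> P \<inter> A \<noteq> {} \<and> s \<in> P \<and> Q \<inter> A \<noteq> {} \<and> x' \<in> Q"
        using disjoint_pair_sides[OF PQ(3,7,9)]
      proof
        assume "s \<in> P \<and> x' \<in> Q"
        then show ?thesis using PQ by (intro exI[of _ P] exI[of _ Q]) simp
      next
        assume "s \<in> Q \<and> x' \<in> P"
        then show ?thesis using PQ by (intro exI[of _ Q] exI[of _ P]) (simp add: Int_commute)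
      qed
      then obtain P1 Q1 where 1: "P1 \<subseteq> C" "Q1 \<subseteq> C" "P1 \<inter> Q1 = {}" "linked E' P1" "linked E' Q1" "P1 \<inter> A \<noteq> {}" "s \<in> P1" "Q1 \<inter> A \<noteq> {}" "x' \<in> Q1"
        by blast
      have "\<exists>P Q. P \<subseteq> C \<and> Q \<subseteq> C \<and> P \<inter> Q = {} \<and> linked E' P \<and> linked E' Q \<and> P \<inter> B \<noteq> {} \<and> s \<in> P \<and> Q \<inter> B \<noteq> {} \<and> y' \<in> Q"
        using disjoint_pair_sides[OF PQ'(3,7,9)]
      proof
        assume "s \<in> P' \<and> y' \<in> Q'"
        then show ?thesis using PQ' by (intro exI[of _ P'] exI[of _ Q']) simp
      next
        assume "s \<in> Q' \<and> y' \<in> P'"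
        then show ?thesis using PQ' by (intro exI[of _ Q'] exI[of _ P']) (simp add: Int_commute)
      qed
      then obtain P2 Q2 where 2: "P2 \<subseteq> C" "Q2 \<subseteq> C" "P2 \<inter> Q2 = {}" "linked E' P2" "linked E' Q2" "P2 \<inter> B \<noteq> {}" "s \<in> P2" "Q2 \<inter> B \<noteq> {}" "y' \<in> Q2"
        by blast
      obtain pa where pa: "pa \<in> P1" "pa \<in> A" using 1(6) by auto
      obtain pb where pb: "pb \<in> P2" "pb \<in> B" using 2(6) by auto
      obtain P10 where P10: "linked E' P10" "s \<in> P10" "P10 \<subseteq> P1" "P10 \<inter> A \<noteq> {}"
          "\<forall>v\<in>P10 - {s}. joined E' (C - {s}) A {v}"
        using joined_trim[OF E'(2) 1(4,7) pa 1(1)] by (elim exE conjE) (rule that)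
      obtain P20 where P20: "linked E' P20" "s \<in> P20" "P20 \<subseteq> P2" "P20 \<inter> B \<noteq> {}"
          "\<forall>v\<in>P20 - {s}. joined E' (C - {s}) B {v}"
        using joined_trim[OF E'(2) 2(4,7) pb 2(1)] by (elim exE conjE) (rule that)
      have side: "joined E' (C - {s}) X {v}" if h: "linked E' Q" "Q \<subseteq> C" "s \<notin> Q" "Q \<inter> X \<noteq> {}" "v \<in> Q" for Q X v
      proof -
        obtain a where a: "a \<in> Q" "a \<in> X" using h(4) by auto
        have sub: "Q \<subseteq> C - {s}" using h by auto
        show ?thesis
          by (rule joinedI[OF a(2) _ _ _ restrict_rtrancl_mono[OF linkedD[OF h(1) a(1) h(5)] sub order_refl]])
            (use sub a h in auto)
      qed
      have Q1: "joined E' (C - {s}) A {v}" if "v \<in> Q1" for v using side[OF 1(5,2) _ 1(8) that] 1 by auto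
      have Q2: "joined E' (C - {s}) B {v}" if "v \<in> Q2" for v using side[OF 2(5,2) _ 2(8) that] 2 by auto
      \<comment> \<open>a node on both sides of \<open>s\<close> would connect \<open>A\<close> and \<open>B\<close> around \<open>s\<close>\<close>
      have clash: False if "joined E' (C - {s}) A {v}" "joined E' (C - {s}) B {v}" for v
        using s(2) joined_trans1[OF that(1) joined_sym[OF E'(2) that(2)]] by simp
      have "linked E (P10 \<union> P20)"
        using linked_mono[OF P10(1) E'(4)] linked_mono[OF P20(1) E'(4)] P10 P20 prems(2) by (intro linked_Un) auto
      moreover have "linked E (Q1 \<union> Q2)"
        using linked_mono[OF 1(5) E'(4)] linked_mono[OF 2(5) E'(4)] 1 2 prems(2) E'2 by (intro linked_Un_adj) (auto simp: adj_def)
      moreover have "(P10 \<union> P20) \<inter> (Q1 \<union> Q2) = {}"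
      proof -
        have "v \<notin> Q1 \<union> Q2" if "v \<in> P10 \<union> P20" for v
        proof (cases "v = s")
          case True then show ?thesis using 1 2 by auto
        next
          case False
          show ?thesis
          proof
            assume "v \<in> Q1 \<union> Q2"
            moreover have "v \<notin> Q1" if "v \<in> P10" using that P10(3) 1(3) by auto
            moreover have "v \<notin> Q2" if "v \<in> P20" using that P20(3) 2(3) by auto
            moreover have "v \<notin> Q2" if "v \<in> P10" using clash[OF P10(5)[rule_format] Q2, of v] that False by auto
            moreover have "v \<notin> Q1" if "v \<in> P20" using clash[OF Q1 P20(5)[rule_format], of v] that False by auto
            ultimately show False using that by auto
          qed
        qed
        then show ?thesis by blast
      qed
      moreover have "P10 \<union> P20 \<subseteq> C" "Q1 \<union> Q2 \<subseteq> C" using P10 P20 1 2 by auto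
      moreover have "(P10 \<union> P20) \<inter> A \<noteq> {}" "(P10 \<union> P20) \<inter> B \<noteq> {}" "(Q1 \<union> Q2) \<inter> A \<noteq> {}" "(Q1 \<union> Q2) \<inter> B \<noteq> {}"
        using P10(4) P20(4) 1(8) 2(8) by auto
      ultimately show ?thesis by (intro exI[of _ "P10 \<union> P20"] exI[of _ "Q1 \<union> Q2"]) simp
    qed
  qed
qed

section \<open>The two obstructions as branch sets\<close>

text \<open>
  Branch sets of a minor, as a list: for the small patterns below the recursion unfolds to an
  explicit conjunction that simplification can handle.
\<close>

fun branch_sets :: "('a \<times> 'a) set \<Rightarrow> 'a set \<Rightarrow> 'a set list \<Rightarrow> bool" where
  "branch_sets E V [] \<longleftrightarrow> True"
| "branch_sets E V (S # Ss) \<longleftrightarrow>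
     S \<noteq> {} \<and> S \<subseteq> V \<and> linked E S \<and> (\<forall>T\<in>set Ss. S \<inter> T = {}) \<and> branch_sets E V Ss"

text \<open>
  The names of the sets follow the node names of the two graphs: \<open>S12\<close> is the branch
  set of the node of degree two next to \<open>S1\<close> and \<open>S2\<close>, and in the second
  definition \<open>S13\<close> is the fourth node of the subdivided \<open>K\<^sub>4\<close>.
\<close>

definition has_F3 :: "('a \<times> 'a) set \<Rightarrow> 'a set \<Rightarrow> bool" where
  "has_F3 E V \<longleftrightarrow> (\<exists>S1 S2 S3 S12 S13 S23. branch_sets E V [S1, S2, S3, S12, S13, S23] \<and>
     adj E S1 S2 \<and> adj E S1 S3 \<and> adj E S2 S3 \<and> adj E S1 S12 \<and> adj E S2 S12 \<and>
     adj E S1 S13 \<and> adj E S3 S13 \<and> adj E S2 S23 \<and> adj E S3 S23)"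

definition has_H3 :: "('a \<times> 'a) set \<Rightarrow> 'a set \<Rightarrow> bool" where
  "has_H3 E V \<longleftrightarrow> (\<exists>S1 S2 S3 S12 S13 S23. branch_sets E V [S1, S2, S3, S12, S13, S23] \<and>
     adj E S1 S3 \<and> adj E S1 S13 \<and> adj E S3 S13 \<and> adj E S2 S13 \<and>
     adj E S1 S12 \<and> adj E S2 S12 \<and> adj E S2 S23 \<and> adj E S3 S23)"

lemma has_F3I:
  "branch_sets E V [S1, S2, S3, S12, S13, S23] \<Longrightarrow> adj E S1 S2 \<Longrightarrow> adj E S1 S3 \<Longrightarrow> adj E S2 S3 \<Longrightarrow>
   adj E S1 S12 \<Longrightarrow> adj E S2 S12 \<Longrightarrow> adj E S1 S13 \<Longrightarrow> adj E S3 S13 \<Longrightarrow> adj E S2 S23 \<Longrightarrow> adj E S3 S23 \<Longrightarrow> has_F3 E V"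
  unfolding has_F3_def by (intro exI conjI)

lemma has_H3I:
  "branch_sets E V [S1, S2, S3, S12, S13, S23] \<Longrightarrow> adj E S1 S3 \<Longrightarrow> adj E S1 S13 \<Longrightarrow> adj E S3 S13 \<Longrightarrow>
   adj E S2 S13 \<Longrightarrow> adj E S1 S12 \<Longrightarrow> adj E S2 S12 \<Longrightarrow> adj E S2 S23 \<Longrightarrow> adj E S3 S23 \<Longrightarrow> has_H3 E V"
  unfolding has_H3_def by (intro exI conjI)

section \<open>Decompositions with bags of two nodes\<close>

text \<open>
  \<open>dec E P C\<close>: the set \<open>C\<close> can be hung below a bag \<open>P\<close> as a
  forest of bags with at most two nodes, such that every edge inside \<open>C\<close> or between
  \<open>P\<close> and \<open>C\<close> lies in one bag or between two adjacent bags. The premise of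
  \<open>dec_move\<close> that restricts edges says that a node of \<open>P\<close> which is not
  carried over to the new bag \<open>X\<close> has all its neighbours in \<open>C\<close> inside
  \<open>X\<close>. Unlike in ordinary tree decompositions an edge may thus run between neighbouring
  bags, as the strong product with \<open>K\<^sub>2\<close> allows.
\<close>

inductive dec :: "('a \<times> 'a) set \<Rightarrow> 'a set \<Rightarrow> 'a set \<Rightarrow> bool" for E where
  dec_empty: "dec E P {}"
| dec_union: "dec E P C \<Longrightarrow> dec E P D \<Longrightarrow> C \<inter> D = {} \<Longrightarrow> \<not> adj E C D \<Longrightarrow> dec E P (C \<union> D)"
| dec_move: "X \<subseteq> P \<union> C \<Longrightarrow> finite X \<Longrightarrow> card X \<le> 2 \<Longrightarrow>
    (\<And>p c. p \<in> P - X \<Longrightarrow> c \<in> C \<Longrightarrow> (p, c) \<in> E \<Longrightarrow> c \<in> X) \<Longrightarrow> dec E X (C - X) \<Longrightarrow> dec E P C"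

section \<open>Triangles and paths of branch sets\<close>

text \<open>
  \<open>U\<close> contracts to a triangle in which \<open>a\<close> and \<open>b\<close> are in
  different corners. Used with \<open>U\<close> the outside of a bridge between \<open>a\<close> and
  \<open>b\<close>: the triangle supplies the part of \<open>F\<^sub>3\<close> or
  \<open>H\<^sub>3\<close> that lies outside of the bridge.
\<close>

definition fat :: "('a \<times> 'a) set \<Rightarrow> 'a set \<Rightarrow> 'a \<Rightarrow> 'a \<Rightarrow> bool" where
  "fat E U a b \<longleftrightarrow> (\<exists>X Y Z. branch_sets E U [X, Y, Z] \<and> a \<in> X \<and> b \<in> Y \<and> adj E X Y \<and> adj E X Z \<and> adj E Y Z)"

lemma fatI: "branch_sets E U [X, Y, Z] \<Longrightarrow> a \<in> X \<Longrightarrow> b \<in> Y \<Longrightarrow> adj E X Y \<Longrightarrow> adj E X Z \<Longrightarrow> adj E Y Z \<Longrightarrow> fat E U a b"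
  unfolding fat_def by (intro exI conjI)

lemma fatE:
  assumes "fat E U a b"
  obtains X Y Z where "branch_sets E U [X, Y, Z]" "a \<in> X" "b \<in> Y" "adj E X Y" "adj E X Z" "adj E Y Z"
  using assms unfolding fat_def by (elim exE conjE) (rule that)

lemma fat_commute:
  assumes "sym E" "fat E U a b" shows "fat E U b a"
  using assms(2)
proof (rule fatE)
  fix X Y Z assume "branch_sets E U [X, Y, Z]" "a \<in> X" "b \<in> Y" "adj E X Y" "adj E X Z" "adj E Y Z"
  then show ?thesis
    using adj_commute[OF assms(1), of X Y] by (intro fatI[of E U Y X Z]) auto
qed

text \<open>
  Two different neighbours of \<open>b\<close> in a connected set are the seeds of a partition of
  the set into two adjacent connected parts, each of which is adjacent to \<open>b\<close>. For
  \<open>b\<close> outside of the set, the parts and \<open>b\<close> form a triangle. The part that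
  contains the prescribed node \<open>c\<close> is listed first.
\<close>

lemma double_contact:
  assumes "sym E" "finite K" "linked E K" "c \<in> K" "y1 \<in> K" "y2 \<in> K" "y1 \<noteq> y2" "(b, y1) \<in> E" "(b, y2) \<in> E"
  obtains X Y where "c \<in> X" "X \<union> Y = K" "X \<inter> Y = {}" "Y \<noteq> {}" "linked E X" "linked E Y"
    "adj E X Y" "adj E {b} X" "adj E {b} Y"
proof -
  obtain X Y where XY: "y1 \<in> X" "y2 \<in> Y" "X \<union> Y = K" "X \<inter> Y = {}" "linked E X" "linked E Y" "adj E X Y"
    using linked_split[OF assms(1-3,5-7)] .
  have b: "adj E {b} X" "adj E {b} Y" using XY(1,2) assms by (auto intro: adjI)
  show thesis
  proof (cases "c \<in> X")
    case True
    show thesis by (rule that[of X Y]) (use XY b True in auto)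
  next
    case False
    show thesis by (rule that[of Y X]) (use XY b False assms adj_commute[OF assms(1)] in auto)
  qed
qed

text \<open>
  A path of three branch sets \<open>X\<close>, \<open>Y\<close>, \<open>W\<close> in which
  \<open>A\<close> meets the end \<open>X\<close> and the middle, and \<open>B\<close> meets both
  ends. With \<open>A\<close> and \<open>B\<close> the neighbourhoods of \<open>a\<close> and
  \<open>b\<close>, this is the part of \<open>H\<^sub>3\<close> between two of its nodes of degree
  three.
\<close>

definition zed :: "('a \<times> 'a) set \<Rightarrow> 'a set \<Rightarrow> 'a set \<Rightarrow> 'a set \<Rightarrow> bool" where
  "zed E C A B \<longleftrightarrow> (\<exists>X Y W. branch_sets E C [X, Y, W] \<and> adj E X Y \<and> adj E Y W \<and>
      A \<inter> X \<noteq> {} \<and> A \<inter> Y \<noteq> {} \<and> B \<inter> X \<noteq> {} \<and> B \<inter> W \<noteq> {})"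

lemma zedI:
  "branch_sets E C [X, Y, W] \<Longrightarrow> adj E X Y \<Longrightarrow> adj E Y W \<Longrightarrow>
   A \<inter> X \<noteq> {} \<Longrightarrow> A \<inter> Y \<noteq> {} \<Longrightarrow> B \<inter> X \<noteq> {} \<Longrightarrow> B \<inter> W \<noteq> {} \<Longrightarrow> zed E C A B"
  unfolding zed_def by (intro exI conjI)

text \<open>
  If \<open>A\<close> and \<open>B\<close> meet \<open>P\<close> in different nodes, then
  \<open>P\<close> splits into two parts, one for each; \<open>Q\<close>, which both
  \<open>A\<close> and \<open>B\<close> meet, is adjacent to one of the parts and becomes the end of
  the path of three sets. Which part it is decides the roles of \<open>A\<close> and
  \<open>B\<close>.
\<close>

lemma zed_of_split:
  assumes "sym E" "finite C" "linked E P" "linked E Q" "P \<union> Q = C" "P \<inter> Q = {}" "adj E P Q"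
    "x \<in> A \<inter> P" "y \<in> B \<inter> P" "x \<noteq> y" "Q \<inter> A \<noteq> {}" "Q \<inter> B \<noteq> {}"
  shows "zed E C A B \<or> zed E C B A"
proof -
  have fP: "finite P" using assms(2,5) by auto
  obtain X Y where XY: "x \<in> X" "y \<in> Y" "X \<union> Y = P" "X \<inter> Y = {}" "linked E X" "linked E Y" "adj E X Y"
    using linked_split[OF assms(1) fP assms(3), of x y] assms(8-10) by auto
  have m: "A \<inter> X \<noteq> {}" "B \<inter> Y \<noteq> {}" "A \<inter> Q \<noteq> {}" "B \<inter> Q \<noteq> {}"
    using XY(1,2) assms(8,9,11,12) by auto
  have "adj E Q X \<or> adj E Q Y" using assms(7) XY(3) adj_commute[OF assms(1), of P Q] by (auto simp: adj_def)
  then show ?thesis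
  proof
    assume a: "adj E Q X"
    have "branch_sets E C [Q, X, Y]" using XY assms(4-6,11) by auto
    from zedI[OF this a XY(7) m(3,1,4,2)] show ?thesis ..
  next
    assume a: "adj E Q Y"
    have "branch_sets E C [Q, Y, X]" using XY assms(4-6,11) by auto
    moreover have "adj E Y X" using XY(7) adj_commute[OF assms(1)] by blast
    ultimately have "zed E C B A" using a m by (intro zedI[of E C Q Y X])
    then show ?thesis ..
  qed
qed

text \<open>
  Two disjoint connectors grow until they partition \<open>C\<close>. A side on which
  \<open>A\<close> and \<open>B\<close> offer two different nodes can be split further; if neither
  side does, then \<open>A\<close> and \<open>B\<close> meet each side in one and the same node.
\<close>

lemma connectors_dichotomy:
  assumes "sym E" "finite C" "linked E C"
    "P \<subseteq> C" "Q \<subseteq> C" "P \<inter> Q = {}" "linked E P" "linked E Q"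
    "P \<inter> A \<noteq> {}" "P \<inter> B \<noteq> {}" "Q \<inter> A \<noteq> {}" "Q \<inter> B \<noteq> {}"
  shows "(\<exists>p q. p \<noteq> q \<and> A \<inter> C = {p, q} \<and> B \<inter> C = {p, q}) \<or> zed E C A B \<or> zed E C B A"
proof -
  have "P \<noteq> {}" "Q \<noteq> {}" using assms(9,11) by auto
  from linked_bipartition[OF assms(1-3,7,8,4-6) this]
  obtain P' Q' where PQ: "P \<subseteq> P'" "Q \<subseteq> Q'" "P' \<union> Q' = C" "P' \<inter> Q' = {}" "linked E P'" "linked E Q'" by auto
  have m: "P' \<inter> A \<noteq> {}" "P' \<inter> B \<noteq> {}" "Q' \<inter> A \<noteq> {}" "Q' \<inter> B \<noteq> {}" using assms(9-12) PQ(1,2) by auto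
  obtain x where x: "x \<in> P'" using m(1) by auto
  obtain y where y: "y \<in> Q'" using m(3) by auto
  obtain u v where "(u, v) \<in> E" "u \<in> C \<inter> P'" "v \<in> C - P'"
    using linked_edge_out[OF assms(3), of x P' y] x y PQ(3,4) by auto
  then have ad: "adj E P' Q'" "adj E Q' P'" using PQ(3) adj_commute[OF assms(1)] by (auto simp: adj_def)
  show ?thesis
  proof (cases "\<exists>x y. x \<in> A \<inter> P' \<and> y \<in> B \<inter> P' \<and> x \<noteq> y")
    case True
    then obtain x y where "x \<in> A \<inter> P'" "y \<in> B \<inter> P'" "x \<noteq> y" by auto
    from zed_of_split[OF assms(1,2) PQ(5,6,3,4) ad(1) this m(3,4)] show ?thesis by simp
  next
    case nP: False
    show ?thesis
    proof (cases "\<exists>x y. x \<in> A \<inter> Q' \<and> y \<in> B \<inter> Q' \<and> x \<noteq> y")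
      case True
      then obtain x y where "x \<in> A \<inter> Q'" "y \<in> B \<inter> Q'" "x \<noteq> y" by auto
      moreover have "Q' \<union> P' = C" "Q' \<inter> P' = {}" using PQ by auto
      ultimately show ?thesis using zed_of_split[OF assms(1,2) PQ(6,5) _ _ ad(2) _ _ _ m(1,2), of x y] by auto
    next
      case nQ: False
      obtain p where p: "p \<in> P'" "p \<in> A" using m by auto
      obtain q where q: "q \<in> Q'" "q \<in> A" using m by auto
      have P: "A \<inter> P' = {p}" "B \<inter> P' = {p}" using nP p m(2) by auto
      have Q: "A \<inter> Q' = {q}" "B \<inter> Q' = {q}" using nQ q m(4) by auto
      have "p \<noteq> q" using p q PQ(4) by auto
      moreover have "A \<inter> C = {p, q}" "B \<inter> C = {p, q}" using P Q PQ(3) by auto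
      ultimately show ?thesis by blast
    qed
  qed
qed

text \<open>
  The nodes of degree three of \<open>H\<^sub>3\<close> are \<open>a\<close>, \<open>b\<close>, and
  two of the sets inside \<open>C\<close>; the set \<open>R\<close> outside subdivides the edge
  between \<open>a\<close> and \<open>b\<close>, and \<open>W\<close> subdivides the edge between
  \<open>b\<close> and the middle set.
\<close>

lemma H3_of_zed:
  assumes "sym E" "zed E C {x. (a, x) \<in> E} {x. (b, x) \<in> E}" "branch_sets E U [S, T, R]" "a \<in> S" "b \<in> T"
    "adj E S R" "adj E T R" "C \<inter> U = {}" "C \<subseteq> V" "U \<subseteq> V"
  shows "has_H3 E V"
proof -
  obtain X Y W where Z: "branch_sets E C [X, Y, W]" "adj E X Y" "adj E Y W"
      "{x. (a, x) \<in> E} \<inter> X \<noteq> {}" "{x. (a, x) \<in> E} \<inter> Y \<noteq> {}" "{x. (b, x) \<in> E} \<inter> X \<noteq> {}" "{x. (b, x) \<in> E} \<inter> W \<noteq> {}"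
    using assms(2) unfolding zed_def by (elim exE conjE) (rule that)
  have a: "adj E S X" "adj E S Y" "adj E T X" "adj E T W" using Z(4-7) assms(4,5) by (auto simp: adj_def)
  have "branch_sets E V [S, T, Y, R, X, W]"
  proof -
    have C: "X \<subseteq> C" "Y \<subseteq> C" "W \<subseteq> C" and U: "S \<subseteq> U" "T \<subseteq> U" "R \<subseteq> U"
      using Z(1) assms(3) by simp_all
    have disj: "K \<inter> L = {}" if "K \<subseteq> U" "L \<subseteq> C" for K L using that assms(8) by blast
    have "S \<inter> X = {}" "S \<inter> Y = {}" "S \<inter> W = {}" "T \<inter> X = {}" "T \<inter> Y = {}" "T \<inter> W = {}"
      "R \<inter> X = {}" "R \<inter> Y = {}" "R \<inter> W = {}"
      using disj[OF U(1) C(1)] disj[OF U(1) C(2)] disj[OF U(1) C(3)] disj[OF U(2) C(1)] disj[OF U(2) C(2)]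
        disj[OF U(2) C(3)] disj[OF U(3) C(1)] disj[OF U(3) C(2)] disj[OF U(3) C(3)] by blast+
    moreover have "X \<subseteq> V" "Y \<subseteq> V" "W \<subseteq> V" "S \<subseteq> V" "T \<subseteq> V" "R \<subseteq> V"
      using C U assms(9,10) by simp_all
    ultimately show ?thesis using Z(1) assms(3) by (simp add: Int_commute)
  qed
  moreover have "adj E Y X" using Z(2) adj_commute[OF assms(1)] by blast
  ultimately show ?thesis
    by (intro has_H3I[of E V S T Y R X W]) (use a Z(3) assms(6,7) in simp_all)
qed

section \<open>Bridges between two nodes\<close>

locale fin_graph =
  fixes V :: "'a set" and E :: "('a \<times> 'a) set"
  assumes finV: "finite V" and EV: "E \<subseteq> V \<times> V" and symE: "sym E" and irreflE: "irrefl E"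
begin

lemma finE: "finite E" using finV EV by (meson finite_SigmaI finite_subset)
lemma no_loop [simp]: "(x, x) \<notin> E" using irreflE by (auto simp: irrefl_def)
lemma edge_sym: "(x, y) \<in> E \<Longrightarrow> (y, x) \<in> E" using symE by (rule symD)
lemma edge_in: "(x, y) \<in> E \<Longrightarrow> x \<in> V" "(x, y) \<in> E \<Longrightarrow> y \<in> V" using EV by auto
lemma adj_sym: "adj E X Y \<Longrightarrow> adj E Y X" using adj_commute[OF symE] by blast

definition closed_mod :: "'a set \<Rightarrow> 'a set \<Rightarrow> bool" where
  "closed_mod P S \<longleftrightarrow> (\<forall>x\<in>S. \<forall>y. (x, y) \<in> E \<longrightarrow> y \<in> S \<union> P)"

text \<open>
  A connected component of the graph without \<open>a\<close> and \<open>b\<close>.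
\<close>

definition bridge :: "'a \<Rightarrow> 'a \<Rightarrow> 'a set \<Rightarrow> bool" where
  "bridge a b C \<longleftrightarrow> a \<in> V \<and> b \<in> V \<and> a \<noteq> b \<and> C \<noteq> {} \<and> C \<subseteq> V - {a, b} \<and> linked E C \<and> closed_mod {a, b} C"

text \<open>
  The whole graph hangs below a bag of two nodes.
\<close>

definition decomposable :: bool where
  "decomposable \<longleftrightarrow> (\<exists>a b. a \<in> V \<and> b \<in> V \<and> a \<noteq> b \<and> dec E {a, b} (V - {a, b}))"

lemma bridge_commute: "bridge a b C \<Longrightarrow> bridge b a C"
  by (auto simp: bridge_def insert_commute)

lemma closed_modD: "closed_mod P S \<Longrightarrow> x \<in> S \<Longrightarrow> (x, y) \<in> E \<Longrightarrow> y \<in> S \<union> P"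
  by (auto simp: closed_mod_def)

lemma closed_mod_compl: "closed_mod P S \<Longrightarrow> closed_mod P (V - P - S)"
  using EV edge_sym by (fastforce simp: closed_mod_def)

lemma closed_mod_Diff: "closed_mod P S \<Longrightarrow> closed_mod P T \<Longrightarrow> S \<inter> P = {} \<Longrightarrow> closed_mod P (S - T)"
  unfolding closed_mod_def using edge_sym by blast

lemma component_bridge:
  assumes "a \<in> V" "b \<in> V" "a \<noteq> b" "S \<subseteq> V - {a, b}" "closed_mod {a, b} S" "x \<in> S"
  shows "bridge a b (component E S x)"
proof -
  have s: "component E S x \<subseteq> S" by (rule component_subset[OF assms(6)])
  have "closed_mod {a, b} (component E S x)"
    unfolding closed_mod_def
  proof (intro ballI allI impI)
    fix u y assume u: "u \<in> component E S x" "(u, y) \<in> E"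
    from u(1) s have "u \<in> S" by blast
    from closed_modD[OF assms(5) this u(2)] have "y \<in> S \<union> {a, b}" .
    then show "y \<in> component E S x \<union> {a, b}" using component_closed[OF assms(6) u] by auto
  qed
  then show ?thesis unfolding bridge_def
    using assms s component_linked[OF symE] component_self[of x E S] by (auto simp del: component_self)
qed

lemma closed_absorb:
  assumes "closed_mod P C" "linked E T" "T \<inter> P = {}" "T \<inter> C \<noteq> {}"
  shows "T \<subseteq> C"
proof (rule ccontr)
  assume "\<not> ?thesis"
  then obtain x y where "x \<in> T \<inter> C" "y \<in> T - C" using assms by auto
  with linked_edge_out[OF assms(2), of x C y] obtain u v where "(u, v) \<in> E" "u \<in> C" "v \<in> T - C" by auto
  then show False using assms(1,3) closed_modD[of P C u v] by auto
qed

lemma bridge_absorb: "bridge a b C \<Longrightarrow> linked E T \<Longrightarrow> T \<inter> {a, b} = {} \<Longrightarrow> T \<inter> C \<noteq> {} \<Longrightarrow> T \<subseteq> C"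
  using closed_absorb[of "{a, b}" C T] by (auto simp: bridge_def)

lemma bridges_eq: "bridge a b C \<Longrightarrow> bridge a b D \<Longrightarrow> C \<inter> D \<noteq> {} \<Longrightarrow> C = D"
  using bridge_absorb[of a b C D] bridge_absorb[of a b D C] by (auto simp: bridge_def)

text \<open>
  Different bridges are not adjacent, so their decompositions can hang side by side below the same
  bag.
\<close>

lemma dec_of_bridges:
  assumes "a \<in> V" "b \<in> V" "a \<noteq> b" "S \<subseteq> V - {a, b}" "closed_mod {a, b} S"
    "\<And>C. bridge a b C \<Longrightarrow> C \<subseteq> S \<Longrightarrow> dec E {a, b} C"
  shows "dec E {a, b} S"
  using assms(4-)
proof (induction "card S" arbitrary: S rule: less_induct)
  case less
  show ?case
  proof (cases "S = {}")
    case True then show ?thesis by (simp add: dec_empty)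
  next
    case False
    then obtain x where x: "x \<in> S" by auto
    let ?C = "component E S x"
    have br: "bridge a b ?C" using component_bridge[OF assms(1-3) less.prems(1,2) x] .
    have s: "?C \<subseteq> S" "x \<in> ?C" using component_subset[OF x] by auto
    have fS: "finite S" using less.prems finV by (meson Diff_subset finite_subset)
    have lt: "card (S - ?C) < card S" by (rule psubset_card_mono[OF fS]) (use s x in blast)
    have cl: "closed_mod {a, b} (S - ?C)"
      using br less.prems(1) by (intro closed_mod_Diff less.prems) (auto simp: bridge_def)
    have "dec E {a, b} (S - ?C)"
      by (rule less.hyps[OF lt]) (use less.prems cl in auto)
    moreover have "dec E {a, b} ?C" using less.prems(3) br s by blast
    moreover have "\<not> adj E ?C (S - ?C)"
      using component_closed[OF x] by (auto simp: adj_def)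
    ultimately have "dec E {a, b} (?C \<union> (S - ?C))" by (intro dec_union) auto
    then show ?thesis using s by (simp add: Un_absorb1)
  qed
qed

lemma decomposable_of_bridges:
  assumes "a \<in> V" "b \<in> V" "a \<noteq> b" "\<And>C. bridge a b C \<Longrightarrow> dec E {a, b} C"
  shows decomposable
  unfolding decomposable_def
  by (rule exI[of _ a], rule exI[of _ b], intro conjI assms dec_of_bridges)
    (use EV in \<open>auto simp: closed_mod_def\<close>)

end

section \<open>Bridges with a fat outside\<close>

locale biconnected = fin_graph +
  assumes linkedV: "linked E V" and linked_del: "\<And>v. v \<in> V \<Longrightarrow> linked E (V - {v})"
begin

abbreviation N where "N a \<equiv> {x. (a, x) \<in> E}"

text \<open>
  Otherwise the other end would be a cut node.
\<close>

lemma bridge_contact: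
  assumes "bridge a b C"
  shows "N a \<inter> C \<noteq> {}" "N b \<inter> C \<noteq> {}"
proof -
  have *: "N a \<inter> C \<noteq> {}" if br: "bridge a b C" for a b
  proof -
    have b: "b \<in> V" "a \<in> V - {b}" "C \<subseteq> V - {b}" "a \<notin> C" "closed_mod {a, b} C" using br by (auto simp: bridge_def)
    obtain x where "x \<in> C" using br by (auto simp: bridge_def)
    with linked_edge_out[OF linked_del[OF b(1)], of x C a] b
    obtain u v where uv: "(u, v) \<in> E" "u \<in> C" "v \<in> V - {b} - C" by auto
    from closed_modD[OF b(5) uv(2,1)] uv have "v = a" by auto
    with uv edge_sym have "u \<in> N a \<inter> C" by auto
    then show ?thesis by blast
  qed
  show "N a \<inter> C \<noteq> {}" "N b \<inter> C \<noteq> {}" using *[OF assms] *[OF bridge_commute[OF assms]] by auto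
qed

lemma bridge_adj:
  assumes "bridge a b C" shows "adj E {a} C" "adj E {b} C"
  using bridge_contact[OF assms] by (auto simp: adj_def)

text \<open>
  A node \<open>c\<close> of the bridge separates the neighbours of \<open>a\<close> in it from
  those of \<open>b\<close>. Both sides, each with \<open>c\<close> added, are connected, and since
  \<open>a\<close> and \<open>b\<close> have two neighbours each, both sides split into two adjacent
  parts that both touch \<open>a\<close>, respectively \<open>b\<close>. The two sides share only
  \<open>c\<close>.
\<close>

lemma cut_sides:
  assumes br: "bridge a b C" and c: "c \<in> C" "\<not> joined E (C - {c}) (N a) (N b)"
    and ne: "y1 \<in> N b \<inter> C" "y2 \<in> N b \<inter> C" "y1 \<noteq> y2" "x1 \<in> N a \<inter> C" "x2 \<in> N a \<inter> C" "x1 \<noteq> x2"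
  obtains X1 Y1 X2 Y2 where
    "c \<in> X1" "Y1 \<noteq> {}" "X1 \<inter> Y1 = {}" "linked E X1" "linked E Y1" "adj E X1 Y1" "adj E {b} X1" "adj E {b} Y1"
    "c \<in> X2" "Y2 \<noteq> {}" "X2 \<inter> Y2 = {}" "linked E X2" "linked E Y2" "adj E X2 Y2" "adj E {a} X2" "adj E {a} Y2"
    "X1 \<union> Y1 \<subseteq> C" "X2 \<union> Y2 \<subseteq> C" "(X1 \<union> Y1) \<inter> (X2 \<union> Y2) = {c}"
    "linked E (insert b (X1 \<union> Y1 - {c}))" "closed_mod {a, c} (X2 \<union> Y2 - {c})"
proof -
  let ?D = "C - {c}"
  \<comment> \<open>\<open>B\<close> is what the neighbours of \<open>b\<close> reach without \<open>c\<close>; everything else goes to the side of \<open>a\<close>\<close>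
  define B where "B = {x \<in> ?D. joined E ?D (N b) {x}}"
  define A where "A = ?D - B"
  have C: "C \<subseteq> V" "linked E C" "a \<notin> C" "b \<notin> C" "finite C" "closed_mod {a, b} C" "a \<noteq> b"
    using br finV by (auto simp: bridge_def intro: finite_subset)
  have Bstep: "y \<in> B" if xy: "x \<in> B" "(x, y) \<in> E" "y \<in> ?D" for x y
  proof -
    have x: "x \<in> ?D" "joined E ?D (N b) {x}" using xy(1) by (auto simp: B_def)
    have "joined E ?D {x} {y}"
      by (rule joinedI[of x _ _ y]) (use x(1) xy in \<open>auto intro: r_into_rtrancl\<close>)
    from joined_trans1[OF x(2) this] xy(3) show ?thesis by (simp add: B_def)
  qed
  have Bb: "N b \<inter> ?D \<subseteq> B"
  proof
    fix x assume x: "x \<in> N b \<inter> ?D"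
    have "joined E ?D (N b) {x}" by (rule joinedI[of x _ _ x]) (use x in auto)
    with x show "x \<in> B" by (simp add: B_def)
  qed
  have Ba: "N a \<inter> B = {}"
  proof (rule ccontr)
    assume "\<not> ?thesis"
    then obtain x where x: "x \<in> N a" "x \<in> B" by auto
    have 1: "joined E ?D (N b) {x}" using x by (simp add: B_def)
    have "joined E ?D {x} (N a)" by (rule joinedI[of x _ _ x]) (use x in \<open>auto simp: B_def\<close>)
    from joined_sym[OF symE joined_trans1[OF 1 this]] c(2) show False by simp
  qed
  have Bc: "y \<in> insert c B" if "x \<in> B" "(x, y) \<in> E" "y \<in> C" for x y using Bstep[OF that(1,2)] that(3) by auto
  have Ac: "y \<in> insert c A" if "x \<in> A" "(x, y) \<in> E" "y \<in> C" for x y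
    using Bstep[OF _ edge_sym[OF that(2)]] that by (auto simp: A_def)
  have lA: "linked E (insert c A)"
    by (rule linked_insert_closed[OF symE C(2) c(1)]) (use Ac in \<open>auto simp: A_def\<close>)
  have lB: "linked E (insert c B)"
    by (rule linked_insert_closed[OF symE C(2) c(1)]) (use Bc in \<open>auto simp: B_def\<close>)
  have f: "finite (insert c A)" "finite (insert c B)" using C(5) by (auto simp: A_def B_def)
  have y: "y1 \<in> insert c B" "y2 \<in> insert c B" using ne(1,2) Bb by auto
  have x: "x1 \<in> insert c A" "x2 \<in> insert c A" using ne(4,5) Ba by (auto simp: A_def)
  obtain X1 Y1 where 1: "c \<in> X1" "X1 \<union> Y1 = insert c B" "X1 \<inter> Y1 = {}" "Y1 \<noteq> {}" "linked E X1" "linked E Y1"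
    "adj E X1 Y1" "adj E {b} X1" "adj E {b} Y1"
    using double_contact[OF symE f(2) lB _ y ne(3), of c b] ne(1,2) by auto
  obtain X2 Y2 where 2: "c \<in> X2" "X2 \<union> Y2 = insert c A" "X2 \<inter> Y2 = {}" "Y2 \<noteq> {}" "linked E X2" "linked E Y2"
    "adj E X2 Y2" "adj E {a} X2" "adj E {a} Y2"
    using double_contact[OF symE f(1) lA _ x ne(6), of c a] ne(4,5) by auto
  have cAB: "c \<notin> A" "c \<notin> B" "A \<inter> B = {}" "A \<subseteq> C" "B \<subseteq> C" by (auto simp: A_def B_def)
  have "linked E (insert b B)"
  proof (rule linkedI_center[OF symE, of _ b])
    fix x assume "x \<in> insert b B"
    then show "(b, x) \<in> (E \<inter> insert b B \<times> insert b B)\<^sup>*"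
    proof
      assume "x \<in> B"
      then have "joined E ?D (N b) {x}" by (simp add: B_def)
      then obtain y where y: "y \<in> N b" "y \<in> ?D" "(y, x) \<in> (E \<inter> ?D \<times> ?D)\<^sup>*" by (elim joinedE) auto
      let ?T = "component E ?D y"
      have yB: "y \<in> B" using y Bb by auto
      have TB: "?T \<subseteq> B"
      proof
        fix z assume z: "z \<in> ?T"
        have "joined E ?D (N b) {z}"
          by (rule joinedI[of y _ _ z]) (use y z component_subset[OF y(2), of E] in \<open>auto simp: component_def\<close>)
        then show "z \<in> B" using component_subset[OF y(2), of E] z by (auto simp: B_def)
      qed
      have "linked E (insert b ?T)"
        by (rule linked_insert[OF symE component_linked[OF symE], of y]) (use y in auto)
      from linkedD[OF this, of b x] have "(b, x) \<in> (E \<inter> insert b ?T \<times> insert b ?T)\<^sup>*"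
        using y(3) by (simp add: component_def)
      then show ?thesis by (rule restrict_rtrancl_mono) (use TB in auto)
    qed simp
  qed
  moreover have "X1 \<union> Y1 - {c} = B" "X2 \<union> Y2 - {c} = A" using 1(2) 2(2) cAB by auto
  moreover have "closed_mod {a, c} A"
    unfolding closed_mod_def
  proof (intro ballI allI impI)
    fix x y assume xy: "x \<in> A" "(x, y) \<in> E"
    then have "y \<in> C \<union> {a, b}" using closed_modD[OF C(6) _ xy(2)] cAB by auto
    moreover have "y \<noteq> b" using xy Bb edge_sym by (auto simp: A_def)
    ultimately show "y \<in> A \<union> {a, c}" using Ac[OF xy] by auto
  qed
  moreover have "(X1 \<union> Y1) \<inter> (X2 \<union> Y2) = {c}" "X1 \<union> Y1 \<subseteq> C" "X2 \<union> Y2 \<subseteq> C"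
    unfolding 1(2) 2(2) using cAB c(1) by auto
  ultimately show thesis using 1 2 by (intro that[of X1 Y1 X2 Y2]) simp_all
qed

text \<open>
  Without a separating node there are two disjoint connectors between the neighbourhoods of
  \<open>a\<close> and \<open>b\<close> in \<open>C\<close>. By the dichotomy above they give a path
  of three branch sets, which completes to \<open>H\<^sub>3\<close> through the sets outside of
  \<open>C\<close>, unless \<open>a\<close> and \<open>b\<close> have the same two neighbours in
  \<open>C\<close>.
\<close>

lemma twin_contacts:
  assumes "\<not> has_H3 E V" "C \<subseteq> V" "C \<noteq> {}" "linked E C"
    "\<And>c. c \<in> C \<Longrightarrow> joined E (C - {c}) (N a) (N b)"
    "branch_sets E U [S, T, R]" "a \<in> S" "b \<in> T" "adj E S R" "adj E T R" "C \<inter> U = {}" "U \<subseteq> V"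
  obtains p q where "p \<noteq> q" "N a \<inter> C = {p, q}" "N b \<inter> C = {p, q}"
proof -
  have fC: "finite C" using assms finV by (blast intro: finite_subset)
  obtain c where "c \<in> C" using assms(3) by auto
  then have "joined E C (N a) (N b)" by (rule joined_mono[OF assms(5)]) auto
  have "\<exists>P Q. P \<subseteq> C \<and> Q \<subseteq> C \<and> P \<inter> Q = {} \<and> linked E P \<and> linked E Q \<and>
      P \<inter> N a \<noteq> {} \<and> P \<inter> N b \<noteq> {} \<and> Q \<inter> N a \<noteq> {} \<and> Q \<inter> N b \<noteq> {}"
    by (rule two_disjoint_connectors[OF finE symE irreflE fC \<open>joined E C (N a) (N b)\<close> assms(5)])
  then obtain P Q where PQ: "P \<subseteq> C" "Q \<subseteq> C" "P \<inter> Q = {}" "linked E P" "linked E Q"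
     "P \<inter> N a \<noteq> {}" "P \<inter> N b \<noteq> {}" "Q \<inter> N a \<noteq> {}" "Q \<inter> N b \<noteq> {}"
    by (elim exE conjE) (rule that)
  have "\<not> zed E C (N a) (N b)"
    using H3_of_zed[OF symE _ assms(6-11,2,12)] assms(1) by blast
  moreover have "\<not> zed E C (N b) (N a)"
  proof
    assume z: "zed E C (N b) (N a)"
    have "branch_sets E U [T, S, R]" using assms(6) by auto
    from H3_of_zed[OF symE z this assms(8,7,10,9,11,2,12)] assms(1) show False by simp
  qed
  ultimately have "\<exists>p q. p \<noteq> q \<and> N a \<inter> C = {p, q} \<and> N b \<inter> C = {p, q}"
    using connectors_dichotomy[OF symE fC assms(4) PQ] by blast
  then show thesis using that by blast
qed

lemma closed_of_one_contact:
  assumes "bridge a b C" "N b \<inter> C = {c}"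
  shows "closed_mod {a, c} (C - {c})"
  unfolding closed_mod_def
proof (intro ballI allI impI)
  fix x y assume xy: "x \<in> C - {c}" "(x, y) \<in> E"
  then have "y \<in> C \<union> {a, b}" using assms(1) closed_modD[of "{a, b}" C x y] by (auto simp: bridge_def)
  moreover have "y \<noteq> b" using assms(2) xy edge_sym by blast
  ultimately show "y \<in> C - {c} \<union> {a, c}" by auto
qed

text \<open>
  The single neighbour \<open>c\<close> of \<open>b\<close> in the bridge replaces \<open>b\<close>
  in the bag. The bridges between \<open>a\<close> and \<open>c\<close> inside \<open>C\<close> are
  smaller, and their outside is fat because the corner of \<open>b\<close> absorbs \<open>c\<close>.
\<close>

lemma dec_of_fat_one_contact:
  assumes br: "bridge a b C" and ft: "fat E (V - C) a b" and N1: "N b \<inter> C = {c}"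
    and IH: "\<And>a b C'. card C' < card C \<Longrightarrow> bridge a b C' \<Longrightarrow> fat E (V - C') a b \<Longrightarrow> dec E {a, b} C'"
  shows "dec E {a, b} C"
proof (rule dec_move[of "{a, c}"])
  have C: "C \<subseteq> V" "linked E C" "a \<notin> C" "b \<notin> C" "finite C" "closed_mod {a, b} C" "a \<noteq> b" "a \<in> V" "b \<in> V"
    using br finV by (auto simp: bridge_def intro: finite_subset)
  have c: "c \<in> C" "(b, c) \<in> E" using N1 by auto
  show "{a, c} \<subseteq> {a, b} \<union> C" "finite {a, c}" "card {a, c} \<le> 2" using c by (auto simp: card_insert_if)
  show "x \<in> {a, c}" if "p \<in> {a, b} - {a, c}" "x \<in> C" "(p, x) \<in> E" for p x using that N1 by auto
  have "C - {a, c} = C - {c}" using C by auto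
  with closed_of_one_contact[OF br N1] have cl: "closed_mod {a, c} (C - {a, c})" by simp
  show "dec E {a, c} (C - {a, c})"
  proof (rule dec_of_bridges[OF _ _ _ _ cl])
    fix D assume D: "bridge a c D" "D \<subseteq> C - {a, c}"
    have lt: "card D < card C" by (rule psubset_card_mono[OF C(5)]) (use D c in auto)
    obtain X Y Z where F: "branch_sets E (V - C) [X, Y, Z]" "a \<in> X" "b \<in> Y" "adj E X Y" "adj E X Z" "adj E Y Z"
      using ft by (rule fatE)
    have "linked E (insert c Y)" by (rule linked_insert[OF symE, of _ b]) (use F c edge_sym in auto)
    then have "branch_sets E (V - D) [X, insert c Y, Z]" using F(1) D(2) c(1) C(1) by auto
    moreover have "adj E X (insert c Y)" "adj E (insert c Y) Z" using F(4,6) by (auto simp: adj_def)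
    ultimately have "fat E (V - D) a c" using F(2,5) by (intro fatI[of E _ X "insert c Y" Z]) auto
    then show "dec E {a, c} D" using IH[OF lt D(1)] by simp
  qed (use c C in auto)
qed

text \<open>
  The bag \<open>{a, b}\<close> moves to \<open>{p, q}\<close> in one step, since all edges between
  the bag and the bridge end in \<open>p\<close> or \<open>q\<close>. The outside of every bridge
  between \<open>p\<close> and \<open>q\<close> that lies in \<open>C\<close> contains the 4-cycle
  \<open>a\<close>, \<open>p\<close>, \<open>b\<close>, \<open>q\<close> and is therefore fat.
\<close>

lemma dec_of_twin_contacts:
  assumes br: "bridge a b C" and pq: "p \<noteq> q" "N a \<inter> C = {p, q}" "N b \<inter> C = {p, q}"
    and sub: "\<And>D. bridge p q D \<Longrightarrow> D \<subseteq> C - {p, q} \<Longrightarrow> fat E (V - D) p q \<Longrightarrow> dec E {p, q} D"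
  shows "dec E {a, b} C"
proof (rule dec_move[of "{p, q}"])
  have C: "C \<subseteq> V" "a \<notin> C" "b \<notin> C" "closed_mod {a, b} C" "a \<noteq> b" "a \<in> V" "b \<in> V"
    using br by (auto simp: bridge_def)
  show "{p, q} \<subseteq> {a, b} \<union> C" "finite {p, q}" "card {p, q} \<le> 2" using pq by (auto simp: card_insert_if)
  show "x \<in> {p, q}" if "r \<in> {a, b} - {p, q}" "x \<in> C" "(r, x) \<in> E" for r x using that pq by auto
  have pqC: "p \<in> C" "q \<in> C" "(a, p) \<in> E" "(a, q) \<in> E" "(b, p) \<in> E" "(b, q) \<in> E" using pq by auto
  have cl: "closed_mod {p, q} (C - {p, q})"
    unfolding closed_mod_def
  proof (intro ballI allI impI)
    fix x y assume xy: "x \<in> C - {p, q}" "(x, y) \<in> E"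
    then have "y \<in> C \<union> {a, b}" using closed_modD[OF C(4) _ xy(2)] by auto
    moreover have "y \<noteq> b" "y \<noteq> a" using pq xy edge_sym by blast+
    ultimately show "y \<in> C - {p, q} \<union> {p, q}" by auto
  qed
  show "dec E {p, q} (C - {p, q})"
  proof (rule dec_of_bridges[OF _ _ pq(1) _ cl])
    fix D assume D: "bridge p q D" "D \<subseteq> C - {p, q}"
    have "linked E {p, a}" using pqC edge_sym by (intro linked_edge symE) auto
    then have "branch_sets E (V - D) [{p, a}, {q}, {b}]"
      using D(2) pqC(1,2) C pq(1) by auto
    then have "fat E (V - D) p q"
      using pqC edge_sym by (intro fatI[of E _ "{p, a}" "{q}" "{b}"]) (auto simp: adj_def)
    then show "dec E {p, q} D" using sub[OF D] by simp
  qed (use pqC C in auto)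
qed

text \<open>
  Induction on the bridge. If one of \<open>a\<close>, \<open>b\<close> has a single neighbour in
  it, the bag moves on. Otherwise a node \<open>c\<close> that separates the two neighbourhoods
  inside the bridge gives \<open>F\<^sub>3\<close>: its triangle consists of the corners of
  \<open>a\<close> and \<open>b\<close> outside and of the two parts around \<open>c\<close>, and
  its three ears are the third corner outside and the remaining part on either side of
  \<open>c\<close>. Without such a node, exclusion of \<open>H\<^sub>3\<close> leaves only the case
  that \<open>a\<close> and \<open>b\<close> have the same two neighbours.
\<close>

theorem dec_of_fat:
  assumes "\<not> has_F3 E V" "\<not> has_H3 E V" "bridge a b C" "fat E (V - C) a b"
  shows "dec E {a, b} C"
  using assms(3,4)
proof (induction "card C" arbitrary: a b C rule: less_induct)
  case less
  note br = less.prems(1) and ft = less.prems(2)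
  have IH: "card C' < card C \<Longrightarrow> bridge a b C' \<Longrightarrow> fat E (V - C') a b \<Longrightarrow> dec E {a, b} C'" for a b C'
    by (rule less.hyps)
  have C: "C \<subseteq> V" "linked E C" "a \<notin> C" "b \<notin> C" "finite C" "closed_mod {a, b} C" "a \<noteq> b" "a \<in> V" "b \<in> V" "C \<noteq> {}"
    using br finV by (auto simp: bridge_def intro: finite_subset)
  obtain X Y Z where F: "branch_sets E (V - C) [X, Y, Z]" "a \<in> X" "b \<in> Y" "adj E X Y" "adj E X Z" "adj E Y Z"
    using ft by (rule fatE)
  obtain y1 where y1: "y1 \<in> N b \<inter> C" using bridge_contact[OF br] by auto
  obtain x1 where x1: "x1 \<in> N a \<inter> C" using bridge_contact[OF br] by auto
  show ?case
  proof (cases "N b \<inter> C = {y1}")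
    case True
    show ?thesis by (rule dec_of_fat_one_contact[OF br ft True IH])
  next
    case y: False
    show ?thesis
    proof (cases "N a \<inter> C = {x1}")
      case True
      have "dec E {b, a} C"
        by (rule dec_of_fat_one_contact[OF bridge_commute[OF br] fat_commute[OF symE ft] True IH])
      then show ?thesis by (simp add: insert_commute)
    next
      case x: False
      obtain y2 where y2: "y2 \<in> N b \<inter> C" "y1 \<noteq> y2" using y y1 by auto
      obtain x2 where x2: "x2 \<in> N a \<inter> C" "x1 \<noteq> x2" using x x1 by auto
      show ?thesis
      proof (cases "\<forall>c\<in>C. joined E (C - {c}) (N a) (N b)")
        case False
        then obtain c where c: "c \<in> C" "\<not> joined E (C - {c}) (N a) (N b)" by auto
        obtain X1 Y1 X2 Y2 where S:
          "c \<in> X1" "Y1 \<noteq> {}" "X1 \<inter> Y1 = {}" "linked E X1" "linked E Y1" "adj E X1 Y1" "adj E {b} X1" "adj E {b} Y1"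
          "c \<in> X2" "Y2 \<noteq> {}" "X2 \<inter> Y2 = {}" "linked E X2" "linked E Y2" "adj E X2 Y2" "adj E {a} X2" "adj E {a} Y2"
          "X1 \<union> Y1 \<subseteq> C" "X2 \<union> Y2 \<subseteq> C" "(X1 \<union> Y1) \<inter> (X2 \<union> Y2) = {c}"
          by (rule cut_sides[OF br c y1 y2 x1 x2])
        have l: "linked E (X1 \<union> X2)" using S by (intro linked_Un[OF symE]) auto
        have d: "(X1 \<union> X2) \<inter> Y1 = {}" "(X1 \<union> X2) \<inter> Y2 = {}" "Y2 \<inter> Y1 = {}" using S(1,3,9,11,19) by auto
        have d2: "T \<inter> (X1 \<union> X2) = {}" "T \<inter> Y1 = {}" "T \<inter> Y2 = {}" if "T \<subseteq> V - C" for T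
          using that S(17,18) by auto
        have F': "X \<subseteq> V - C" "Y \<subseteq> V - C" "Z \<subseteq> V - C" using F(1) by auto
        have v: "X1 \<union> X2 \<subseteq> V" "Y1 \<subseteq> V" "Y2 \<subseteq> V" "X \<subseteq> V" "Y \<subseteq> V" "Z \<subseteq> V" using S(17,18) C(1) F' by auto
        have "branch_sets E V [X, Y, X1 \<union> X2, Z, Y2, Y1]"
          using F(1) d d2[OF F'(1)] d2[OF F'(2)] d2[OF F'(3)] v S(2,5,10,13) l S(1)
          by (simp add: Int_commute) blast
        moreover have "adj E X (X1 \<union> X2)" "adj E Y (X1 \<union> X2)" "adj E X Y2" "adj E Y Y1"
            "adj E (X1 \<union> X2) Y1" "adj E (X1 \<union> X2) Y2"
          using adj_single_mono[OF S(15) F(2)] adj_single_mono[OF S(7) F(3)] adj_single_mono[OF S(16) F(2)]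
            adj_single_mono[OF S(8) F(3)] adj_mono[OF S(6)] adj_mono[OF S(14)] by auto
        ultimately have "has_F3 E V" using F(4-6) by (intro has_F3I)
        then show ?thesis using assms(1) by simp
      next
        case True
        have U: "C \<inter> (V - C) = {}" "V - C \<subseteq> V" by auto
        obtain p q where pq: "p \<noteq> q" "N a \<inter> C = {p, q}" "N b \<inter> C = {p, q}"
          using twin_contacts[OF assms(2) C(1,10,2) _ F(1-3,5,6) U] True by blast
        show ?thesis
        proof (rule dec_of_twin_contacts[OF br pq])
          fix D assume D: "bridge p q D" "D \<subseteq> C - {p, q}" "fat E (V - D) p q"
          have "p \<in> C" using pq by auto
          have "card D < card C" by (rule psubset_card_mono[OF C(5)]) (use D(2) \<open>p \<in> C\<close> in auto)
          then show "dec E {p, q} D" using IH D by simp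
        qed
      qed
    qed
  qed
qed

end

section \<open>Graphs with a two-node separator\<close>

locale excluded_minors = biconnected +
  assumes no_F3: "\<not> has_F3 E V" and no_H3: "\<not> has_H3 E V"
begin

lemma decomposable_of_fat:
  "a \<in> V \<Longrightarrow> b \<in> V \<Longrightarrow> a \<noteq> b \<Longrightarrow> (\<And>C. bridge a b C \<Longrightarrow> fat E (V - C) a b) \<Longrightarrow> decomposable"
  using decomposable_of_bridges[of a b] dec_of_fat[OF no_F3 no_H3] by blast

lemma bridgeD:
  assumes "bridge a b C"
  shows "a \<in> V" "b \<in> V" "a \<noteq> b" "C \<noteq> {}" "C \<subseteq> V" "a \<notin> C" "b \<notin> C" "linked E C" "closed_mod {a, b} C" "finite C"
  using assms finV by (auto simp: bridge_def intro: finite_subset)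

lemma fat_of_two_bridges:
  assumes "bridge a b C1" "bridge a b C2" "C1 \<inter> C2 = {}" "C1 \<inter> C = {}" "C2 \<inter> C = {}" "a \<notin> C" "b \<notin> C"
  shows "fat E (V - C) a b"
proof -
  have "linked E (insert b C1)"
    using linked_Un_adj[OF symE _ bridgeD(8)[OF assms(1)] bridge_adj(2)[OF assms(1)]] by simp
  then have "branch_sets E (V - C) [{a}, insert b C1, C2]"
    using bridgeD[OF assms(1)] bridgeD[OF assms(2)] assms(3-) by auto
  moreover have "adj E {a} (insert b C1)" using bridge_adj(1)[OF assms(1)] by (auto simp: adj_def)
  moreover have "adj E (insert b C1) C2" using bridge_adj(2)[OF assms(2)] by (auto simp: adj_def)
  ultimately show ?thesis using bridge_adj(1)[OF assms(2)]
    by (intro fatI[of E _ "{a}" "insert b C1" C2]) auto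
qed

lemma fat_of_edge_bridge:
  assumes "bridge a b D" "(a, b) \<in> E" "D \<inter> C = {}" "a \<notin> C" "b \<notin> C"
  shows "fat E (V - C) a b"
proof -
  have "branch_sets E (V - C) [{a}, {b}, D]"
    using bridgeD[OF assms(1)] assms(3-) by auto
  then show ?thesis using assms(2) bridge_adj[OF assms(1)] by (intro fatI[of E _ "{a}" "{b}" D]) (auto simp: adj_def)
qed

text \<open>
  For every bridge there are two others; one of them becomes the third corner of a triangle, the
  other one connects \<open>a\<close> and \<open>b\<close>.
\<close>

lemma decomposable_of_three_bridges:
  assumes "bridge a b C1" "bridge a b C2" "bridge a b C3" "C1 \<inter> C2 = {}" "C1 \<inter> C3 = {}" "C2 \<inter> C3 = {}"
  shows decomposable
proof (rule decomposable_of_fat[OF bridgeD(1-3)[OF assms(1)]])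
  fix C assume C: "bridge a b C"
  note d = bridgeD[OF C]
  consider "C = C1" | "C = C2" | "C1 \<inter> C = {}" "C2 \<inter> C = {}"
    using bridges_eq[OF C assms(1)] bridges_eq[OF C assms(2)] by (auto simp: Int_commute)
  then show "fat E (V - C) a b"
  proof cases
    case 1 then show ?thesis using assms d by (intro fat_of_two_bridges[of a b C2 C3]) (auto simp: Int_commute)
  next
    case 2 then show ?thesis using assms d by (intro fat_of_two_bridges[of a b C1 C3]) (auto simp: Int_commute)
  next
    case 3 then show ?thesis using assms d by (intro fat_of_two_bridges[of a b C1 C2]) auto
  qed
qed

lemma dec_union_outside:
  assumes "bridge a b C" "dec E {a, b} C" "dec E {a, b} (V - C - {a, b})"
  shows decomposable
proof -
  have "\<not> adj E C (V - C - {a, b})"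
    using bridgeD(9)[OF assms(1)] by (auto simp: adj_def closed_mod_def)
  then have "dec E {a, b} (C \<union> (V - C - {a, b}))" using assms by (intro dec_union) auto
  moreover have "C \<union> (V - C - {a, b}) = V - {a, b}" using bridgeD[OF assms(1)] by auto
  ultimately show ?thesis unfolding decomposable_def using bridgeD[OF assms(1)] by auto
qed

lemma unlinked_two_bridges:
  assumes "a \<in> V" "b \<in> V" "a \<noteq> b" "S \<subseteq> V - {a, b}" "closed_mod {a, b} S" "\<not> linked E S"
  obtains C1 C2 where "bridge a b C1" "bridge a b C2" "C1 \<inter> C2 = {}" "C1 \<subseteq> S" "C2 \<subseteq> S"
proof -
  obtain x where x: "x \<in> S" using assms(6) by fastforce
  have s: "component E S x \<subseteq> S" by (rule component_subset[OF x])
  have "component E S x \<noteq> S" using assms(6) component_linked[OF symE, of S x] by auto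
  then obtain y where y: "y \<in> S" "y \<notin> component E S x" using s by auto
  note b = component_bridge[OF assms(1-5) x] component_bridge[OF assms(1-5) y(1)]
  have "component E S x \<inter> component E S y = {}"
    using bridges_eq[OF b] y(2) component_self[of y E S] by blast
  then show thesis using that b s component_subset[OF y(1)] by blast
qed

lemma outer_bridge:
  assumes "bridge a b C" "V - C - {a, b} \<noteq> {}"
  obtains D where "bridge a b D" "D \<inter> C = {}" "D \<subseteq> V - C - {a, b}"
proof -
  note d = bridgeD[OF assms(1)]
  have cl: "closed_mod {a, b} (V - C - {a, b})"
    using closed_mod_compl[OF d(9)] by (simp add: Diff_eq Int_ac)
  obtain x where x: "x \<in> V - C - {a, b}" using assms(2) by auto
  have s: "component E (V - C - {a, b}) x \<subseteq> V - C - {a, b}" by (rule component_subset[OF x])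
  have "bridge a b (component E (V - C - {a, b}) x)"
    by (rule component_bridge[OF d(1-3) _ cl x]) auto
  then show thesis using that s by blast
qed

text \<open>
  Exchanging \<open>b\<close> for its only neighbour \<open>c\<close> in the bridge enlarges the
  decomposed outside by \<open>b\<close> and shrinks the bridge by \<open>c\<close>. If the bridge
  falls apart without \<open>c\<close>, then there are three bridges between \<open>a\<close> and
  \<open>c\<close>: two of the parts, and the one that contains \<open>b\<close>.
\<close>

lemma decomposable_grow_one_contact:
  assumes br: "bridge a b C" and out: "dec E {a, b} (V - C - {a, b})" "V - C - {a, b} \<noteq> {}"
    and N1: "N b \<inter> C = {c}"
    and IH: "\<And>a b C'. card C' < card C \<Longrightarrow> bridge a b C' \<Longrightarrow> dec E {a, b} (V - C' - {a, b}) \<Longrightarrow>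
       V - C' - {a, b} \<noteq> {} \<Longrightarrow> decomposable"
  shows decomposable
proof -
  note C = bridgeD[OF br]
  have c: "c \<in> C" "(b, c) \<in> E" using N1 by auto
  have cV: "c \<in> V" "a \<noteq> c" "b \<noteq> c" using c C by auto
  have cl: "closed_mod {a, c} (C - {c})" by (rule closed_of_one_contact[OF br N1])
  show ?thesis
  proof (cases "C = {c}")
    case True
    have "dec E {a, b} C"
    proof (rule dec_move[of "{c}"])
      show "dec E {c} (C - {c})" using True by (simp add: dec_empty)
    qed (use True in auto)
    then show ?thesis using dec_union_outside[OF br _ out(1)] by simp
  next
    case False
    show ?thesis
    proof (cases "linked E (C - {c})")
      case True
      have br': "bridge a c (C - {c})"
        unfolding bridge_def using C cV True cl False by auto
      have eq: "V - (C - {c}) - {a, c} = insert b (V - C - {a, b})" using C cV c by auto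
      have "dec E {a, c} (insert b (V - C - {a, b}))"
      proof (rule dec_move[of "{a, b}"])
        show "x \<in> {a, b}" if "p \<in> {a, c} - {a, b}" "x \<in> insert b (V - C - {a, b})" "(p, x) \<in> E" for p x
          using closed_modD[OF C(9) c(1), of x] that by auto
        have "insert b (V - C - {a, b}) - {a, b} = V - C - {a, b}" by auto
        then show "dec E {a, b} (insert b (V - C - {a, b}) - {a, b})" using out(1) by simp
      qed (auto simp: card_insert_if)
      moreover have "card (C - {c}) < card C" by (rule psubset_card_mono) (use C c in auto)
      ultimately show ?thesis using IH[OF _ br'] eq by auto
    next
      case False
      have sub: "C - {c} \<subseteq> V - {a, c}" using C by auto
      obtain C1 C2 where 12: "bridge a c C1" "bridge a c C2" "C1 \<inter> C2 = {}" "C1 \<subseteq> C - {c}" "C2 \<subseteq> C - {c}"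
        by (rule unlinked_two_bridges[OF C(1) cV(1,2) sub cl False])
      have bV: "b \<in> V - {a, c}" using C cV by auto
      have "closed_mod {a, c} (V - {a, c})" using EV by (auto simp: closed_mod_def)
      from component_bridge[OF C(1) cV(1,2) order_refl this bV]
      have 3: "bridge a c (component E (V - {a, c}) b)" (is "bridge a c ?D") .
      have b: "b \<in> ?D" "b \<notin> C1" "b \<notin> C2" using 12 C by auto
      have "C1 \<inter> ?D = {}" "C2 \<inter> ?D = {}" using bridges_eq[OF 12(1) 3] bridges_eq[OF 12(2) 3] b by blast+
      then show ?thesis using decomposable_of_three_bridges[OF 12(1,2) 3 12(3)] by simp
    qed
  qed
qed

text \<open>
  The bag is \<open>{a, c}\<close>. Both sides of \<open>c\<close> in the bridge contract to a
  triangle: on the side of \<open>a\<close> with \<open>a\<close> itself, on the side of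
  \<open>b\<close> with the connected set made of \<open>a\<close>, \<open>b\<close> and another
  bridge \<open>D\<close> between them. A bridge between \<open>a\<close> and \<open>c\<close>
  avoids one of the two sides, so its outside is fat.
\<close>

lemma decomposable_of_cut:
  assumes br: "bridge a b C" and out: "V - C - {a, b} \<noteq> {}"
    and c: "c \<in> C" "\<not> joined E (C - {c}) (N a) (N b)"
    and ne: "y1 \<in> N b \<inter> C" "y2 \<in> N b \<inter> C" "y1 \<noteq> y2" "x1 \<in> N a \<inter> C" "x2 \<in> N a \<inter> C" "x1 \<noteq> x2"
  shows decomposable
proof -
  note C = bridgeD[OF br]
  obtain D where D: "bridge a b D" "D \<inter> C = {}" "D \<subseteq> V - C - {a, b}" by (rule outer_bridge[OF br out])
  obtain X1 Y1 X2 Y2 where S: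
    "c \<in> X1" "Y1 \<noteq> {}" "X1 \<inter> Y1 = {}" "linked E X1" "linked E Y1" "adj E X1 Y1" "adj E {b} X1" "adj E {b} Y1"
    "c \<in> X2" "Y2 \<noteq> {}" "X2 \<inter> Y2 = {}" "linked E X2" "linked E Y2" "adj E X2 Y2" "adj E {a} X2" "adj E {a} Y2"
    "X1 \<union> Y1 \<subseteq> C" "X2 \<union> Y2 \<subseteq> C" "(X1 \<union> Y1) \<inter> (X2 \<union> Y2) = {c}"
    "linked E (insert b (X1 \<union> Y1 - {c}))" "closed_mod {a, c} (X2 \<union> Y2 - {c})"
    by (rule cut_sides[OF br c ne])
  have cV: "c \<in> V" "a \<noteq> c" "b \<noteq> c" using c C by auto
  have lD: "linked E (insert b D)"
    using linked_Un_adj[OF symE _ bridgeD(8)[OF D(1)] bridge_adj(2)[OF D(1)]] by simp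
  \<comment> \<open>a connected set around \<open>b\<close> without \<open>a\<close> and \<open>c\<close>; a bridge between \<open>a\<close> and \<open>c\<close> that misses \<open>b\<close> avoids all of it\<close>
  define R where "R = insert b D \<union> insert b (X1 \<union> Y1 - {c})"
  have lR: "linked E R" unfolding R_def by (rule linked_Un[OF symE lD S(20)]) auto
  have Rac: "R \<inter> {a, c} = {}" using C(3,6) cV(3) D(3) c(1) S(17) by (auto simp: R_def)
  show ?thesis
  proof (rule decomposable_of_fat[OF C(1) cV(1,2)])
    fix C' assume C': "bridge a c C'"
    note d = bridgeD[OF C']
    show "fat E (V - C') a c"
    proof (cases "b \<in> C'")
      case True
      have "C' \<inter> (X2 \<union> Y2 - {c}) = {}"
      proof (rule ccontr)
        assume "C' \<inter> (X2 \<union> Y2 - {c}) \<noteq> {}"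
        from closed_absorb[OF S(21) d(8) _ this] d(6,7) have "C' \<subseteq> X2 \<union> Y2" by auto
        then show False using True S(18) C(7) by auto
      qed
      then have "branch_sets E (V - C') [{a}, X2, Y2]"
        using S(9-13,18) d(6,7) C(1,5,6) by auto
      then show ?thesis using S(9,14-16) by (intro fatI[of E _ "{a}" X2 Y2]) auto
    next
      case False
      have RC': "R \<inter> C' = {}" using bridge_absorb[OF C' lR Rac] False by (auto simp: R_def)
      have lX: "linked E (insert a (insert b D))"
      proof -
        have "adj E {a} (insert b D)" by (rule adj_mono[OF bridge_adj(1)[OF D(1)]]) auto
        from linked_Un_adj[OF symE linked_singleton lD this]
        have "linked E ({a} \<union> insert b D)" .
        moreover have "{a} \<union> insert b D = insert a (insert b D)" by auto
        ultimately show ?thesis by metis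
      qed
      have "insert a (insert b D) \<subseteq> V - C'" using RC' d(6) C(1,2) D(3) by (auto simp: R_def)
      moreover have "X1 \<subseteq> V - C'" "Y1 \<subseteq> V - C'" using RC' d(7) S(17) C(5) by (auto simp: R_def)
      moreover have "insert a (insert b D) \<inter> X1 = {}" "insert a (insert b D) \<inter> Y1 = {}"
        using S(17) C(6,7) D(2) by auto
      ultimately have "branch_sets E (V - C') [insert a (insert b D), X1, Y1]"
        using S(1-5) lX by auto
      moreover have "adj E (insert a (insert b D)) X1" "adj E (insert a (insert b D)) Y1"
        using adj_single_mono[OF S(7)] adj_single_mono[OF S(8)] by auto
      ultimately show ?thesis using S(1,6)
        by (intro fatI[of E _ "insert a (insert b D)" X1 Y1]) auto
    qed
  qed
qed

text \<open>
  Here the outside of the bridge need not be fat; it is known to be decomposable instead. The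
  induction repeats the case distinction for fat outsides, except that a separating node now leads
  to another pair of nodes for the first bag.
\<close>

theorem decomposable_of_outer_dec:
  assumes "bridge a b C" "dec E {a, b} (V - C - {a, b})" "V - C - {a, b} \<noteq> {}"
  shows decomposable
  using assms
proof (induction "card C" arbitrary: a b C rule: less_induct)
  case less
  note br = less.prems(1)
  have IH: "card C' < card C \<Longrightarrow> bridge a b C' \<Longrightarrow> dec E {a, b} (V - C' - {a, b}) \<Longrightarrow>
       V - C' - {a, b} \<noteq> {} \<Longrightarrow> decomposable" for a b C'
    by (rule less.hyps)
  note C = bridgeD[OF br]
  obtain y1 where y1: "y1 \<in> N b \<inter> C" using bridge_contact[OF br] by auto
  obtain x1 where x1: "x1 \<in> N a \<inter> C" using bridge_contact[OF br] by auto
  show ?case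
  proof (cases "N b \<inter> C = {y1}")
    case True
    show ?thesis by (rule decomposable_grow_one_contact[OF less.prems True IH])
  next
    case y: False
    show ?thesis
    proof (cases "N a \<inter> C = {x1}")
      case True
      show ?thesis
        by (rule decomposable_grow_one_contact[OF bridge_commute[OF br] _ _ True IH])
          (use less.prems(2,3) in \<open>simp_all add: insert_commute\<close>)
    next
      case x: False
      obtain y2 where y2: "y2 \<in> N b \<inter> C" "y1 \<noteq> y2" using y y1 by auto
      obtain x2 where x2: "x2 \<in> N a \<inter> C" "x1 \<noteq> x2" using x x1 by auto
      show ?thesis
      proof (cases "\<forall>c\<in>C. joined E (C - {c}) (N a) (N b)")
        case False
        then obtain c where c: "c \<in> C" "\<not> joined E (C - {c}) (N a) (N b)" by auto
        show ?thesis by (rule decomposable_of_cut[OF br less.prems(3) c y1 y2 x1 x2])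
      next
        case True
        obtain D where D: "bridge a b D" "D \<inter> C = {}" "D \<subseteq> V - C - {a, b}"
          by (rule outer_bridge[OF br less.prems(3)])
        have U: "C \<inter> (V - C) = {}" "V - C \<subseteq> V" by auto
        have bs: "branch_sets E (V - C) [{a}, {b}, D]" using D bridgeD[OF D(1)] C by auto
        obtain p q where pq: "p \<noteq> q" "N a \<inter> C = {p, q}" "N b \<inter> C = {p, q}"
          using twin_contacts[OF no_H3 C(5,4,8) _ bs _ _ bridge_adj[OF D(1)] U] True by blast
        have "dec E {a, b} C"
          by (rule dec_of_twin_contacts[OF br pq]) (rule dec_of_fat[OF no_F3 no_H3])
        then show ?thesis using dec_union_outside[OF br _ less.prems(2)] by simp
      qed
    qed
  qed
qed

text \<open>
  A node \<open>v\<close> of degree two is a bridge between its neighbours and trivially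
  decomposable. The rest of the graph either is a single bridge, to which the previous theorem
  applies with \<open>v\<close> as the outside, or it yields two more bridges.
\<close>

lemma decomposable_of_degree_two:
  assumes "v \<in> V" "N v = {a, b}" "a \<noteq> b" "card V \<ge> 4"
  shows decomposable
proof -
  have ab: "(v, a) \<in> E" "(v, b) \<in> E" using assms(2) by auto
  have V: "a \<in> V" "b \<in> V" "v \<noteq> a" "v \<noteq> b" using ab edge_in by auto
  have cl: "closed_mod {a, b} {v}" using assms(2) by (auto simp: closed_mod_def)
  have bv: "bridge a b {v}" unfolding bridge_def using V assms(1,3) cl by auto
  let ?W = "V - {a, b} - {v}"
  have clW: "closed_mod {a, b} ?W" by (rule closed_mod_compl[OF cl])
  have "?W \<noteq> {}"
  proof
    assume "?W = {}"
    then have "V \<subseteq> {a, b, v}" by auto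
    then have "card V \<le> card {a, b, v}" by (intro card_mono) auto
    also have "\<dots> \<le> 3" by (auto simp: card_insert_if)
    finally show False using assms(4) by simp
  qed
  show ?thesis
  proof (cases "linked E ?W")
    case True
    have br: "bridge a b ?W" unfolding bridge_def using V assms(3) True clW \<open>?W \<noteq> {}\<close> by auto
    have eq: "V - ?W - {a, b} = {v}" using V assms(1) by auto
    have "dec E {a, b} {v}"
    proof (rule dec_move[of "{v}"])
      show "dec E {v} ({v} - {v})" by (simp add: dec_empty)
    qed auto
    then show ?thesis using decomposable_of_outer_dec[OF br, unfolded eq] by simp
  next
    case False
    obtain C1 C2 where "bridge a b C1" "bridge a b C2" "C1 \<inter> C2 = {}" "C1 \<subseteq> ?W" "C2 \<subseteq> ?W"
      using unlinked_two_bridges[OF V(1,2) assms(3) _ clW False] by auto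
    then show ?thesis using decomposable_of_three_bridges[OF _ _ bv] by blast
  qed
qed

text \<open>
  The outside contains another bridge \<open>D\<close>. The edge \<open>ab\<close> or a further
  bridge gives a triangle at once. If \<open>D\<close> is all there is, then two neighbours of
  \<open>b\<close> in \<open>D\<close> split \<open>D\<close> with \<open>a\<close> into two
  corners. A single neighbour \<open>p\<close> of \<open>b\<close> is merged with \<open>b\<close>;
  having degree at least three, it sees two nodes besides \<open>b\<close>, which play the same
  role.
\<close>

lemma fat_outside:
  assumes nd: "\<not> (\<exists>v x y. v \<in> V \<and> x \<noteq> y \<and> N v = {x, y})"
    and br: "bridge a b C" and out: "V - C - {a, b} \<noteq> {}"
  shows "fat E (V - C) a b"
proof -
  note C = bridgeD[OF br]
  obtain D where D: "bridge a b D" "D \<inter> C = {}" "D \<subseteq> V - C - {a, b}" by (rule outer_bridge[OF br out])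
  note d = bridgeD[OF D(1)]
  show ?thesis
  proof (cases "(a, b) \<in> E")
    case True then show ?thesis by (rule fat_of_edge_bridge[OF D(1) _ D(2) C(6,7)])
  next
    case nab: False
    show ?thesis
    proof (cases "D = V - C - {a, b}")
      case False
      have cl: "closed_mod {a, b} (V - C - {a, b} - D)"
        using closed_mod_Diff[OF closed_mod_compl[OF C(9)] d(9)] by (simp add: Diff_eq Int_ac)
      obtain x where x: "x \<in> V - C - {a, b} - D" using False D(3) by auto
      have s: "component E (V - C - {a, b} - D) x \<subseteq> V - C - {a, b} - D" by (rule component_subset[OF x])
      have "bridge a b (component E (V - C - {a, b} - D) x)"
        by (rule component_bridge[OF d(1-3) _ cl x]) auto
      from fat_of_two_bridges[OF D(1) this _ D(2) _ C(6,7)] s show ?thesis by auto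
    next
      case DW: True
      obtain p where p: "p \<in> N b \<inter> D" using bridge_contact[OF D(1)] by auto
      have lK: "linked E (insert a D)"
        using linked_Un_adj[OF symE _ d(8) bridge_adj(1)[OF D(1)]] by simp
      show ?thesis
      proof (cases "N b \<inter> D = {p}")
        case False
        then obtain q where q: "q \<in> N b \<inter> D" "p \<noteq> q" using p by auto
        obtain X Y where XY: "a \<in> X" "X \<union> Y = insert a D" "X \<inter> Y = {}" "Y \<noteq> {}" "linked E X" "linked E Y"
          "adj E X Y" "adj E {b} X" "adj E {b} Y"
          by (rule double_contact[OF symE _ lK, of a p q b]) (use p q d(10) in auto)
        have sub: "X \<subseteq> V - C" "Y \<subseteq> V - C" "b \<notin> X" "b \<notin> Y" using XY(2) D(3) C d by auto
        then have "branch_sets E (V - C) [X, {b}, Y]" using XY C by auto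
        then show ?thesis using XY adj_sym by (intro fatI[of E _ X "{b}" Y]) auto
      next
        case True
        have pD: "p \<in> D" "(b, p) \<in> E" "p \<in> V" "p \<noteq> a" "p \<noteq> b" using p d by auto
        define K where "K = insert a (D - {p})"
        have lK: "linked E K"
          unfolding K_def
        proof (rule linked_insert_closed[OF symE linked_del[OF pD(3)]])
          fix x y assume xy: "x \<in> D - {p}" "(x, y) \<in> E" "y \<in> V - {p}"
          then have "y \<in> D \<union> {a, b}" using closed_modD[OF d(9)] by auto
          moreover have "y \<noteq> b" using True xy edge_sym by blast
          ultimately show "y \<in> insert a (D - {p})" using xy by auto
        qed (use d pD in auto)
        have Np: "N p \<subseteq> insert b K" using closed_modD[OF d(9) pD(1)] by (auto simp: K_def)
        have bp: "b \<in> N p" using pD edge_sym by auto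
        have bK: "b \<notin> K" using d by (auto simp: K_def)
        have "\<exists>x. x \<in> N p \<inter> K"
        proof -
          have "linked E (V - {b})" using linked_del C by auto
          from linked_edge_out[OF this, of p "{p}" a] pD C(1,3)
          obtain u where u: "(p, u) \<in> E" "u \<noteq> b" by auto
          then have "u \<in> N p \<inter> K" using Np by auto
          then show ?thesis by blast
        qed
        then obtain x where x: "x \<in> N p \<inter> K" by auto
        have "b \<noteq> x" using x bK by auto
        then have "N p \<noteq> {b, x}" using nd pD(3) by blast
        then obtain y where y: "y \<in> N p \<inter> K" "x \<noteq> y" using bp x Np by auto
        have fK: "finite K" using d(10) by (simp add: K_def)
        obtain X Y where XY: "a \<in> X" "X \<union> Y = K" "X \<inter> Y = {}" "Y \<noteq> {}" "linked E X" "linked E Y"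
          "adj E X Y" "adj E {p} X" "adj E {p} Y"
          by (rule double_contact[OF symE fK lK, of a x y p]) (use x y in \<open>auto simp: K_def\<close>)
        have l: "linked E {p, b}" using bp by (intro linked_edge symE) auto
        have sub: "X \<subseteq> V - C" "Y \<subseteq> V - C" "b \<notin> X" "b \<notin> Y" "p \<notin> X" "p \<notin> Y"
          using XY(2) D(3) C d pD unfolding K_def by auto
        then have "branch_sets E (V - C) [X, {p, b}, Y]" using XY(1,3-6) C(2,7) pD(1,3) D(2) l by auto
        moreover have "adj E X {p, b}" "adj E {p, b} Y" using adj_sym[OF XY(8)] XY(9) 
          by (auto simp: adj_def)
        ultimately show ?thesis using XY(1,7) by (intro fatI[of E _ X "{p, b}" Y]) auto
      qed
    qed
  qed
qed

theorem decomposable_of_two_separator: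
  assumes "card V \<ge> 4" "a \<in> V" "b \<in> V" "a \<noteq> b" "\<not> linked E (V - {a, b})"
  shows decomposable
proof (cases "\<exists>v x y. v \<in> V \<and> x \<noteq> y \<and> N v = {x, y}")
  case True
  then show ?thesis using decomposable_of_degree_two assms(1) by blast
next
  case False
  show ?thesis
  proof (rule decomposable_of_fat[OF assms(2-4)])
    fix C assume C: "bridge a b C"
    have "V - C - {a, b} \<noteq> {}"
    proof
      assume "V - C - {a, b} = {}"
      then have "C = V - {a, b}" using bridgeD[OF C] by auto
      then show False using assms(5) bridgeD[OF C] by simp
    qed
    then show "fat E (V - C) a b" by (rule fat_outside[OF False C])
  qed
qed

end

section \<open>Graphs without a two-node separator\<close>

context fin_graph begin

lemma component_closed_mod:
  assumes "closed_mod P S" "x \<in> S" shows "closed_mod P (component E S x)"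
  unfolding closed_mod_def
proof (intro ballI allI impI)
  fix u y assume u: "u \<in> component E S x" "(u, y) \<in> E"
  from u(1) component_subset[OF assms(2)] have "u \<in> S" by blast
  from closed_modD[OF assms(1) this u(2)] show "y \<in> component E S x \<union> P"
    using component_closed[OF assms(2) u] by auto
qed

text \<open>
  The situation when a path \<open>a\<close>, \<open>v\<close>, \<open>b\<close> separates the
  graph: \<open>D\<close> is one component and touches the three nodes of the path, while the
  adjacent sets \<open>X\<close> and \<open>Y\<close> make up another one. Here the middle node of
  the path touches \<open>Y\<close> and its ends touch \<open>X\<close>; in the next lemma an end
  touches \<open>Y\<close> and the other two nodes touch \<open>X\<close>.
\<close>

lemma H3_of_split_vertex_at_hub:
  assumes "branch_sets E V [X, Y, D, {a}, {b}, {v}]" "adj E X Y"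
    "adj E {a} D" "adj E {b} D" "adj E {v} D" "(a, v) \<in> E" "(v, b) \<in> E"
    "adj E {v} Y" "adj E {a} X" "adj E {b} X"
  shows "has_H3 E V"
proof (rule has_H3I[of E V "{v}" X D Y "{b}" "{a}"])
  show "branch_sets E V [{v}, X, D, Y, {b}, {a}]" using assms(1) by auto
qed (use assms adj_sym in \<open>auto simp: adj_def dest: edge_sym\<close>)

lemma H3_of_split_vertex_at_rim:
  assumes "branch_sets E V [X, Y, D, {a}, {b}, {v}]" "adj E X Y"
    "adj E {a} D" "adj E {b} D" "adj E {v} D" "(a, v) \<in> E" "(v, b) \<in> E"
    "adj E {a} Y" "adj E {v} X" "adj E {b} X"
  shows "has_H3 E V"
proof (rule has_H3I[of E V X "{a}" "{b}" Y "{v}" D])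
  show "branch_sets E V [X, {a}, {b}, Y, {v}, D]" using assms(1) by auto
qed (use assms adj_sym in \<open>auto simp: adj_def dest: edge_sym\<close>)

lemma H3_of_wheel_split:
  assumes "branch_sets E V [X, Y, D, {a}, {b}, {v}]" "adj E X Y"
    "adj E {a} D" "adj E {b} D" "adj E {v} D" "(a, v) \<in> E" "(v, b) \<in> E"
    "adj E {v} Y \<and> adj E {a} X \<and> adj E {b} X \<or> adj E {a} Y \<and> adj E {v} X \<and> adj E {b} X \<or>
     adj E {b} Y \<and> adj E {v} X \<and> adj E {a} X"
  shows "has_H3 E V"
  using assms(8)
proof (elim disjE conjE)
  assume *: "adj E {b} Y" "adj E {v} X" "adj E {a} X"
  have "branch_sets E V [X, Y, D, {b}, {a}, {v}]" using assms(1) by auto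
  from H3_of_split_vertex_at_rim[OF this assms(2,4,3,5) edge_sym[OF assms(7)] edge_sym[OF assms(6)] *]
  show ?thesis .
qed (use H3_of_split_vertex_at_hub[OF assms(1-7)] H3_of_split_vertex_at_rim[OF assms(1-7)] in auto)

lemma H3_of_K33_plus_edge:
  assumes "branch_sets E V [A, B, D, C1, C2, C3]" "adj E A D"
    "adj E A C1" "adj E B C1" "adj E D C1" "adj E A C2" "adj E B C2" "adj E D C2"
    "adj E A C3" "adj E B C3" "adj E D C3"
  shows "has_H3 E V"
proof (rule has_H3I[of E V A B D C1 C3 C2])
  show "branch_sets E V [A, B, D, C1, C3, C2]" using assms(1) by auto
qed (use assms in auto)

end

locale triconnected = biconnected +
  assumes no_H3: "\<not> has_H3 E V" and six: "card V \<ge> 6"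
    and linked_del2: "\<And>a b. a \<in> V \<Longrightarrow> b \<in> V \<Longrightarrow> a \<noteq> b \<Longrightarrow> linked E (V - {a, b})"
begin

text \<open>
  Otherwise the remaining two of the three nodes would separate \<open>C\<close> from
  \<open>a\<close>.
\<close>

lemma contact3:
  assumes "C \<noteq> {}" "C \<subseteq> V - {a, b, v}" "closed_mod {a, b, v} C" "a \<in> V" "b \<in> V" "v \<in> V" "a \<noteq> b" "a \<noteq> v" "b \<noteq> v"
  shows "adj E {a} C"
proof -
  obtain x where "x \<in> C" using assms(1) by auto
  with linked_edge_out[OF linked_del2[OF assms(5,6,9)], of x C a] assms
  obtain u w where uw: "(u, w) \<in> E" "u \<in> C" "w \<in> V - {b, v} - C" by auto
  then have "w = a" using closed_modD[OF assms(3) uw(2,1)] by auto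
  then show ?thesis using uw edge_sym by (auto simp: adj_def)
qed

text \<open>
  Two components \<open>C\<close> and \<open>D\<close> of the graph without the path
  \<open>a\<close>, \<open>v\<close>, \<open>b\<close> touch all three of its nodes. If
  \<open>C\<close> has two nodes, then two different nodes of \<open>C\<close> have an edge to the
  path, and they are the seeds of a partition of \<open>C\<close> into adjacent parts. Both parts
  touch the path, and each of the three nodes of the path touches one of the parts, so one of the
  two lemmas above applies.
\<close>

lemma H3_of_big_part:
  assumes D: "branch_sets E V [C, D, {a}, {b}, {v}]" and cl: "closed_mod {a, b, v} C"
    and ad: "adj E {a} C" "adj E {b} C" "adj E {v} C" "adj E {a} D" "adj E {b} D" "adj E {v} D"
    and e: "(a, v) \<in> E" "(v, b) \<in> E"
    and z: "z1 \<in> C" "z2 \<in> C" "z1 \<noteq> z2"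
  shows False
proof -
  obtain t1 where t1: "t1 \<in> C" "(a, t1) \<in> E" using ad(1) by (auto simp: adj_def)
  then obtain z where z: "z \<in> C" "z \<noteq> t1" using z by auto
  have V: "t1 \<in> V" "a \<in> V" "C \<subseteq> V" "a \<notin> C" "b \<notin> C" "v \<notin> C" "linked E C" using D t1 by auto
  \<comment> \<open>without \<open>t1\<close> the graph stays connected, so \<open>C - {t1}\<close> has an edge to the path\<close>
  obtain t2 w where t2: "(t2, w) \<in> E" "t2 \<in> C" "t2 \<noteq> t1" "w \<in> V - C"
    using linked_edge_out[OF linked_del[OF V(1)], of z "C - {t1}" a] z t1 V by auto
  have w: "w \<in> {a, b, v}" using closed_modD[OF cl t2(2,1)] t2 by auto
  have fC: "finite C" using V(3) finV by (rule finite_subset)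
  obtain X Y where XY: "t1 \<in> X" "t2 \<in> Y" "X \<union> Y = C" "X \<inter> Y = {}" "linked E X" "linked E Y" "adj E X Y"
    using linked_split[OF symE fC V(7) t1(1) t2(2)] t2(3) by metis
  have or: "adj E {l} X \<or> adj E {l} Y" if "adj E {l} C" for l using that XY(3) by (auto simp: adj_def)
  have aX: "adj E {a} X" using t1 XY by (auto simp: adj_def)
  have wY: "adj E {w} Y" using t2 XY edge_sym by (auto simp: adj_def)
  have d: "X \<subseteq> C" "Y \<subseteq> C" "X \<noteq> {}" "Y \<noteq> {}" using XY by auto
  have "X \<inter> D = {}" "Y \<inter> D = {}" "a \<notin> X" "a \<notin> Y" "b \<notin> X" "b \<notin> Y" "v \<notin> X" "v \<notin> Y" "X \<subseteq> V" "Y \<subseteq> V"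
    using D d by auto
  then have bs: "branch_sets E V [X, Y, D, {a}, {b}, {v}]" "branch_sets E V [Y, X, D, {a}, {b}, {v}]"
    using D XY(4-6) d(3,4) by auto
  note h = H3_of_wheel_split[OF bs(1) XY(7) ad(4-6) e] H3_of_wheel_split[OF bs(2) adj_sym[OF XY(7)] ad(4-6) e]
  have "adj E {a} Y \<or> adj E {b} Y \<or> adj E {v} Y" using w wY by auto
  then show False using h no_H3 or[OF ad(2)] or[OF ad(3)] aX by blast
qed

text \<open>
  Otherwise there are two components, each of which touches all of \<open>a\<close>,
  \<open>v\<close>, \<open>b\<close>. Three of them give \<open>K\<^sub>3\<^sub>,\<^sub>3\<close>
  with an edge added; two of them have at least three nodes together, so one has at least two.
\<close>

lemma linked_del_path:
  assumes e: "(a, v) \<in> E" "(v, b) \<in> E" and ab: "a \<noteq> b"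
  shows "linked E (V - {a, b, v})"
proof (rule ccontr)
  let ?W = "V - {a, b, v}"
  assume nl: "\<not> ?thesis"
  have V: "a \<in> V" "b \<in> V" "v \<in> V" "a \<noteq> v" "b \<noteq> v" using e edge_in no_loop by auto
  have cl: "closed_mod {a, b, v} ?W" using EV by (auto simp: closed_mod_def)
  have comp: "component E ?W x \<subseteq> ?W" "component E ?W x \<noteq> {}" "linked E (component E ?W x)"
      "closed_mod {a, b, v} (component E ?W x)"
      "adj E {a} (component E ?W x)" "adj E {b} (component E ?W x)" "adj E {v} (component E ?W x)"
    if x: "x \<in> ?W" for x
  proof -
    show 1: "component E ?W x \<subseteq> ?W" by (rule component_subset[OF x])
    show 2: "component E ?W x \<noteq> {}" using component_self[of x E ?W] by blast
    show "linked E (component E ?W x)" by (rule component_linked[OF symE])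
    show 3: "closed_mod {a, b, v} (component E ?W x)" by (rule component_closed_mod[OF cl x])
    have p: "{a, b, v} = {b, a, v}" "{a, b, v} = {v, a, b}" by auto
    show "adj E {a} (component E ?W x)" by (rule contact3[OF 2 1 3]) (use V ab in auto)
    show "adj E {b} (component E ?W x)"
      by (rule contact3[of _ b a v, folded p(1), OF 2 1 3]) (use V ab in auto)
    show "adj E {v} (component E ?W x)"
      by (rule contact3[of _ v a b, folded p(2), OF 2 1 3]) (use V ab in auto)
  qed
  have disj: "component E ?W x \<inter> component E ?W y = {}" if "x \<in> ?W" "y \<in> ?W" "y \<notin> component E ?W x" for x y
  proof (rule ccontr)
    assume "component E ?W x \<inter> component E ?W y \<noteq> {}"
    moreover have "component E ?W y \<inter> {a, b, v} = {}" using comp(1)[OF that(2)] by auto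
    ultimately have "component E ?W y \<subseteq> component E ?W x"
      using closed_absorb[OF comp(4)[OF that(1)] comp(3)[OF that(2)]] by blast
    then show False using that(3) component_self[of y E ?W] by blast
  qed
  have "?W \<noteq> {}" using nl linked_empty by metis
  then obtain x where x: "x \<in> ?W" by blast
  let ?C1 = "component E ?W x"
  have "?C1 \<noteq> ?W"
  proof
    assume eq: "?C1 = ?W"
    from comp(3)[OF x] have "linked E ?W" unfolding eq .
    with nl show False ..
  qed
  then obtain y where y: "y \<in> ?W" "y \<notin> ?C1" using comp(1)[OF x] by blast
  let ?C2 = "component E ?W y"
  note 12 = disj[OF x y]
  note c1 = comp[OF x] and c2 = comp[OF y(1)]
  show False
  proof (cases "?C1 \<union> ?C2 = ?W")
    case False
    then obtain z where z: "z \<in> ?W" "z \<notin> ?C1" "z \<notin> ?C2" using c1(1) c2(1) by blast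
    let ?C3 = "component E ?W z"
    note c3 = comp[OF z(1)]
    note 13 = disj[OF x z(1,2)] and 23 = disj[OF y(1) z(1,3)]
    have *: "a \<notin> C \<and> b \<notin> C \<and> v \<notin> C \<and> C \<subseteq> V" if "C \<subseteq> ?W" for C using that by auto
    have "branch_sets E V [{a}, {b}, {v}, ?C1, ?C2, ?C3]"
      using V ab 12 13 23 c1(2,3) c2(2,3) c3(2,3) *[OF c1(1)] *[OF c2(1)] *[OF c3(1)] by simp
    moreover have "adj E {a} {v}" using e by (auto simp: adj_def)
    ultimately have "has_H3 E V" by (rule H3_of_K33_plus_edge) (use c1 c2 c3 in auto)
    then show False using no_H3 by simp
  next
    case True
    have *: "a \<notin> C \<and> b \<notin> C \<and> v \<notin> C \<and> C \<subseteq> V" if "C \<subseteq> ?W" for C using that by auto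
    have bs: "branch_sets E V [?C1, ?C2, {a}, {b}, {v}]" "branch_sets E V [?C2, ?C1, {a}, {b}, {v}]"
      using V ab 12 c1(2,3) c2(2,3) *[OF c1(1)] *[OF c2(1)] by (simp_all add: Int_commute)
    have x1: "z = x" if "z \<in> ?C1" for z
      using H3_of_big_part[OF bs(1) c1(4-7) c2(5-7) e, of z x] that by auto
    have y1: "z = y" if "z \<in> ?C2" for z
      using H3_of_big_part[OF bs(2) c2(4-7) c1(5-7) e, of z y] that by auto
    have "?W \<subseteq> {x, y}" using True x1 y1 by blast
    then have "V \<subseteq> {x, y, a, b, v}" by auto
    then have "card V \<le> card {x, y, a, b, v}" by (intro card_mono) auto
    also have "\<dots> \<le> 5" by (auto simp: card_insert_if)
    finally show False using six by simp
  qed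
qed

text \<open>
  The rest of the graph without \<open>a\<close>, \<open>v\<close>, \<open>b\<close> is connected,
  and no node \<open>c\<close> of it separates the neighbours of \<open>a\<close> from those of
  \<open>b\<close>, because \<open>c\<close> and \<open>v\<close> do not separate the graph. So
  \<open>twin_contacts\<close> applies, with \<open>v\<close> as the connection outside.
\<close>

lemma nonadjacent_twins:
  assumes e: "(a, v) \<in> E" "(v, b) \<in> E" and ab: "a \<noteq> b" "(a, b) \<notin> E"
  obtains p q where "p \<noteq> q" "p \<noteq> v" "q \<noteq> v" "N a = {v, p, q}" "N b = {v, p, q}"
proof -
  let ?C = "V - {a, b, v}"
  have V: "a \<in> V" "b \<in> V" "v \<in> V" "a \<noteq> v" "b \<noteq> v" using e edge_in no_loop by auto
  have ba: "(b, a) \<notin> E" using ab edge_sym by blast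
  have "?C \<noteq> {}"
  proof
    assume "?C = {}"
    then have "V \<subseteq> {a, b, v}" by auto
    then have "card V \<le> card {a, b, v}" by (intro card_mono) auto
    also have "\<dots> \<le> 3" by (auto simp: card_insert_if)
    finally show False using six by simp
  qed
  have jn: "joined E (?C - {c}) (N a) (N b)" if c: "c \<in> ?C" for c
  proof (rule ccontr)
    assume nj: "\<not> ?thesis"
    let ?D = "?C - {c}"
    \<comment> \<open>the part reached from \<open>a\<close> without \<open>b\<close>, \<open>v\<close>, \<open>c\<close>; it has to have an edge to \<open>b\<close>\<close>
    define A where "A = {x \<in> ?D. joined E ?D (N a) {x}}"
    have cV: "c \<in> V" "c \<noteq> v" using c by auto
    have "linked E (V - {v, c})" by (rule linked_del2) (use V c in auto)
    from linked_edge_out[OF this, of a "insert a A" b] V ab c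
    obtain u w where uw: "(u, w) \<in> E" "u \<in> insert a A" "w \<in> V - {v, c}" "w \<noteq> a" "w \<notin> A" by (auto simp: A_def)
    have A: "x \<in> A" if "x \<in> ?D" "joined E ?D (N a) {x}" for x using that by (simp add: A_def)
    show False
    proof (cases "u = a")
      case True
      then have w: "w \<in> ?D" "w \<in> N a" using uw ab by auto
      have "joined E ?D (N a) {w}" by (rule joinedI[of w _ _ w]) (use w in auto)
      with A w uw(5) show False by blast
    next
      case False
      then have u: "u \<in> ?D" "joined E ?D (N a) {u}" using uw(2) by (auto simp: A_def)
      show False
      proof (cases "w = b")
        case True
        have "joined E ?D {u} (N b)"
          by (rule joinedI[of u _ _ u]) (use u uw True edge_sym in auto)
        from joined_trans1[OF u(2) this] nj show False by simp
      next
        case False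
        then have w: "w \<in> ?D" using uw by auto
        have "joined E ?D {u} {w}"
          by (rule joinedI[of u _ _ w]) (use u w uw in \<open>auto intro: r_into_rtrancl\<close>)
        from A[OF w joined_trans1[OF u(2) this]] uw(5) show False by simp
      qed
    qed
  qed
  have bs: "branch_sets E {a, b, v} [{a}, {b}, {v}]" using V ab by auto
  have "adj E {a} {v}" "adj E {b} {v}" using e edge_sym by (auto simp: adj_def)
  then obtain p q where pq: "p \<noteq> q" "N a \<inter> ?C = {p, q}" "N b \<inter> ?C = {p, q}"
    using twin_contacts[OF no_H3 _ \<open>?C \<noteq> {}\<close> linked_del_path[OF e ab(1)] jn bs] V by blast
  have "N a = {v} \<union> (N a \<inter> ?C)" using e edge_in ab by auto
  moreover have "N b = {v} \<union> (N b \<inter> ?C)" using e edge_in ba edge_sym by auto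
  moreover have "p \<noteq> v" "q \<noteq> v" using pq by blast+
  ultimately show thesis using pq by (intro that[of p q]) (simp_all add: insert_commute)
qed

lemma exists_nonadjacent: "\<exists>x\<in>V. \<exists>y\<in>V. x \<noteq> y \<and> (x, y) \<notin> E"
proof (rule ccontr)
  assume "\<not> ?thesis"
  then have full: "(x, y) \<in> E" if "x \<in> V" "y \<in> V" "x \<noteq> y" for x y using that by blast
  obtain T where T: "T \<subseteq> V" "card T = 6" "finite T" using six by (meson obtain_subset_with_card_n)
  obtain xs where xs: "set xs = T" "distinct xs" using finite_distinct_list[OF T(3)] by auto
  then have "length xs = 6" using T(2) distinct_card by fastforce
  then obtain x1 x2 x3 x4 x5 x6 where "xs = [x1, x2, x3, x4, x5, x6]"
    by (auto simp: length_Suc_conv eval_nat_numeral)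
  then have d: "distinct [x1, x2, x3, x4, x5, x6]" and x: "x1 \<in> V" "x2 \<in> V" "x3 \<in> V" "x4 \<in> V" "x5 \<in> V" "x6 \<in> V"
    using xs T by auto
  have ad: "adj E {x} {y}" if "x \<in> V" "y \<in> V" "x \<noteq> y" for x y using full[OF that] by (auto simp: adj_def)
  have "branch_sets E V [{x1}, {x2}, {x3}, {x4}, {x5}, {x6}]" using d x by auto
  then have "has_H3 E V"
    by (rule has_H3I) (rule ad; use d x in simp)+
  then show False using no_H3 by simp
qed

text \<open>
  Take a node \<open>x\<close> with a node at distance two; its neighbourhood \<open>J\<close> has
  three elements. By the previous lemma, every node at distance two from \<open>x\<close> has the
  neighbourhood \<open>J\<close> as well, so all nodes outside of \<open>J\<close> do. An edge
  inside \<open>J\<close> would give \<open>H\<^sub>3\<close>, and two elements of \<open>J\<close>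
  are then themselves non-adjacent with a common neighbour, which bounds the other side by three.
\<close>

theorem is_K33:
  "\<exists>I J. V = I \<union> J \<and> I \<inter> J = {} \<and> card I = 3 \<and> card J = 3 \<and> E = I \<times> J \<union> J \<times> I"
proof -
  obtain x y where xy: "x \<in> V" "y \<in> V" "x \<noteq> y" "(x, y) \<notin> E" using exists_nonadjacent by auto
  obtain v b where vb: "(v, b) \<in> E" "v \<in> insert x (N x)" "b \<notin> insert x (N x)"
    using linked_edge_out[OF linkedV xy(1), of "insert x (N x)" y] xy by auto
  then have xv: "(x, v) \<in> E" by auto
  obtain p q where pq: "p \<noteq> q" "p \<noteq> v" "q \<noteq> v" "N x = {v, p, q}"
  proof (rule nonadjacent_twins[OF xv vb(1)])
    show "x \<noteq> b" "(x, b) \<notin> E" using vb by auto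
  qed (rule that)
  define J where "J = N x"
  define I where "I = {z \<in> V. N z = J}"
  have cJ: "card J = 3" using pq by (simp add: J_def)
  have JV: "J \<subseteq> V" using edge_in by (auto simp: J_def)
  have xI: "x \<in> I" using xy(1) by (simp add: I_def J_def)
  have IJ: "I \<inter> J = {}"
  proof (rule ccontr)
    assume "I \<inter> J \<noteq> {}"
    then obtain z where "z \<in> J" "N z = J" by (auto simp: I_def)
    then have "z \<in> N z" by blast
    then show False by simp
  qed
  have twin: "N z = N w" if "(z, j) \<in> E" "(j, w) \<in> E" "z \<noteq> w" "(z, w) \<notin> E" for z j w
    using nonadjacent_twins[OF that] by metis
  have V: "V = I \<union> J"
  proof (rule ccontr)
    assume "V \<noteq> I \<union> J"
    then obtain z where z: "z \<in> V" "z \<notin> I \<union> J" using JV by (auto simp: I_def)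
    obtain j w where jw: "(j, w) \<in> E" "j \<in> I \<union> J" "w \<in> V - (I \<union> J)"
      using linked_edge_out[OF linkedV xy(1), of "I \<union> J" z] z xI by auto
    have "j \<in> J"
    proof (rule ccontr)
      assume "j \<notin> J"
      then have "N j = J" using jw by (auto simp: I_def)
      then show False using jw by auto
    qed
    then have "(x, j) \<in> E" by (simp add: J_def)
    moreover have "x \<noteq> w" "(x, w) \<notin> E" using jw xI by (auto simp: J_def)
    ultimately have "N x = N w" using twin jw by blast
    then show False using jw by (auto simp: I_def J_def)
  qed
  have fin: "finite I" "finite J" using finV V by auto
  have "card V = card I + card J" using card_Un_disjoint[OF fin IJ] V by simp
  then have cI: "card I \<ge> 3" using six cJ by simp
  have IJE: "(i, j) \<in> E" "(j, i) \<in> E" if "i \<in> I" "j \<in> J" for i j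
  proof -
    have "j \<in> N i" using that by (auto simp: I_def)
    then show "(i, j) \<in> E" by simp
    then show "(j, i) \<in> E" by (rule edge_sym)
  qed
  have indepJ: "(j, k) \<notin> E" if jk: "j \<in> J" "k \<in> J" for j k
  proof
    assume e: "(j, k) \<in> E"
    then have "j \<noteq> k" by auto
    have "card (J - {j, k}) = 1" using cJ jk \<open>j \<noteq> k\<close> fin by (simp add: card_Diff_subset)
    then obtain l where l: "J - {j, k} = {l}" by (auto simp: card_1_singleton_iff)
    obtain T where T: "T \<subseteq> I" "card T = 3" using cI by (meson obtain_subset_with_card_n)
    then obtain i1 i2 i3 where i: "T = {i1, i2, i3}" "i1 \<noteq> i2" "i1 \<noteq> i3" "i2 \<noteq> i3" by (auto simp: card_3_iff)
    have iI: "i1 \<in> I" "i2 \<in> I" "i3 \<in> I" using T i by auto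
    have lJ: "l \<in> J" "l \<noteq> j" "l \<noteq> k" using l by auto
    have "branch_sets E V [{j}, {l}, {k}, {i1}, {i2}, {i3}]"
      using i iI jk lJ IJ V \<open>j \<noteq> k\<close> by auto
    then have "has_H3 E V"
      by (rule H3_of_K33_plus_edge) (use e IJE iI jk lJ in \<open>auto simp: adj_def\<close>)
    then show False using no_H3 by simp
  qed
  have NJ: "N j = I" if "j \<in> J" for j
  proof
    show "N j \<subseteq> I" using edge_in V indepJ[OF that] by blast
    show "I \<subseteq> N j" using IJE that by auto
  qed
  have "card I = 3"
  proof -
    have vp: "v \<in> J" "p \<in> J" "v \<noteq> p" using pq by (auto simp: J_def)
    obtain r s where "r \<noteq> s" "r \<noteq> x" "s \<noteq> x" "N v = {x, r, s}"
      using nonadjacent_twins[of v x p] IJE xI vp indepJ by metis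
    then show ?thesis using NJ[OF vp(1)] by simp
  qed
  moreover have "E = I \<times> J \<union> J \<times> I"
  proof
    show "E \<subseteq> I \<times> J \<union> J \<times> I"
    proof
      fix e assume e: "e \<in> E"
      obtain z w where zw: "e = (z, w)" by force
      then have "z \<in> V" "w \<in> V" "w \<in> N z" using e edge_in by auto
      show "e \<in> I \<times> J \<union> J \<times> I"
      proof (cases "z \<in> J")
        case True
        from \<open>w \<in> N z\<close> have "w \<in> I" unfolding NJ[OF True] .
        then show ?thesis using True zw by simp
      next
        case False
        then have zI: "z \<in> I" using \<open>z \<in> V\<close> V by simp
        then have eq: "N z = J" by (simp add: I_def)
        from \<open>w \<in> N z\<close> have "w \<in> J" unfolding eq .
        then show ?thesis using zI zw by simp
      qed
    qed
    show "I \<times> J \<union> J \<times> I \<subseteq> E" using IJE by auto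
  qed
  ultimately show ?thesis using V IJ cJ by blast
qed

end

context excluded_minors begin

text \<open>
  The two cases of the combinatorial argument come together: a separating pair of nodes starts a
  decomposition, and a graph without one is \<open>K\<^sub>3\<^sub>,\<^sub>3\<close>.
\<close>

theorem decomposable_or_K33:
  assumes "card V \<ge> 6"
    "\<not> (\<exists>I J. V = I \<union> J \<and> I \<inter> J = {} \<and> card I = 3 \<and> card J = 3 \<and> E = I \<times> J \<union> J \<times> I)"
  shows decomposable
proof (cases "\<exists>a b. a \<in> V \<and> b \<in> V \<and> a \<noteq> b \<and> \<not> linked E (V - {a, b})")
  case True
  then show ?thesis using decomposable_of_two_separator assms(1) by force
next
  case False
  interpret triconnected V E
    by unfold_locales (use no_H3 assms(1) False in auto)
  show ?thesis using is_K33 assms(2) by simp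
qed

end

section \<open>Trees of bags\<close>

text \<open>
  Trees in the order in which they are built. All constructions along trees below, the decomposition
  as well as the planar configuration, add one leaf at a time.
\<close>

inductive grown_tree :: "'t set \<Rightarrow> ('t \<times> 't) set \<Rightarrow> bool" where
  grown_tree_single: "grown_tree {r} {}"
| grown_tree_leaf: "grown_tree S F \<Longrightarrow> v \<in> S \<Longrightarrow> u \<notin> S \<Longrightarrow> grown_tree (insert u S) (insert (u, v) (insert (v, u) F))"

lemma grown_tree_basic:
  assumes "grown_tree S F"
  shows "finite S \<and> F \<subseteq> S \<times> S \<and> sym F \<and> irrefl F \<and> S \<noteq> {}"
  using assms by induction (auto simp: sym_def irrefl_def)

lemma grown_tree_linked: "grown_tree S F \<Longrightarrow> linked F S"
proof (induction rule: grown_tree.induct)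
  case (grown_tree_leaf S F v u)
  let ?F = "insert (u, v) (insert (v, u) F)"
  have "sym ?F" using grown_tree_basic[OF grown_tree_leaf(1)] by (auto simp: sym_def)
  moreover have "linked ?F S" by (rule linked_mono[OF grown_tree_leaf.IH]) auto
  ultimately show ?case using grown_tree_leaf(2) by (intro linked_insert[of ?F S v u]) auto
qed simp

text \<open>
  The last conjunct is weaker than in ordinary tree decompositions: the ends of an edge may lie in
  adjacent bags.
\<close>

definition tree_dec :: "('a \<times> 'a) set \<Rightarrow> 't set \<Rightarrow> ('t \<times> 't) set \<Rightarrow> ('t \<Rightarrow> 'a set) \<Rightarrow> 'a set \<Rightarrow> bool" where
  "tree_dec E S F bag W \<longleftrightarrow> grown_tree S F \<and>
     (\<forall>t\<in>S. bag t \<subseteq> W \<and> finite (bag t) \<and> card (bag t) \<le> 2) \<and>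
     (\<forall>w\<in>W. {t\<in>S. w \<in> bag t} \<noteq> {} \<and> linked F {t\<in>S. w \<in> bag t}) \<and>
     (\<forall>x\<in>W. \<forall>y\<in>W. (x, y) \<in> E \<longrightarrow>
        (\<exists>s\<in>S. \<exists>t\<in>S. x \<in> bag s \<and> y \<in> bag t \<and> (s = t \<or> (s, t) \<in> F)))"

lemma tree_decD:
  assumes "tree_dec E S F bag W"
  shows "grown_tree S F" "t \<in> S \<Longrightarrow> bag t \<subseteq> W" "t \<in> S \<Longrightarrow> finite (bag t)" "t \<in> S \<Longrightarrow> card (bag t) \<le> 2"
    "w \<in> W \<Longrightarrow> {t\<in>S. w \<in> bag t} \<noteq> {}" "w \<in> W \<Longrightarrow> linked F {t\<in>S. w \<in> bag t}"
    "x \<in> W \<Longrightarrow> y \<in> W \<Longrightarrow> (x, y) \<in> E \<Longrightarrow> \<exists>s\<in>S. \<exists>t\<in>S. x \<in> bag s \<and> y \<in> bag t \<and> (s = t \<or> (s, t) \<in> F)"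
  using assms by (simp_all add: tree_dec_def)

lemma tree_dec_add_leaf:
  assumes "sym E" and td: "tree_dec E S F bag W" and t: "t \<in> S" and u: "u \<notin> S"
    and X: "X \<subseteq> bag t \<union> C" "finite X" "card X \<le> 2" and C: "C \<inter> W = {}"
    and sep: "\<And>x c. x \<in> W - bag t \<Longrightarrow> c \<in> C \<Longrightarrow> (x, c) \<notin> E"
  shows "tree_dec E (insert u S) (insert (u, t) (insert (t, u) F)) (bag(u := X)) (W \<union> X)"
proof -
  let ?S = "insert u S" and ?F = "insert (u, t) (insert (t, u) F)" and ?bag = "bag(u := X)"
  note D = tree_decD[OF td]
  have tg: "grown_tree ?S ?F" by (rule grown_tree_leaf[OF D(1) t u])
  have sF: "sym ?F" using grown_tree_basic[OF tg] by simp
  have old: "s \<in> S \<Longrightarrow> ?bag s = bag s" for s using u by auto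
  have "\<forall>s\<in>?S. ?bag s \<subseteq> W \<union> X \<and> finite (?bag s) \<and> card (?bag s) \<le> 2"
    using D(2-4) X(2,3) u by auto
  moreover have "\<forall>w\<in>W \<union> X. {s\<in>?S. w \<in> ?bag s} \<noteq> {} \<and> linked ?F {s\<in>?S. w \<in> ?bag s}"
  proof
    fix w assume w: "w \<in> W \<union> X"
    show "{s\<in>?S. w \<in> ?bag s} \<noteq> {} \<and> linked ?F {s\<in>?S. w \<in> ?bag s}"
    proof (cases "w \<in> W")
      case True
      have l: "linked ?F {s\<in>S. w \<in> bag s}" by (rule linked_mono[OF D(6)[OF True]]) auto
      show ?thesis
      proof (cases "w \<in> X")
        case wX: True
        have "{s\<in>?S. w \<in> ?bag s} = insert u {s\<in>S. w \<in> bag s}" using wX old by auto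
        moreover have "t \<in> {s\<in>S. w \<in> bag s}" using wX X(1) C True t by auto
        then have "linked ?F (insert u {s\<in>S. w \<in> bag s})" by (rule linked_insert[OF sF l]) simp
        ultimately show ?thesis by auto
      next
        case False
        then have "{s\<in>?S. w \<in> ?bag s} = {s\<in>S. w \<in> bag s}" using u by auto
        then show ?thesis using l D(5)[OF True] by simp
      qed
    next
      case False
      then have "w \<in> X" "\<And>s. s \<in> S \<Longrightarrow> w \<notin> bag s" using w D(2) by auto
      then have "{s\<in>?S. w \<in> ?bag s} = {u}" using u by auto
      then show ?thesis by simp
    qed
  qed
  moreover have "\<forall>x\<in>W \<union> X. \<forall>y\<in>W \<union> X. (x, y) \<in> E \<longrightarrow>
      (\<exists>s\<in>?S. \<exists>s'\<in>?S. x \<in> ?bag s \<and> y \<in> ?bag s' \<and> (s = s' \<or> (s, s') \<in> ?F))"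
  proof (intro ballI impI)
    fix x y assume xy: "x \<in> W \<union> X" "y \<in> W \<union> X" "(x, y) \<in> E"
    have yx: "(y, x) \<in> E" using xy(3) assms(1) by (simp add: symD)
    have XC: "z \<in> C \<and> z \<in> X" if "z \<in> W \<union> X" "z \<notin> W" for z using that X(1) D(2)[OF t] by auto
    consider "x \<in> W" "y \<in> W" | "x \<in> W" "y \<notin> W" | "x \<notin> W" "y \<in> W" | "x \<notin> W" "y \<notin> W" by auto
    then show "\<exists>s\<in>?S. \<exists>s'\<in>?S. x \<in> ?bag s \<and> y \<in> ?bag s' \<and> (s = s' \<or> (s, s') \<in> ?F)"
    proof cases
      case 1
      then obtain s s' where s: "s \<in> S" "s' \<in> S" "x \<in> bag s" "y \<in> bag s'" "s = s' \<or> (s, s') \<in> F"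
        using D(7)[OF _ _ xy(3)] by auto
      then have "x \<in> ?bag s" "y \<in> ?bag s'" "s \<in> ?S" "s' \<in> ?S" "s = s' \<or> (s, s') \<in> ?F" using old by auto
      then show ?thesis by (intro bexI[of _ s] bexI[of _ s'] conjI)
    next
      case 2
      then have "x \<in> bag t" "y \<in> X" using sep xy(3) XC[OF xy(2)] by auto
      then have "x \<in> ?bag t" "y \<in> ?bag u" "t \<in> ?S" "u \<in> ?S" "(t, u) \<in> ?F" using old[OF t] t by simp_all
      then show ?thesis by (intro bexI[of _ t] bexI[of _ u] conjI disjI2)
    next
      case 3
      then have "y \<in> bag t" "x \<in> X" using sep yx XC[OF xy(1)] by auto
      then have "x \<in> ?bag u" "y \<in> ?bag t" "t \<in> ?S" "u \<in> ?S" "(u, t) \<in> ?F" using old[OF t] t by simp_all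
      then show ?thesis by (intro bexI[of _ u] bexI[of _ t] conjI disjI2)
    next
      case 4
      then have "x \<in> ?bag u" "y \<in> ?bag u" "u \<in> ?S" using XC xy by auto
      then show ?thesis by (intro bexI[of _ u] conjI disjI1 refl)
    qed
  qed
  ultimately show ?thesis using tg unfolding tree_dec_def by blast
qed

text \<open>
  The inductive definition of \<open>dec\<close> is a recipe for a tree: \<open>dec_move\<close>
  attaches the new bag as a leaf to the bag \<open>P\<close>, and \<open>dec_union\<close> continues
  twice from the same bag, which is why the old bags have to be preserved. The tree nodes are
  natural numbers, so a fresh one is always available.
\<close>

lemma tree_dec_extend:
  fixes S :: "nat set"
  assumes "dec E P C" "sym E" "tree_dec E S F bag W" "t \<in> S" "bag t = P" "C \<inter> W = {}"
    "\<And>x c. x \<in> W - P \<Longrightarrow> c \<in> C \<Longrightarrow> (x, c) \<notin> E"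
  shows "\<exists>S' F' bag'. tree_dec E S' F' bag' (W \<union> C) \<and> S \<subseteq> S' \<and> (\<forall>s\<in>S. bag' s = bag s)"
  using assms
proof (induction arbitrary: S F bag W t rule: dec.induct)
  case (dec_empty P)
  then show ?case by (intro exI[of _ S] exI[of _ F] exI[of _ bag]) auto
next
  case (dec_union P C D)
  obtain S1 F1 bag1 where 1: "tree_dec E S1 F1 bag1 (W \<union> C)" "S \<subseteq> S1" "\<forall>s\<in>S. bag1 s = bag s"
    using dec_union.IH(1)[OF dec_union.prems(1-4)] dec_union.prems(5,6) by blast
  have tS1: "t \<in> S1" "bag1 t = P" "D \<inter> (W \<union> C) = {}" using 1 dec_union by auto
  have sep: "(x, c) \<notin> E" if "x \<in> W \<union> C - P" "c \<in> D" for x c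
    using that dec_union.prems(6)[of x c] dec_union.hyps(4) by (auto simp: adj_def)
  obtain S2 F2 bag2 where "tree_dec E S2 F2 bag2 (W \<union> C \<union> D)" "S1 \<subseteq> S2" "\<forall>s\<in>S1. bag2 s = bag1 s"
    using dec_union.IH(2)[OF dec_union.prems(1) 1(1) tS1 sep] by blast
  then show ?case using 1 by (intro exI[of _ S2] exI[of _ F2] exI[of _ bag2]) (auto simp: Un_assoc)
next
  case (dec_move X P C)
  note D = tree_decD[OF dec_move.prems(2)]
  have "finite S" using grown_tree_basic[OF D(1)] by simp
  then obtain u where u: "u \<notin> S" using ex_new_if_finite infinite_UNIV_nat by metis
  let ?S = "insert u S" and ?F = "insert (u, t) (insert (t, u) F)" and ?bag = "bag(u := X)"
  have td: "tree_dec E ?S ?F ?bag (W \<union> X)"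
    by (rule tree_dec_add_leaf[OF dec_move.prems(1,2,3) u _ dec_move.hyps(2,3) dec_move.prems(5)])
      (use dec_move.hyps(1) dec_move.prems(4,6) in auto)
  have PW: "P \<subseteq> W" using D(2)[OF dec_move.prems(3)] dec_move.prems(4) by simp
  have sep: "(x, c) \<notin> E" if "x \<in> W \<union> X - X" "c \<in> C - X" for x c
    using that dec_move.prems(6)[of x c] dec_move.hyps(4)[of x c] by auto
  have "(C - X) \<inter> (W \<union> X) = {}" using dec_move.prems(5) by auto
  then have "\<exists>S' F' bag'. tree_dec E S' F' bag' (W \<union> X \<union> (C - X)) \<and> ?S \<subseteq> S' \<and> (\<forall>s\<in>?S. bag' s = ?bag s)"
    by (intro dec_move.IH[OF dec_move.prems(1) td, of u] sep) auto
  then obtain S' F' bag' where *: "tree_dec E S' F' bag' (W \<union> X \<union> (C - X))" "?S \<subseteq> S'" "\<forall>s\<in>?S. bag' s = ?bag s"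
    by (elim exE conjE) (rule that)
  have "W \<union> X \<union> (C - X) = W \<union> C" using dec_move.hyps(1) PW by auto
  then show ?case using * u by (intro exI[of _ S'] exI[of _ F'] exI[of _ bag']) auto
qed

lemma (in fin_graph) tree_dec_of_decomposable:
  assumes decomposable
  obtains S :: "nat set" and F bag where "tree_dec E S F bag V"
proof -
  obtain a b where ab: "a \<in> V" "b \<in> V" "a \<noteq> b" "dec E {a, b} (V - {a, b})"
    using assms by (auto simp: decomposable_def)
  have "grown_tree {0::nat} {}" by (rule grown_tree_single)
  then have td: "tree_dec E {0::nat} {} (\<lambda>_. {a, b}) {a, b}"
    unfolding tree_dec_def by (auto simp: card_insert_if)
  have "\<exists>S' F' bag'. tree_dec E S' F' bag' ({a, b} \<union> (V - {a, b})) \<and> {0::nat} \<subseteq> S' \<and> (\<forall>s\<in>{0}. bag' s = {a, b})"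
    by (rule tree_dec_extend[OF ab(4) symE td, of 0]) auto
  then obtain S' :: "nat set" and F' bag' where "tree_dec E S' F' bag' ({a, b} \<union> (V - {a, b}))" by blast
  moreover have "{a, b} \<union> (V - {a, b}) = V" using ab by auto
  ultimately show thesis using that by simp
qed

section \<open>Minor models\<close>

text \<open>
  \<open>\<beta>\<close> assigns branch sets in the graph \<open>(V, E)\<close> to the nodes of the
  graph \<open>(VM, EM)\<close>.
\<close>

definition model :: "('m \<times> 'm) set \<Rightarrow> 'm set \<Rightarrow> ('a \<times> 'a) set \<Rightarrow> 'a set \<Rightarrow> ('m \<Rightarrow> 'a set) \<Rightarrow> bool" where
  "model EM VM E V \<beta> \<longleftrightarrow>
     (\<forall>x\<in>VM. \<beta> x \<noteq> {} \<and> \<beta> x \<subseteq> V \<and> linked E (\<beta> x)) \<and>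
     (\<forall>x\<in>VM. \<forall>y\<in>VM. x \<noteq> y \<longrightarrow> \<beta> x \<inter> \<beta> y = {}) \<and>
     (\<forall>x\<in>VM. \<forall>y\<in>VM. (x, y) \<in> EM \<longrightarrow> adj E (\<beta> x) (\<beta> y))"

lemma modelD:
  assumes "model EM VM E V \<beta>"
  shows "x \<in> VM \<Longrightarrow> \<beta> x \<noteq> {}" "x \<in> VM \<Longrightarrow> \<beta> x \<subseteq> V" "x \<in> VM \<Longrightarrow> linked E (\<beta> x)"
    "x \<in> VM \<Longrightarrow> y \<in> VM \<Longrightarrow> x \<noteq> y \<Longrightarrow> \<beta> x \<inter> \<beta> y = {}"
    "x \<in> VM \<Longrightarrow> y \<in> VM \<Longrightarrow> (x, y) \<in> EM \<Longrightarrow> adj E (\<beta> x) (\<beta> y)"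
  using assms by (simp_all add: model_def)

lemma linked_image:
  assumes "linked F A" "\<And>s t. (s, t) \<in> F \<Longrightarrow> s \<in> A \<Longrightarrow> t \<in> A \<Longrightarrow> g s = g t \<or> (g s, g t) \<in> E"
  shows "linked E (g ` A)"
  unfolding linked_def
proof (intro ballI)
  fix x y assume "x \<in> g ` A" "y \<in> g ` A"
  then obtain s t where st: "s \<in> A" "t \<in> A" "x = g s" "y = g t" by auto
  have "(s, t) \<in> (F \<inter> A \<times> A)\<^sup>*" by (rule linkedD[OF assms(1) st(1,2)])
  then have "(g s, g t) \<in> (E \<inter> g ` A \<times> g ` A)\<^sup>*"
  proof (induction rule: rtrancl_induct)
    case (step u v)
    then have "g u = g v \<or> (g u, g v) \<in> E \<inter> g ` A \<times> g ` A" using assms(2) by auto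
    then show ?case
    proof
      assume "g u = g v"
      then show ?thesis using step.IH by metis
    next
      assume "(g u, g v) \<in> E \<inter> g ` A \<times> g ` A"
      with step.IH show ?thesis by (rule rtrancl_into_rtrancl)
    qed
  qed simp
  then show "(x, y) \<in> (E \<inter> g ` A \<times> g ` A)\<^sup>*" using st by metis
qed

text \<open>
  Number the at most two elements of every bag by 0 and 1. The branch set of a node consists of its
  positions in all the bags that contain it.
\<close>

lemma model_of_tree_dec:
  assumes "tree_dec E S F bag W"
    and "\<And>s i t j. s \<in> S \<Longrightarrow> t \<in> S \<Longrightarrow> i < (2::nat) \<Longrightarrow> j < 2 \<Longrightarrow> (s, i) \<noteq> (t, j) \<Longrightarrow> s = t \<or> (s, t) \<in> F \<Longrightarrow>
       ((s, i), (t, j)) \<in> E'"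
    and "irrefl E"
  shows "\<exists>\<beta>. model E W E' (S \<times> {..<2}) \<beta>"
proof -
  note D = tree_decD[OF assms(1)]
  have "\<forall>t\<in>S. \<exists>f. inj_on f (bag t) \<and> f ` bag t \<subseteq> {..<2::nat}"
    using D(3,4) by (metis card_lessThan card_le_inj finite_lessThan image_subset_iff)
  then obtain sl where sl: "\<And>t. t \<in> S \<Longrightarrow> inj_on (sl t) (bag t)" "\<And>t v. t \<in> S \<Longrightarrow> v \<in> bag t \<Longrightarrow> sl t v < (2::nat)"
    by (metis image_subset_iff lessThan_iff)
  define A where "A v = {t\<in>S. v \<in> bag t}" for v
  define \<beta> where "\<beta> v = (\<lambda>t. (t, sl t v)) ` A v" for v
  have irF: "(s, s) \<notin> F" for s using grown_tree_basic[OF D(1)] by (auto simp: irrefl_def)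
  have "model E W E' (S \<times> {..<2}) \<beta>"
    unfolding model_def
  proof (intro conjI ballI impI)
    fix x assume x: "x \<in> W"
    show "\<beta> x \<noteq> {}" using D(5)[OF x] by (auto simp: \<beta>_def A_def)
    show "\<beta> x \<subseteq> S \<times> {..<2}" using sl(2) by (auto simp: \<beta>_def A_def)
    show "linked E' (\<beta> x)"
      unfolding \<beta>_def
    proof (rule linked_image)
      show "linked F (A x)" using D(6)[OF x] by (simp add: A_def)
      fix s t assume "(s, t) \<in> F" "s \<in> A x" "t \<in> A x"
      then show "(s, sl s x) = (t, sl t x) \<or> ((s, sl s x), t, sl t x) \<in> E'"
        using sl(2) irF by (intro disjI2 assms(2)) (auto simp: A_def)
    qed
  next
    fix x y assume "x \<in> W" "y \<in> W" "x \<noteq> y"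
    then show "\<beta> x \<inter> \<beta> y = {}" using sl(1) by (auto simp: \<beta>_def A_def inj_on_def)
  next
    fix x y assume xy: "x \<in> W" "y \<in> W" "(x, y) \<in> E"
    then obtain s t where st: "s \<in> S" "t \<in> S" "x \<in> bag s" "y \<in> bag t" "s = t \<or> (s, t) \<in> F" using D(7) by blast
    have "x \<noteq> y" using xy(3) assms(3) by (auto simp: irrefl_def)
    have ne: "(s, sl s x) \<noteq> (t, sl t y)" using st \<open>x \<noteq> y\<close> sl(1) by (auto simp: inj_on_def)
    have "((s, sl s x), (t, sl t y)) \<in> E'" using st ne sl(2) by (intro assms(2)) auto
    moreover have "(s, sl s x) \<in> \<beta> x" "(t, sl t y) \<in> \<beta> y" using st by (auto simp: \<beta>_def A_def)
    ultimately show "adj E' (\<beta> x) (\<beta> y)" by (auto simp: adj_def)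
  qed
  then show ?thesis by blast
qed

section \<open>Symmetric digraphs as arc sets\<close>

abbreviation simple_graph :: "'a ugraph \<Rightarrow> bool" where
  "simple_graph G \<equiv> fin_graph (pverts G) (parcs G)"

lemma simple_graph_iff: "simple_graph G \<longleftrightarrow> pair_graph G"
proof
  assume "simple_graph G"
  then interpret fin_graph "pverts G" "parcs G" .
  show "pair_graph G"
    by unfold_locales (use finV finE EV symE in \<open>auto simp: symmetric_def\<close>)
next
  assume "pair_graph G"
  then interpret pair_graph G .
  show "simple_graph G"
  proof
    show "sym (parcs G)" using pair_sym_arcs by (simp add: symmetric_def)
    show "irrefl (parcs G)"
      unfolding irrefl_def
    proof
      fix x show "(x, x) \<notin> parcs G" using pair_no_loops[of "(x, x)"] by auto
    qed
    show "parcs G \<subseteq> pverts G \<times> pverts G" by (auto intro: in_arcsD1 in_arcsD2)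
  qed (rule pair_finite_verts)
qed

lemma rtrancl_on_restrict:
  "(u, v) \<in> rtrancl_on V E \<longleftrightarrow> u \<in> V \<and> v \<in> V \<and> (u, v) \<in> (E \<inter> V \<times> V)\<^sup>*"
proof (intro iffI conjI)
  assume a: "(u, v) \<in> rtrancl_on V E"
  then show "u \<in> V" "v \<in> V" by (rule in_rtrancl_on_in_F)+
  show "(u, v) \<in> (E \<inter> V \<times> V)\<^sup>*"
    using a
  proof (induction rule: rtrancl_on_induct)
    case (step y z)
    then have "(y, z) \<in> E \<inter> V \<times> V" by simp
    with step.IH show ?case by (rule rtrancl_into_rtrancl)
  qed simp
next
  assume "u \<in> V \<and> v \<in> V \<and> (u, v) \<in> (E \<inter> V \<times> V)\<^sup>*"
  then have uv: "(u, v) \<in> (E \<inter> V \<times> V)\<^sup>*" and u: "u \<in> V" by simp_all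
  from uv show "(u, v) \<in> rtrancl_on V E"
  proof (induction rule: rtrancl_induct)
    case base
    show ?case using u by (rule rtrancl_on_refl)
  next
    case (step y z)
    then have "(y, z) \<in> E" "z \<in> V" by simp_all
    with step.IH show ?case by (rule rtrancl_on_into_rtrancl_on)
  qed
qed

lemma reachable_iff:
  "reachable (with_proj G) u v \<longleftrightarrow> u \<in> pverts G \<and> v \<in> pverts G \<and> (u, v) \<in> (parcs G \<inter> pverts G \<times> pverts G)\<^sup>*"
  by (simp add: reachable_def rtrancl_on_restrict)

lemma connected_iff:
  assumes "simple_graph G"
  shows "connected (with_proj G) \<longleftrightarrow> pverts G \<noteq> {} \<and> linked (parcs G) (pverts G)"
proof -
  interpret fin_graph "pverts G" "parcs G" by fact
  have "mk_symmetric (with_proj G) = G"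
    unfolding mk_symmetric_def by (rule pair_pre_digraph.equality) (use edge_sym in auto)
  then show ?thesis
    unfolding connected_def strongly_connected_def linked_def by (simp add: reachable_iff)
qed

text \<open>
  Deleting a node of a connected graph without cut nodes keeps all other pairs connected.
\<close>

lemma two_connected_linked:
  assumes "simple_graph G" "two_connected G"
  shows "linked (parcs G) (pverts G)" "v \<in> pverts G \<Longrightarrow> linked (parcs G) (pverts G - {v})"
proof -
  interpret fin_graph "pverts G" "parcs G" by fact
  show l: "linked (parcs G) (pverts G)" using assms by (simp add: two_connected_def connected_iff)
  assume v: "v \<in> pverts G"
  have nc: "\<not> cut_node G v" using assms by (simp add: two_connected_def)
  show "linked (parcs G) (pverts G - {v})"
    unfolding linked_def
  proof (intro ballI)
    fix x y assume xy: "x \<in> pverts G - {v}" "y \<in> pverts G - {v}"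
    have "reachable (with_proj G) x y" using linkedD[OF l] xy by (simp add: reachable_iff)
    then have "reachable (with_proj (delete_node G v)) x y" using nc v xy unfolding cut_node_def by blast
    then have "(x, y) \<in> (parcs (delete_node G v) \<inter> pverts (delete_node G v) \<times> pverts (delete_node G v))\<^sup>*"
      by (simp add: reachable_iff)
    moreover have "parcs (delete_node G v) \<inter> pverts (delete_node G v) \<times> pverts (delete_node G v)
      = parcs G \<inter> (pverts G - {v}) \<times> (pverts G - {v})"
      by (auto simp: delete_node_def)
    ultimately show "(x, y) \<in> (parcs G \<inter> (pverts G - {v}) \<times> (pverts G - {v}))\<^sup>*" by simp
  qed
qed

lemma digraph_isoI:
  assumes "simple_graph M" "inj_on g (pverts M)" "pverts H = g ` pverts M" "parcs H = map_prod g g ` parcs M"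
  shows "digraph_iso (with_proj M) (with_proj H)"
proof -
  interpret fin_graph "pverts M" "parcs M" by fact
  let ?f = "\<lparr>iso_verts = g, iso_arcs = map_prod g g, iso_head = snd, iso_tail = fst\<rparr>"
  have wf: "wf_digraph (with_proj M)" by unfold_locales (use EV in auto)
  have "inj_on (map_prod g g) (parcs M)"
    by (rule inj_on_subset[OF map_prod_inj_on[OF assms(2,2)] EV])
  then have "pre_digraph.digraph_isomorphism (with_proj M) ?f"
    using assms(2) wf by (auto simp: pre_digraph.digraph_isomorphism_def)
  moreover have "with_proj H = app_iso ?f (with_proj M)"
    using assms(3,4) by (simp add: app_iso_def with_proj_def)
  ultimately show ?thesis unfolding digraph_iso_def by blast
qed

text \<open>
  An isomorphism between graphs whose arcs are pairs maps arcs by their ends, as its tail and head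
  maps are the projections.
\<close>

lemma digraph_isoE:
  assumes "digraph_iso (with_proj M) (with_proj H)"
  obtains f where "inj_on f (pverts M)" "pverts H = f ` pverts M"
    "\<And>x y. (x, y) \<in> parcs M \<Longrightarrow> (f x, f y) \<in> parcs H"
proof -
  obtain h where h: "pre_digraph.digraph_isomorphism (with_proj M) h" "with_proj H = app_iso h (with_proj M)"
    using assms unfolding digraph_iso_def by blast
  have eq: "verts (with_proj H) = verts (app_iso h (with_proj M))" "arcs (with_proj H) = arcs (app_iso h (with_proj M))"
    "tail (with_proj H) = tail (app_iso h (with_proj M))" "head (with_proj H) = head (app_iso h (with_proj M))"
    using h(2) by simp_all
  have v: "pverts H = iso_verts h ` pverts M" and a: "parcs H = iso_arcs h ` parcs M"
    and t: "iso_tail h = fst" and hd: "iso_head h = snd"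
    using eq by simp_all
  have "(iso_verts h x, iso_verts h y) \<in> parcs H" if xy: "(x, y) \<in> parcs M" for x y
  proof -
    have "iso_verts h x = fst (iso_arcs h (x, y))" "iso_verts h y = snd (iso_arcs h (x, y))"
      using h(1) xy t hd by (auto simp: pre_digraph.digraph_isomorphism_def)
    then have "(iso_verts h x, iso_verts h y) = iso_arcs h (x, y)" by (simp add: prod_eq_iff)
    then show ?thesis using a xy by auto
  qed
  moreover have "inj_on (iso_verts h) (pverts M)"
    using h(1) by (simp add: pre_digraph.digraph_isomorphism_def)
  ultimately show thesis using that v by blast
qed

section \<open>Minors are branch-set models\<close>

lemma simple_graph_minor_step:
  assumes "minor_step G H" "simple_graph G"
  shows "simple_graph H"
  using assms
proof (induction rule: minor_step.induct)
  case (edge_deletion u v G)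
  then interpret fin_graph "pverts G" "parcs G" by simp
  show ?case
    by unfold_locales (use finV EV symE irreflE in \<open>auto simp: delete_edge_def sym_def irrefl_def\<close>)
next
  case (node_deletion v G)
  then interpret fin_graph "pverts G" "parcs G" by simp
  show ?case
    by unfold_locales (use finV EV symE irreflE in \<open>auto simp: delete_node_def sym_def irrefl_def\<close>)
next
  case (edge_contraction u v G)
  then interpret fin_graph "pverts G" "parcs G" by simp
  show ?case
  proof
    show "sym (parcs (contract_edge G u v))"
      unfolding contract_edge_def Let_def sym_def using edge_sym by (simp, blast)
  qed (use finV EV in \<open>auto simp: contract_edge_def Let_def irrefl_def\<close>)
qed

text \<open>
  A model of \<open>H\<close> in \<open>G\<close> survives a minor operation on \<open>H\<close>:
  contracting an edge merges the two branch sets of its ends.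
\<close>

lemma model_minor_step:
  assumes "minor_step H H'" "simple_graph H" "simple_graph G" "model (parcs H) (pverts H) (parcs G) (pverts G) \<beta>"
  shows "\<exists>\<beta>'. model (parcs H') (pverts H') (parcs G) (pverts G) \<beta>'"
  using assms
proof (induction rule: minor_step.induct)
  case (edge_deletion u v H)
  then show ?case by (intro exI[of _ \<beta>]) (auto simp: delete_edge_def model_def)
next
  case (node_deletion v H)
  then show ?case by (intro exI[of _ \<beta>]) (auto simp: delete_node_def model_def)
next
  case (edge_contraction u v H)
  interpret H: fin_graph "pverts H" "parcs H" by fact
  interpret G: fin_graph "pverts G" "parcs G" by fact
  note M = modelD[OF edge_contraction(4)]
  have uv: "u \<in> pverts H" "v \<in> pverts H" "u \<noteq> v" using edge_contraction(1) H.edge_in H.no_loop by auto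
  define f where "f x = (if x = v then u else x)" for x
  define \<beta>' where "\<beta>' = \<beta>(u := \<beta> u \<union> \<beta> v)"
  have V: "pverts (contract_edge H u v) = pverts H - {v}"
    using uv by (auto simp: contract_edge_def)
  have sub: "\<beta> x \<subseteq> \<beta>' (f x)" for x by (auto simp: f_def \<beta>'_def)
  have "model (parcs (contract_edge H u v)) (pverts H - {v}) (parcs G) (pverts G) \<beta>'"
    unfolding model_def
  proof (intro conjI ballI impI)
    fix x assume x: "x \<in> pverts H - {v}"
    show "\<beta>' x \<noteq> {}" "\<beta>' x \<subseteq> pverts G" using M(1,2) x uv by (auto simp: \<beta>'_def)
    have "linked (parcs G) (\<beta> u \<union> \<beta> v)"
      using M(3)[OF uv(1)] M(3)[OF uv(2)] M(5)[OF uv(1,2) edge_contraction(1)] by (intro linked_Un_adj G.symE)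
    then show "linked (parcs G) (\<beta>' x)" using M(3) x by (auto simp: \<beta>'_def)
  next
    fix x y assume "x \<in> pverts H - {v}" "y \<in> pverts H - {v}" "x \<noteq> y"
    then show "\<beta>' x \<inter> \<beta>' y = {}"
      using M(4)[of x y] M(4)[of v y] M(4)[of x v] uv by (auto simp: \<beta>'_def)
  next
    fix x y assume "(x, y) \<in> parcs (contract_edge H u v)"
    then obtain p q where "x = f p" "y = f q" and pq: "(p, q) \<in> parcs H"
      by (auto simp: contract_edge_def f_def Let_def)
    then show "adj (parcs G) (\<beta>' x) (\<beta>' y)"
      using adj_mono[OF M(5)[OF _ _ pq] sub sub] H.edge_in[OF pq] by simp
  qed
  then show ?case using V by auto
qed

lemma model_of_minor:
  assumes "is_minor M G" "simple_graph G"
  obtains \<beta> where "model (parcs M) (pverts M) (parcs G) (pverts G) \<beta>"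
proof -
  obtain H where H: "minor_step\<^sup>*\<^sup>* G H" "digraph_iso (with_proj M) (with_proj H)"
    using assms(1) by (auto simp: is_minor_def)
  from H(1) have "simple_graph H \<and> (\<exists>\<beta>. model (parcs H) (pverts H) (parcs G) (pverts G) \<beta>)"
  proof (induction rule: rtranclp_induct)
    case base
    interpret fin_graph "pverts G" "parcs G" by fact
    have "model (parcs G) (pverts G) (parcs G) (pverts G) (\<lambda>x. {x})" by (auto simp: model_def adj_def)
    then show ?case using assms(2) by blast
  next
    case (step H H')
    then show ?case using simple_graph_minor_step[OF step(2)] model_minor_step[OF step(2) _ assms(2)] by blast
  qed
  then obtain \<beta> where b: "model (parcs H) (pverts H) (parcs G) (pverts G) \<beta>" by blast
  note B = modelD[OF b]
  obtain f where f: "inj_on f (pverts M)" "pverts H = f ` pverts M" "\<And>x y. (x, y) \<in> parcs M \<Longrightarrow> (f x, f y) \<in> parcs H"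
    using digraph_isoE[OF H(2)] by blast
  have "model (parcs M) (pverts M) (parcs G) (pverts G) (\<lambda>x. \<beta> (f x))"
    unfolding model_def
  proof (intro conjI ballI impI)
    fix x y assume xy: "x \<in> pverts M" "y \<in> pverts M" "x \<noteq> y"
    then have "f x \<noteq> f y" using f(1) by (auto simp: inj_on_def)
    then show "\<beta> (f x) \<inter> \<beta> (f y) = {}" using B(4) f(2) xy by auto
  qed (use B(1,2,3,5) f(2,3) in auto)
  then show thesis by (rule that)
qed

lemma is_minor_step: "minor_step G H \<Longrightarrow> is_minor M H \<Longrightarrow> is_minor M G"
  unfolding is_minor_def by (meson converse_rtranclp_into_rtranclp)

lemma model_linked_mono:
  assumes "linked E S" "E \<inter> S \<times> S \<subseteq> E'"
  shows "linked E' S"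
  unfolding linked_def
proof (intro ballI)
  fix x y assume "x \<in> S" "y \<in> S"
  have "(x, y) \<in> (E \<inter> S \<times> S)\<^sup>*" by (rule linkedD[OF assms(1)]) fact+
  then show "(x, y) \<in> (E' \<inter> S \<times> S)\<^sup>*" by (rule subsetD[OF rtrancl_mono, rotated]) (use assms(2) in blast)
qed

text \<open>
  Induction on the size of \<open>G\<close>. A node outside of all branch sets is deleted, an edge
  inside a branch set is contracted, and when all branch sets are single nodes, an edge that
  \<open>M\<close> lacks is deleted. If none of these applies, the model is an isomorphism.
\<close>

theorem minor_of_model:
  assumes "simple_graph M" "simple_graph G" "model (parcs M) (pverts M) (parcs G) (pverts G) \<beta>"
  shows "is_minor M G"
  using assms(2,3)
proof (induction "card (pverts G) + card (parcs G)" arbitrary: G \<beta> rule: less_induct)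
  case less
  interpret M: fin_graph "pverts M" "parcs M" by fact
  interpret G: fin_graph "pverts G" "parcs G" by fact
  note B = modelD[OF less.prems(2)]
  have reduce: "is_minor M G" if "minor_step G H" "card (pverts H) + card (parcs H) < card (pverts G) + card (parcs G)"
      "model (parcs M) (pverts M) (parcs H) (pverts H) \<gamma>" for H \<gamma>
    using is_minor_step[OF that(1)] less.hyps[OF that(2) simple_graph_minor_step[OF that(1) less.prems(1)] that(3)] .
  show ?case
  proof (cases "\<exists>v\<in>pverts G. \<forall>x\<in>pverts M. v \<notin> \<beta> x")
    case True
    then obtain v where v: "v \<in> pverts G" "\<And>x. x \<in> pverts M \<Longrightarrow> v \<notin> \<beta> x" by auto
    let ?H = "delete_node G v"
    have "card (pverts ?H) < card (pverts G)"
      by (rule psubset_card_mono[OF G.finV]) (use v in \<open>auto simp: delete_node_def\<close>)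
    moreover have "card (parcs ?H) \<le> card (parcs G)"
      by (rule card_mono[OF G.finE]) (auto simp: delete_node_def)
    moreover have "model (parcs M) (pverts M) (parcs ?H) (pverts ?H) \<beta>"
      unfolding model_def
    proof (intro conjI ballI impI)
      fix x assume x: "x \<in> pverts M"
      show "\<beta> x \<noteq> {}" "\<beta> x \<subseteq> pverts ?H" using B(1,2)[OF x] v(2)[OF x] by (auto simp: delete_node_def)
      show "linked (parcs ?H) (\<beta> x)"
        by (rule model_linked_mono[OF B(3)[OF x]]) (use v(2)[OF x] in \<open>auto simp: delete_node_def\<close>)
    next
      fix x y assume xy: "x \<in> pverts M" "y \<in> pverts M" "(x, y) \<in> parcs M"
      then show "adj (parcs ?H) (\<beta> x) (\<beta> y)"
        using B(5)[OF xy] v(2)[OF xy(1)] v(2)[OF xy(2)] by (auto simp: adj_def delete_node_def)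
    qed (rule B(4))
    ultimately show ?thesis using v by (intro reduce[of ?H \<beta>] node_deletion) auto
  next
    case False
    then have cover: "\<exists>x\<in>pverts M. v \<in> \<beta> x" if "v \<in> pverts G" for v using that by blast
    show ?thesis
    proof (cases "\<exists>x\<in>pverts M. \<exists>u v. (u, v) \<in> parcs G \<and> u \<in> \<beta> x \<and> v \<in> \<beta> x")
      case True
      then obtain z u v where z: "z \<in> pverts M" "(u, v) \<in> parcs G" "u \<in> \<beta> z" "v \<in> \<beta> z" by auto
      let ?H = "contract_edge G u v"
      define f where "f x = (if x = v then u else x)" for x
      have uv: "u \<noteq> v" "u \<in> pverts G" "v \<in> pverts G" using z G.no_loop G.edge_in by auto
      have H: "pverts ?H = pverts G - {v}" "parcs ?H = {(f a, f b) |a b. (a, b) \<in> parcs G \<and> f a \<noteq> f b}"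
        using uv by (auto simp: contract_edge_def f_def Let_def)
      have fb: "f ` \<beta> x = \<beta> x - {v}" if "x \<in> pverts M" for x
        using B(4)[OF that z(1)] z(3,4) uv(1) by (cases "x = z") (auto simp: f_def image_iff)
      have "card (pverts ?H) < card (pverts G)"
        unfolding H by (rule psubset_card_mono[OF G.finV]) (use uv in auto)
      moreover have "card (parcs ?H) \<le> card (parcs G)"
      proof -
        have "parcs ?H \<subseteq> map_prod f f ` parcs G" unfolding H by auto
        then have "card (parcs ?H) \<le> card (map_prod f f ` parcs G)" by (intro card_mono finite_imageI G.finE)
        also have "\<dots> \<le> card (parcs G)" by (rule card_image_le[OF G.finE])
        finally show ?thesis .
      qed
      moreover have "model (parcs M) (pverts M) (parcs ?H) (pverts ?H) (\<lambda>x. \<beta> x - {v})"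
        unfolding model_def
      proof (intro conjI ballI impI)
        fix x assume x: "x \<in> pverts M"
        show "\<beta> x - {v} \<noteq> {}" using fb[OF x] B(1)[OF x] by (metis image_is_empty)
        show "\<beta> x - {v} \<subseteq> pverts ?H" using B(2)[OF x] unfolding H by auto
        show "linked (parcs ?H) (\<beta> x - {v})"
          unfolding fb[OF x, symmetric] H by (rule linked_image[OF B(3)[OF x]]) auto
      next
        fix x y assume "x \<in> pverts M" "y \<in> pverts M" "x \<noteq> y"
        then show "(\<beta> x - {v}) \<inter> (\<beta> y - {v}) = {}" using B(4)[of x y] by auto
      next
        fix x y assume xy: "x \<in> pverts M" "y \<in> pverts M" "(x, y) \<in> parcs M"
        then obtain p q where pq: "p \<in> \<beta> x" "q \<in> \<beta> y" "(p, q) \<in> parcs G" using B(5)[OF xy] by (auto simp: adj_def)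
        have "x \<noteq> y" using xy M.no_loop by auto
        have m: "f p \<in> \<beta> x - {v}" "f q \<in> \<beta> y - {v}" using pq fb[OF xy(1)] fb[OF xy(2)] by blast+
        moreover have "f p \<noteq> f q" using m B(4)[OF xy(1,2) \<open>x \<noteq> y\<close>] by auto
        ultimately show "adj (parcs ?H) (\<beta> x - {v}) (\<beta> y - {v})"
          unfolding H adj_def using pq(3) by blast
      qed
      ultimately show ?thesis using z by (intro reduce[of ?H "\<lambda>x. \<beta> x - {v}"] edge_contraction) auto
    next
      case False
      have single: "\<exists>u. \<beta> x = {u}" if x: "x \<in> pverts M" for x
      proof (rule ccontr)
        assume n: "\<not> ?thesis"
        obtain u where u: "u \<in> \<beta> x" using B(1)[OF x] by auto
        then obtain w where w: "w \<in> \<beta> x" "w \<noteq> u" using n by blast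
        from linked_edge_out[OF B(3)[OF x] u, of "{u}" w] w
        show False using False x by blast
      qed
      define g where "g x = the_elem (\<beta> x)" for x
      have g: "\<beta> x = {g x}" if x: "x \<in> pverts M" for x
      proof -
        obtain u where u: "\<beta> x = {u}" using single[OF x] by (elim exE)
        then show ?thesis unfolding g_def u by simp
      qed
      have inj: "inj_on g (pverts M)"
      proof (rule inj_onI, rule ccontr)
        fix x y assume xy: "x \<in> pverts M" "y \<in> pverts M" "g x = g y" "x \<noteq> y"
        from B(4)[OF xy(1,2,4)] show False using g[OF xy(1)] g[OF xy(2)] xy(3) by simp
      qed
      have V: "pverts G = g ` pverts M"
      proof
        show "pverts G \<subseteq> g ` pverts M"
        proof
          fix v assume "v \<in> pverts G"
          then obtain x where x: "x \<in> pverts M" "v \<in> \<beta> x" using cover by blast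
          then have "v = g x" using g[OF x(1)] by simp
          then show "v \<in> g ` pverts M" using x(1) by simp
        qed
        show "g ` pverts M \<subseteq> pverts G"
        proof
          fix v assume "v \<in> g ` pverts M"
          then obtain x where x: "x \<in> pverts M" "v = g x" by auto
          then show "v \<in> pverts G" using B(2)[OF x(1)] g[OF x(1)] by simp
        qed
      qed
      have EM: "(g x, g y) \<in> parcs G" if "(x, y) \<in> parcs M" for x y
        using B(5)[OF _ _ that] M.edge_in[OF that] g by (auto simp: adj_def)
      show ?thesis
      proof (cases "\<exists>x\<in>pverts M. \<exists>y\<in>pverts M. (g x, g y) \<in> parcs G \<and> (x, y) \<notin> parcs M")
        case True
        then obtain x y where xy: "x \<in> pverts M" "y \<in> pverts M" "(g x, g y) \<in> parcs G" "(x, y) \<notin> parcs M" by auto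
        let ?H = "delete_edge G (g x) (g y)"
        have "pverts ?H = pverts G" by (simp add: delete_edge_def)
        moreover have "card (parcs ?H) < card (parcs G)"
          by (rule psubset_card_mono[OF G.finE]) (use xy in \<open>auto simp: delete_edge_def\<close>)
        moreover have "model (parcs M) (pverts M) (parcs ?H) (pverts G) \<beta>"
          unfolding model_def
        proof (intro conjI ballI impI)
          fix z assume z: "z \<in> pverts M"
          show "\<beta> z \<noteq> {}" "\<beta> z \<subseteq> pverts G" using B(1,2)[OF z] by auto
          show "linked (parcs ?H) (\<beta> z)" using g[OF z] by simp
        next
          fix p q assume pq: "p \<in> pverts M" "q \<in> pverts M" "(p, q) \<in> parcs M"
          have "(g p, g q) \<notin> {(g x, g y), (g y, g x)}"
            using pq(3) xy(4) M.edge_sym[of p q] inj_on_eq_iff[OF inj pq(1) xy(1)] inj_on_eq_iff[OF inj pq(2) xy(2)]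
              inj_on_eq_iff[OF inj pq(1) xy(2)] inj_on_eq_iff[OF inj pq(2) xy(1)] by auto
          then show "adj (parcs ?H) (\<beta> p) (\<beta> q)"
            using EM[OF pq(3)] g[OF pq(1)] g[OF pq(2)] by (simp add: adj_def delete_edge_def)
        qed (rule B(4))
        ultimately show ?thesis using xy by (intro reduce[of ?H \<beta>] edge_deletion) auto
      next
        case False
        have "parcs G = map_prod g g ` parcs M"
        proof
          show "map_prod g g ` parcs M \<subseteq> parcs G" using EM by auto
          show "parcs G \<subseteq> map_prod g g ` parcs M"
          proof
            fix e assume e: "e \<in> parcs G"
            then obtain x y where xy: "x \<in> pverts M" "y \<in> pverts M" "e = (g x, g y)" using G.EV unfolding V by blast
            then have "(x, y) \<in> parcs M" using False e by blast
            then show "e \<in> map_prod g g ` parcs M" unfolding xy(3) by (intro image_eqI[of _ _ "(x, y)"]) simp_all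
          qed
        qed
        from digraph_isoI[OF assms(1) inj V this] show ?thesis unfolding is_minor_def by blast
      qed
    qed
  qed
qed

section \<open>The two excluded graphs\<close>

lemma F3_simps:
  "pverts F3 = {1, 2, 3, 12, 13, 23}"
  "parcs F3 = {(1, 2), (1, 3), (2, 3), (1, 12), (2, 12), (1, 13), (3, 13), (2, 23), (3, 23),
     (2, 1), (3, 1), (3, 2), (12, 1), (12, 2), (13, 1), (13, 3), (23, 2), (23, 3)}"
  unfolding F3_def symcl_def by auto

lemma H3_simps:
  "pverts H3 = {1, 2, 3, 12, 13, 23}"
  "parcs H3 = {(1, 3), (1, 13), (3, 13), (2, 13), (1, 12), (2, 12), (2, 23), (3, 23),
     (3, 1), (13, 1), (13, 3), (13, 2), (12, 1), (12, 2), (23, 2), (23, 3)}"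
proof -
  have K4: "{(i, j). i \<in> {1, 2, 3, 13} \<and> j \<in> {1, 2, 3, 13} \<and> i \<noteq> j} =
    {(1, 2), (1, 3), (1, 13), (2, 1), (2, 3), (2, 13), (3, 1), (3, 2), (3, 13), (13, 1), (13, 2), (13, 3 :: nat)}"
    (is "?L = ?R")
  proof
    show "?L \<subseteq> ?R"
    proof
      fix e assume "e \<in> ?L"
      then obtain i j where "e = (i, j)" "i \<in> {1, 2, 3, 13}" "j \<in> {1, 2, 3, 13}" "i \<noteq> j" by auto
      then show "e \<in> ?R" by (elim insertE emptyE) simp_all
    qed
  qed simp
  show "pverts H3 = {1, 2, 3, 12, 13, 23}"
    unfolding H3_def complete_on_def subdivide.simps by auto
  have "parcs H3 = (({(1, 2), (1, 3), (1, 13), (2, 1), (2, 3), (2, 13), (3, 1), (3, 2), (3, 13), (13, 1), (13, 2), (13, 3)}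
     - {(1, 2), (2, 1)}) \<union> {(1, 12), (12, 1), (12, 2), (2, 12)}
     - {(2, 3), (3, 2)}) \<union> {(2, 23), (23, 2), (23, 3), (3, 23)}"
    unfolding H3_def complete_on_def subdivide.simps K4 by simp
  also have "\<dots> = {(1, 3), (1, 13), (3, 13), (2, 13), (1, 12), (2, 12), (2, 23), (3, 23),
     (3, 1), (13, 1), (13, 3), (13, 2), (12, 1), (12, 2), (23, 2), (23, 3)}" (is "?A = ?B")
  proof
    show "?A \<subseteq> ?B" by (simp add: insert_Diff_if)
    show "?B \<subseteq> ?A" by simp
  qed
  finally show "parcs H3 = {(1, 3), (1, 13), (3, 13), (2, 13), (1, 12), (2, 12), (2, 23), (3, 23),
     (3, 1), (13, 1), (13, 3), (13, 2), (12, 1), (12, 2), (23, 2), (23, 3)}" .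
qed

lemma simple_F3: "simple_graph F3"
  by unfold_locales (unfold F3_simps sym_def irrefl_def, auto)

lemma simple_H3: "simple_graph H3"
  by unfold_locales (unfold H3_simps sym_def irrefl_def, auto)

text \<open>
  Six objects indexed by the numerals that name the nodes of \<open>F\<^sub>3\<close> and
  \<open>H\<^sub>3\<close>; the default value belongs to the node 23.
\<close>

definition pick6 :: "'a \<Rightarrow> 'a \<Rightarrow> 'a \<Rightarrow> 'a \<Rightarrow> 'a \<Rightarrow> 'a \<Rightarrow> nat \<Rightarrow> 'a" where
  "pick6 a b c d e f i = (if i = 1 then a else if i = 2 then b else if i = 3 then c else
     if i = 12 then d else if i = 13 then e else f)"

lemma model_six:
  assumes bs: "branch_sets E V [S1, S2, S3, S12, S13, S23]" and V: "VM = {1, 2, 3, 12, 13, 23}"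
    and ad: "\<And>i j. (i, j) \<in> EM \<Longrightarrow> adj E (pick6 S1 S2 S3 S12 S13 S23 i) (pick6 S1 S2 S3 S12 S13 S23 j)"
  shows "model EM VM E V (pick6 S1 S2 S3 S12 S13 S23)"
  unfolding model_def
proof (intro conjI ballI impI)
  fix x :: nat assume "x \<in> VM"
  then consider "x = 1" | "x = 2" | "x = 3" | "x = 12" | "x = 13" | "x = 23" by (auto simp: V)
  note c = this
  show "pick6 S1 S2 S3 S12 S13 S23 x \<noteq> {}" using c bs by cases (simp_all add: pick6_def)
  show "pick6 S1 S2 S3 S12 S13 S23 x \<subseteq> V" using c bs by cases (simp_all add: pick6_def)
  show "linked E (pick6 S1 S2 S3 S12 S13 S23 x)" using c bs by cases (simp_all add: pick6_def)
next
  fix x y :: nat assume "x \<in> VM" "y \<in> VM" "x \<noteq> y"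
  then show "pick6 S1 S2 S3 S12 S13 S23 x \<inter> pick6 S1 S2 S3 S12 S13 S23 y = {}"
    using bs unfolding V by (elim insertE emptyE) (simp_all add: pick6_def Int_commute)
qed (rule ad)

lemma F3_minor_of_branch_sets:
  assumes "simple_graph G" "has_F3 (parcs G) (pverts G)" shows "is_minor F3 G"
proof -
  interpret fin_graph "pverts G" "parcs G" by fact
  obtain S1 S2 S3 S12 S13 S23 where S: "branch_sets (parcs G) (pverts G) [S1, S2, S3, S12, S13, S23]"
     "adj (parcs G) S1 S2" "adj (parcs G) S1 S3" "adj (parcs G) S2 S3" "adj (parcs G) S1 S12" "adj (parcs G) S2 S12"
     "adj (parcs G) S1 S13" "adj (parcs G) S3 S13" "adj (parcs G) S2 S23" "adj (parcs G) S3 S23"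
    using assms(2) unfolding has_F3_def by (elim exE conjE) (rule that)
  have "model (parcs F3) (pverts F3) (parcs G) (pverts G) (pick6 S1 S2 S3 S12 S13 S23)"
  proof (rule model_six[OF S(1) F3_simps(1)])
    fix i j assume "(i, j) \<in> parcs F3"
    then show "adj (parcs G) (pick6 S1 S2 S3 S12 S13 S23 i) (pick6 S1 S2 S3 S12 S13 S23 j)"
      unfolding F3_simps using S(2-) S(2-)[THEN adj_sym]
      by (elim insertE emptyE) (simp_all add: pick6_def)
  qed
  then show ?thesis by (rule minor_of_model[OF simple_F3 assms(1)])
qed

lemma H3_minor_of_branch_sets:
  assumes "simple_graph G" "has_H3 (parcs G) (pverts G)" shows "is_minor H3 G"
proof -
  interpret fin_graph "pverts G" "parcs G" by fact
  obtain S1 S2 S3 S12 S13 S23 where S: "branch_sets (parcs G) (pverts G) [S1, S2, S3, S12, S13, S23]"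
     "adj (parcs G) S1 S3" "adj (parcs G) S1 S13" "adj (parcs G) S3 S13" "adj (parcs G) S2 S13"
     "adj (parcs G) S1 S12" "adj (parcs G) S2 S12" "adj (parcs G) S2 S23" "adj (parcs G) S3 S23"
    using assms(2) unfolding has_H3_def by (elim exE conjE) (rule that)
  have "model (parcs H3) (pverts H3) (parcs G) (pverts G) (pick6 S1 S2 S3 S12 S13 S23)"
  proof (rule model_six[OF S(1) H3_simps(1)])
    fix i j assume "(i, j) \<in> parcs H3"
    then show "adj (parcs G) (pick6 S1 S2 S3 S12 S13 S23 i) (pick6 S1 S2 S3 S12 S13 S23 j)"
      unfolding H3_simps using S(2-) S(2-)[THEN adj_sym]
      by (elim insertE emptyE) (simp_all add: pick6_def)
  qed
  then show ?thesis by (rule minor_of_model[OF simple_H3 assms(1)])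
qed

section \<open>Trees\<close>

lemma pcas_iff: "pcas u p v \<longleftrightarrow> map fst p @ [v] = u # map snd p"
  by (induction p arbitrary: u) auto

lemma pawalk_verts_pcas: "pcas u p v \<Longrightarrow> pawalk_verts u p = u # map snd p"
  by (induction p arbitrary: u) auto

text \<open>
  For arcs that are pairs, a closed walk is a list in which the heads of the arcs are the tails of
  the next ones; the equation between lists states this for all arcs at once.
\<close>

lemma cycle_iff:
  assumes "simple_graph G"
  shows "pre_digraph.cycle (with_proj G) p \<longleftrightarrow>
     (\<exists>u. map fst p @ [u] = u # map snd p) \<and> set p \<subseteq> parcs G \<and> distinct (map snd p) \<and> p \<noteq> []"
    (is "_ \<longleftrightarrow> ?R")
proof -
  interpret fin_graph "pverts G" "parcs G" by fact
  show ?thesis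
  proof
    assume "pre_digraph.cycle (with_proj G) p"
    then obtain u where "set p \<subseteq> parcs G" "pcas u p u" "distinct (tl (pawalk_verts u p))" "p \<noteq> []"
      unfolding pre_digraph.cycle_def pre_digraph.awalk_def
      by (auto simp: cas_with_proj_eq awalk_verts_with_proj_eq)
    then show ?R using pawalk_verts_pcas[of u p u] pcas_iff[of u p u] by auto
  next
    assume R: ?R
    then obtain u where u: "map fst p @ [u] = u # map snd p" by auto
    then have c: "pcas u p u" by (simp add: pcas_iff)
    obtain e es where "p = e # es" using R by (cases p) auto
    then have "fst e = u" "e \<in> parcs G" using u R by auto
    then have "u \<in> pverts G" using edge_in by (metis prod.collapse)
    then show "pre_digraph.cycle (with_proj G) p"
      unfolding pre_digraph.cycle_def pre_digraph.awalk_def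
      using R c pawalk_verts_pcas[OF c] by (auto simp: cas_with_proj_eq awalk_verts_with_proj_eq)
  qed
qed

text \<open>
  Rank the nodes by the time at which they were added: every node has at most one neighbour of lower
  rank.
\<close>

lemma grown_tree_rank:
  assumes "grown_tree S F"
  shows "\<exists>r :: 't \<Rightarrow> nat. inj_on r S \<and> (\<forall>x y z. (x, z) \<in> F \<longrightarrow> (y, z) \<in> F \<longrightarrow> r x < r z \<longrightarrow> r y < r z \<longrightarrow> x = y)"
  using assms
proof (induction rule: grown_tree.induct)
  case (grown_tree_single r)
  then show ?case by auto
next
  case (grown_tree_leaf S F v u)
  obtain r :: "'t \<Rightarrow> nat" where r: "inj_on r S"
    "\<And>x y z. (x, z) \<in> F \<Longrightarrow> (y, z) \<in> F \<Longrightarrow> r x < r z \<Longrightarrow> r y < r z \<Longrightarrow> x = y"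
    using grown_tree_leaf.IH by blast
  note b = grown_tree_basic[OF grown_tree_leaf(1)]
  define m where "m = Suc (Max (r ` S))"
  have m: "r x < m" if "x \<in> S" for x using that b by (simp add: m_def less_Suc_eq_le)
  define r' where "r' = r(u := m)"
  have r': "r' u = m" "\<And>x. x \<in> S \<Longrightarrow> r' x = r x" using grown_tree_leaf(3) by (auto simp: r'_def)
  have "inj_on r' (insert u S)"
  proof (rule inj_onI)
    fix x y assume "x \<in> insert u S" "y \<in> insert u S" "r' x = r' y"
    then show "x = y" using r' m[of x] m[of y] inj_onD[OF r(1), of x y] by auto
  qed
  moreover have "x = y" if e: "(x, z) \<in> insert (u, v) (insert (v, u) F)" "(y, z) \<in> insert (u, v) (insert (v, u) F)"
      "r' x < r' z" "r' y < r' z" for x y z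
  proof (cases "z = u")
    case True
    then show ?thesis using e(1,2) grown_tree_leaf(2,3) b by auto
  next
    case False
    have zS: "z \<in> S" using e(1) False grown_tree_leaf(2) b by auto
    have "x \<noteq> u" "y \<noteq> u" using e(3,4) r' m[OF zS] zS by auto
    then have "(x, z) \<in> F" "(y, z) \<in> F" using e(1,2) False by auto
    moreover have "r x < r z" "r y < r z" using calculation e(3,4) r'(2) b zS by auto
    ultimately show ?thesis by (rule r(2))
  qed
  ultimately show ?case by blast
qed

text \<open>
  The node of highest rank on a cycle of length at least three would have two different neighbours
  of lower rank, its predecessor and its successor.
\<close>

lemma grown_tree_acyclic:
  assumes tg: "grown_tree S F" and p: "map fst p @ [u] = u # map snd p" "set p \<subseteq> F" "distinct (map snd p)" "3 \<le> length p"
  shows False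
proof -
  obtain r :: "'a \<Rightarrow> nat" where r: "inj_on r S"
    "\<And>x y z. (x, z) \<in> F \<Longrightarrow> (y, z) \<in> F \<Longrightarrow> r x < r z \<Longrightarrow> r y < r z \<Longrightarrow> x = y"
    using grown_tree_rank[OF tg] by blast
  note b = grown_tree_basic[OF tg]
  define L where "L = length p"
  have L: "L \<ge> 3" using p(4) by (simp add: L_def)
  define q where "q i = p ! (i mod L)" for i
  have qp: "q i \<in> set p" for i
  proof -
    have "i mod L < length p" using L unfolding L_def by (intro mod_less_divisor) linarith
    then show ?thesis unfolding q_def by (rule nth_mem)
  qed
  have qF: "q i \<in> F" for i using qp[of i] p(2) by (rule subsetD[rotated])
  have step: "fst (q (Suc i)) = snd (q i)" for i
  proof -
    define j where "j = i mod L"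
    have j: "j < L" using L by (simp add: j_def)
    have "snd (p ! j) = (u # map snd p) ! Suc j" using j by (simp add: L_def)
    also have "\<dots> = (map fst p @ [u]) ! Suc j" using p(1) by simp
    also have "\<dots> = fst (p ! (Suc j mod L))"
    proof (cases "Suc j = L")
      case True
      have "u = fst (p ! 0)" using p(1) L by (cases p) (auto simp: L_def)
      then show ?thesis using True by (simp add: nth_append L_def)
    next
      case False
      then show ?thesis using j by (simp add: nth_append L_def)
    qed
    finally have "snd (p ! j) = fst (p ! (Suc j mod L))" .
    moreover have "Suc j mod L = Suc i mod L" by (simp add: j_def mod_Suc_eq)
    ultimately show ?thesis by (simp add: q_def j_def)
  qed
  have "finite (r ` snd ` set p)" "r ` snd ` set p \<noteq> {}" using p(4) by auto
  then have "Max (r ` snd ` set p) \<in> r ` snd ` set p" by (rule Max_in)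
  then obtain e where e: "e \<in> set p" "r (snd e) = Max (r ` snd ` set p)" by auto
  obtain k where k: "k < L" "e = p ! k" using e(1) by (auto simp: in_set_conv_nth L_def)
  have qk: "q k = e" using k by (simp add: q_def)
  have mx: "r (snd (q i)) \<le> r (snd e)" for i unfolding e(2) using qp[of i] by (intro Max_ge) auto
  \<comment> \<open>\<open>i\<close> is the position before \<open>k\<close>, without subtracting from a \<open>k\<close> that may be 0\<close>
  define i where "i = k + (L - 1)"
  have "q (Suc i) = q k" using L by (simp add: i_def q_def)
  then have 1: "fst e = snd (q i)" using step[of i] qk by simp
  have 2: "fst (q (Suc k)) = snd e" using step[of k] qk by simp
  have E1: "(snd (q i), snd e) \<in> F" using qF[of k] 1 qk by (metis prod.collapse)
  have E2: "(snd (q (Suc k)), snd e) \<in> F"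
    using qF[of "Suc k"] 2 b by (metis prod.collapse symD)
  have lt: "r (snd (q j)) < r (snd e)" if "(snd (q j), snd e) \<in> F" for j
  proof -
    have "snd (q j) \<noteq> snd e" "snd (q j) \<in> S" "snd e \<in> S" using that b by (auto simp: irrefl_def)
    then have "r (snd (q j)) \<noteq> r (snd e)" using r(1) by (auto simp: inj_on_def)
    then show ?thesis using mx[of j] by simp
  qed
  have "snd (q i) = snd (q (Suc k))" by (rule r(2)[OF E1 E2 lt[OF E1] lt[OF E2]])
  moreover have ml: "j mod L < length (map snd p)" for j
    using L unfolding L_def length_map by (intro mod_less_divisor) linarith
  moreover have "snd (q j) = map snd p ! (j mod L)" for j using ml[of j] by (simp add: q_def)
  ultimately have "map snd p ! (i mod L) = map snd p ! (Suc k mod L)" by simp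
  then have "i mod L = Suc k mod L"
    using nth_eq_iff_index_eq[OF p(3) ml ml] by simp
  moreover have "i = Suc k + (L - 2)" using L by (simp add: i_def)
  ultimately have "L dvd L - 2" by (metis add_diff_cancel_left' le_add1 mod_eq_dvd_iff_nat)
  then show False using L by (auto dest: dvd_imp_le)
qed

lemma undirected_tree_simple: "undirected_tree T \<Longrightarrow> simple_graph T"
  by (simp add: undirected_tree_def simple_graph_iff)

lemma undirected_tree_of_grown_tree:
  assumes "grown_tree S F"
  shows "undirected_tree \<lparr>pverts = S, parcs = F\<rparr>" (is "undirected_tree ?T")
proof -
  note b = grown_tree_basic[OF assms]
  have s: "simple_graph ?T" by unfold_locales (use b in auto)
  have "connected (with_proj ?T)" using connected_iff[OF s] b grown_tree_linked[OF assms] by simp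
  moreover have "\<not> (\<exists>p. pre_digraph.cycle (with_proj ?T) p \<and> 3 \<le> length p)"
    using grown_tree_acyclic[OF assms] by (auto simp: cycle_iff[OF s])
  moreover have "pair_graph ?T" using s by (rule simple_graph_iff[THEN iffD1])
  ultimately show ?thesis unfolding undirected_tree_def by blast
qed

lemma restrict_path:
  assumes "(x, y) \<in> (F \<inter> S \<times> S)\<^sup>*" "x \<in> S"
  shows "\<exists>p. map fst p @ [y] = x # map snd p \<and> set p \<subseteq> F \<inter> S \<times> S \<and> distinct (x # map snd p)"
proof -
  let ?G = "\<lparr>pverts = S, parcs = F \<inter> S \<times> S\<rparr>"
  interpret pair_wf_digraph ?G by unfold_locales auto
  have "y \<in> S" by (rule restrict_rtrancl_in[OF assms])
  have "reachable (with_proj ?G) x y"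
    using assms \<open>y \<in> S\<close> by (simp add: reachable_iff)
  then obtain p where "apath x p y" using reachable_apath by blast
  then have "pcas x p y" "set p \<subseteq> F \<inter> S \<times> S" "distinct (pawalk_verts x p)"
    by (auto simp: apath_def awalk_def)
  then show ?thesis using pawalk_verts_pcas[of x p y] by (auto simp: pcas_iff intro!: exI[of _ p])
qed

text \<open>
  Take a largest node set that induces a tree built leaf by leaf. If it missed a node, then it would
  have an edge to some \<open>v\<close> outside. Two such edges would close a cycle with a path
  inside the set, so \<open>v\<close> is a leaf that could be added.
\<close>

lemma grown_tree_of_undirected_tree:
  assumes "undirected_tree T"
  shows "grown_tree (pverts T) (parcs T)"
proof -
  let ?V = "pverts T" and ?E = "parcs T"
  have s: "simple_graph T" using assms by (simp add: undirected_tree_def simple_graph_iff)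
  interpret fin_graph ?V ?E by fact
  have V: "?V \<noteq> {}" "linked ?E ?V" using assms connected_iff[OF s] by (auto simp: undirected_tree_def)
  have ac: "\<not> (map fst p @ [u] = u # map snd p \<and> set p \<subseteq> ?E \<and> distinct (map snd p) \<and> 3 \<le> length p)" for p u
    using assms cycle_iff[OF s, of p] by (auto simp: undirected_tree_def)
  let ?P = "\<lambda>S. S \<subseteq> ?V \<and> grown_tree S (?E \<inter> S \<times> S)"
  obtain r where r: "r \<in> ?V" using V by auto
  have "?E \<inter> {r} \<times> {r} = {}" by auto
  then have "?P {r}" using r grown_tree_single[of r] by simp
  then have "\<exists>S. ?P S \<and> (\<forall>S'. ?P S' \<longrightarrow> card S' \<le> card S)"
    using finV by (intro ex_has_greatest_nat[of ?P "{r}" card "Suc (card ?V)"]) (auto simp: less_Suc_eq_le intro: card_mono)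
  then obtain S where S: "S \<subseteq> ?V" "grown_tree S (?E \<inter> S \<times> S)" "\<And>S'. ?P S' \<Longrightarrow> card S' \<le> card S" by blast
  note b = grown_tree_basic[OF S(2)]
  have "S = ?V"
  proof (rule ccontr)
    assume "S \<noteq> ?V"
    then obtain y where y: "y \<in> ?V" "y \<notin> S" using S(1) by auto
    obtain x where x: "x \<in> S" using b by auto
    obtain w v where wv: "(w, v) \<in> ?E" "w \<in> S" "v \<in> ?V - S"
      using linked_edge_out[OF V(2), of x S y] x y S(1) by auto
    have uniq: "w' = w" if w': "(w', v) \<in> ?E" "w' \<in> S" for w'
    proof (rule ccontr)
      assume "w' \<noteq> w"
      have "(w, w') \<in> ((?E \<inter> S \<times> S) \<inter> S \<times> S)\<^sup>*"
        by (rule linkedD[OF grown_tree_linked[OF S(2)] wv(2) w'(2)])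
      from restrict_path[OF this wv(2)] obtain p where p: "map fst p @ [w'] = w # map snd p"
        "set p \<subseteq> ?E \<inter> S \<times> S" "distinct (w # map snd p)" by auto
      have "p \<noteq> []" using p(1) \<open>w' \<noteq> w\<close> by auto
      let ?q = "(v, w) # p @ [(w', v)]"
      have "map fst ?q @ [v] = v # map snd ?q" using p(1) by simp
      moreover have "set ?q \<subseteq> ?E" using p(2) wv(1) w'(1) edge_sym by auto
      moreover have "distinct (map snd ?q)" using p(2,3) wv by auto
      moreover have "3 \<le> length ?q" using \<open>p \<noteq> []\<close> by (cases p) auto
      ultimately show False using ac[of ?q v] by blast
    qed
    have "?E \<inter> insert v S \<times> insert v S = insert (v, w) (insert (w, v) (?E \<inter> S \<times> S))"
    proof -
      have vw: "(v, w) \<in> ?E" by (rule edge_sym[OF wv(1)])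
      have mem: "(x, y) \<in> ?E \<inter> insert v S \<times> insert v S \<longleftrightarrow>
          (x, y) \<in> insert (v, w) (insert (w, v) (?E \<inter> S \<times> S))" for x y
      proof (cases "x = v")
        case True
        then show ?thesis using uniq[of y] edge_sym[of v y] vw wv(2,3) no_loop[of v] by auto
      next
        case False
        then show ?thesis using uniq[of x] wv by auto
      qed
      show ?thesis
      proof (rule Set.set_eqI)
        fix e
        show "e \<in> ?E \<inter> insert v S \<times> insert v S \<longleftrightarrow> e \<in> insert (v, w) (insert (w, v) (?E \<inter> S \<times> S))"
          using mem[of "fst e" "snd e"] unfolding prod.collapse .
      qed
    qed
    moreover have "grown_tree (insert v S) (insert (v, w) (insert (w, v) (?E \<inter> S \<times> S)))"
      by (rule grown_tree_leaf[OF S(2) wv(2)]) (use wv in auto)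
    ultimately have "?P (insert v S)" using S(1) wv by auto
    then have "card (insert v S) \<le> card S" by (rule S(3))
    then show False using wv b by simp
  qed
  moreover have "?E \<inter> ?V \<times> ?V = ?E" using EV by auto
  ultimately show ?thesis using S(2) by simp
qed

section \<open>The combinatorial half\<close>

definition tree_minor :: "'a ugraph \<Rightarrow> nat \<Rightarrow> bool" where
  "tree_minor G k \<longleftrightarrow> (\<exists>T :: nat ugraph. undirected_tree T \<and> is_minor G (strong_product T (complete_graph k)))"

lemma strong_product_simps:
  "pverts (strong_product T (complete_graph k)) = pverts T \<times> {..<k}"
  "parcs (strong_product T (complete_graph k)) =
     {((s, i), (t, j)) |s i t j. s \<in> pverts T \<and> t \<in> pverts T \<and> i < k \<and> j < k \<and> (s, i) \<noteq> (t, j) \<and>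
        (s = t \<or> (s, t) \<in> parcs T)}"
  by (auto simp: strong_product_def complete_graph_def complete_on_def)

lemma simple_strong_product:
  assumes "simple_graph T" shows "simple_graph (strong_product T (complete_graph k))"
proof -
  interpret fin_graph "pverts T" "parcs T" by fact
  show ?thesis
    by unfold_locales (use finV edge_sym in \<open>auto simp: strong_product_simps sym_def irrefl_def\<close>)
qed

text \<open>
  The tree of bags found for the arc set becomes the tree factor of the product.
\<close>

theorem tree_minor_of_excluded:
  fixes G :: "'a ugraph"
  assumes sg: "simple_graph G" and "two_connected G" "card (pverts G) \<ge> 6"
    "\<not> complete_bipartite_digraph 3 3 (with_proj G)" "\<not> is_minor F3 G" "\<not> is_minor H3 G"
  shows "tree_minor G 2"
proof -
  interpret fin_graph "pverts G" "parcs G" by fact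
  interpret excluded_minors "pverts G" "parcs G"
    by unfold_locales
      (use two_connected_linked[OF sg assms(2)] F3_minor_of_branch_sets[OF sg] H3_minor_of_branch_sets[OF sg] assms(5,6) in auto)
  have "\<not> (\<exists>I J. pverts G = I \<union> J \<and> I \<inter> J = {} \<and> card I = 3 \<and> card J = 3 \<and> parcs G = I \<times> J \<union> J \<times> I)"
    using assms(4) finV by (auto simp: complete_bipartite_digraph_pair_def)
  then have decomposable using decomposable_or_K33 assms(3) by blast
  then obtain S :: "nat set" and F bag where td: "tree_dec (parcs G) S F bag (pverts G)"
    using tree_dec_of_decomposable by blast
  let ?T = "\<lparr>pverts = S, parcs = F\<rparr>"
  have tg: "grown_tree S F" by (rule tree_decD(1)[OF td])
  have ut: "undirected_tree ?T" by (rule undirected_tree_of_grown_tree[OF tg])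
  then have sT: "simple_graph ?T" by (rule undirected_tree_simple)
  have "\<exists>\<beta>. model (parcs G) (pverts G) (parcs (strong_product ?T (complete_graph 2))) (S \<times> {..<2}) \<beta>"
    by (rule model_of_tree_dec[OF td _ irreflE]) (auto simp: strong_product_simps)
  then obtain \<beta> where m: "model (parcs G) (pverts G) (parcs (strong_product ?T (complete_graph 2))) (S \<times> {..<2}) \<beta>" by blast
  have "is_minor G (strong_product ?T (complete_graph 2))"
    by (rule minor_of_model[OF sg simple_strong_product[OF sT], where \<beta> = \<beta>]) (use m in \<open>simp add: strong_product_simps(1)\<close>)
  then show ?thesis unfolding tree_minor_def using ut by blast
qed

lemma tree_minor_mono:
  assumes "simple_graph G" "tree_minor G k" "k \<le> l" shows "tree_minor G l"
proof -
  obtain T :: "nat ugraph" where T: "undirected_tree T" "is_minor G (strong_product T (complete_graph k))"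
    using assms(2) by (auto simp: tree_minor_def)
  have sT: "simple_graph T" using T(1) by (rule undirected_tree_simple)
  let ?P = "strong_product T (complete_graph k)" and ?Q = "strong_product T (complete_graph l)"
  obtain \<beta> where m: "model (parcs G) (pverts G) (parcs ?P) (pverts ?P) \<beta>"
    by (rule model_of_minor[OF T(2) simple_strong_product[OF sT]])
  have sub: "parcs ?P \<subseteq> parcs ?Q" "pverts ?P \<subseteq> pverts ?Q" using assms(3) by (auto simp: strong_product_simps)
  note M = modelD[OF m]
  have "model (parcs G) (pverts G) (parcs ?Q) (pverts ?Q) \<beta>"
    unfolding model_def
  proof (intro conjI ballI impI)
    fix x assume x: "x \<in> pverts G"
    show "\<beta> x \<noteq> {}" "\<beta> x \<subseteq> pverts ?Q" using M(1,2)[OF x] sub by auto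
    show "linked (parcs ?Q) (\<beta> x)" by (rule linked_mono[OF M(3)[OF x] sub(1)])
  next
    fix x y assume "x \<in> pverts G" "y \<in> pverts G" "(x, y) \<in> parcs G"
    from M(5)[OF this] show "adj (parcs ?Q) (\<beta> x) (\<beta> y)" using sub by (auto simp: adj_def)
  qed (rule M(4))
  then have "is_minor G ?Q" by (rule minor_of_model[OF assms(1) simple_strong_product[OF sT]])
  then show ?thesis using T(1) by (auto simp: tree_minor_def)
qed

text \<open>
  For the least \<open>k\<close> to be meaningful, some \<open>k\<close> has to work: over a
  one-node tree the product is the complete graph.
\<close>

lemma tree_minor_card:
  fixes G :: "nat ugraph"
  assumes sg: "simple_graph G" and V: "pverts G = {..<n}"
  shows "tree_minor G n"
proof -
  have ut: "undirected_tree \<lparr>pverts = {0::nat}, parcs = {}\<rparr>" (is "undirected_tree ?T")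
    by (rule undirected_tree_of_grown_tree[OF grown_tree_single])
  then have sT: "simple_graph ?T" by (rule undirected_tree_simple)
  interpret fin_graph "pverts G" "parcs G" by fact
  have "model (parcs G) (pverts G) (parcs (strong_product ?T (complete_graph n))) ({0} \<times> {..<n}) (\<lambda>i. {(0, i)})"
    unfolding model_def
  proof (intro conjI ballI impI)
    fix x y assume xy: "x \<in> pverts G" "y \<in> pverts G" "(x, y) \<in> parcs G"
    then have "x \<noteq> y" by auto
    then show "adj (parcs (strong_product ?T (complete_graph n))) {(0, x)} {(0, y)}"
      using xy V by (auto simp: adj_def strong_product_simps)
  qed (use V in auto)
  then have "is_minor G (strong_product ?T (complete_graph n))"
    by (intro minor_of_model[OF sg simple_strong_product[OF sT]]) (simp add: strong_product_simps(1))
  then show ?thesis using ut by (auto simp: tree_minor_def)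
qed

theorem la_strong_le_2_iff:
  fixes G :: "nat ugraph"
  assumes sg: "simple_graph G" and V: "pverts G = {..<n}" and n: "n \<ge> 1"
  shows "la_strong G \<le> 2 \<longleftrightarrow> tree_minor G 2"
proof -
  have la: "la_strong G = (LEAST k. 1 \<le> k \<and> tree_minor G k)" by (simp add: la_strong_def tree_minor_def)
  have "1 \<le> n \<and> tree_minor G n" using tree_minor_card[OF sg V] n by simp
  then have "1 \<le> la_strong G \<and> tree_minor G (la_strong G)"
    unfolding la by (rule LeastI)
  then show ?thesis
    using tree_minor_mono[OF sg] Least_le[of "\<lambda>k. 1 \<le> k \<and> tree_minor G k" 2] la by auto
qed

section \<open>Gram representations\<close>

text \<open>
  Positive semidefiniteness of a kernel on a finite index set, free of matrix dimensions, so that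
  blocks of a matrix and pullbacks along maps of the indices are again of this form.
\<close>

definition psd_on :: "'i set \<Rightarrow> ('i \<Rightarrow> 'i \<Rightarrow> real) \<Rightarrow> bool" where
  "psd_on S k \<longleftrightarrow> (\<forall>i\<in>S. \<forall>j\<in>S. k i j = k j i) \<and> (\<forall>a. 0 \<le> (\<Sum>i\<in>S. \<Sum>j\<in>S. a i * a j * k i j))"

lemma quadratic_insert:
  fixes k :: "'i \<Rightarrow> 'i \<Rightarrow> real"
  assumes "finite S" "i \<notin> S" "\<And>j. j \<in> S \<Longrightarrow> k j i = k i j"
  shows "(\<Sum>p\<in>insert i S. \<Sum>q\<in>insert i S. a p * a q * k p q) =
    (a i)\<^sup>2 * k i i + 2 * a i * (\<Sum>j\<in>S. a j * k i j) + (\<Sum>p\<in>S. \<Sum>q\<in>S. a p * a q * k p q)"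
proof -
  have "(\<Sum>p\<in>insert i S. \<Sum>q\<in>insert i S. a p * a q * k p q) =
     (a i * a i * k i i + (\<Sum>q\<in>S. a i * a q * k i q)) + (\<Sum>p\<in>S. a p * a i * k p i + (\<Sum>q\<in>S. a p * a q * k p q))"
    using assms(1,2) by simp
  also have "(\<Sum>p\<in>S. a p * a i * k p i + (\<Sum>q\<in>S. a p * a q * k p q)) =
     (\<Sum>p\<in>S. a p * a i * k p i) + (\<Sum>p\<in>S. \<Sum>q\<in>S. a p * a q * k p q)" by (simp add: sum.distrib)
  also have "(\<Sum>p\<in>S. a p * a i * k p i) = a i * (\<Sum>j\<in>S. a j * k i j)"
    using assms(3) by (simp add: sum_distrib_left mult_ac)
  also have "(\<Sum>q\<in>S. a i * a q * k i q) = a i * (\<Sum>j\<in>S. a j * k i j)"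
    by (simp add: sum_distrib_left mult_ac)
  finally show ?thesis by (simp add: power2_eq_square algebra_simps)
qed

text \<open>
  One step of Cholesky factorisation per index: the Schur complement of a positive diagonal entry is
  again positive semidefinite, and a zero diagonal entry forces its whole row to vanish.
\<close>

lemma gram_coordinates:
  assumes "finite S" "psd_on S k"
  shows "\<exists>f :: 'i \<Rightarrow> nat \<Rightarrow> real. \<forall>i\<in>S. \<forall>j\<in>S. k i j = (\<Sum>l<card S. f i l * f j l)"
  using assms
proof (induction S arbitrary: k rule: finite_induct)
  case empty
  then show ?case by simp
next
  case (insert i S)
  have sym: "k p q = k q p" if "p \<in> insert i S" "q \<in> insert i S" for p q
    using insert.prems that by (auto simp: psd_on_def)
  have sym': "j \<in> S \<Longrightarrow> k j i = k i j" for j using sym by auto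
  have nn: "0 \<le> (a i)\<^sup>2 * k i i + 2 * a i * (\<Sum>j\<in>S. a j * k i j) + (\<Sum>p\<in>S. \<Sum>q\<in>S. a p * a q * k p q)" for a
  proof -
    have "0 \<le> (\<Sum>p\<in>insert i S. \<Sum>q\<in>insert i S. a p * a q * k p q)"
      using insert.prems unfolding psd_on_def by blast
    also have "\<dots> = (a i)\<^sup>2 * k i i + 2 * a i * (\<Sum>j\<in>S. a j * k i j) + (\<Sum>p\<in>S. \<Sum>q\<in>S. a p * a q * k p q)"
      by (intro quadratic_insert insert.hyps sym')
    finally show ?thesis .
  qed
  have "psd_on S k" unfolding psd_on_def
  proof (intro conjI allI ballI)
    fix a show "0 \<le> (\<Sum>p\<in>S. \<Sum>q\<in>S. a p * a q * k p q)"
    proof -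
      have "p \<in> S \<Longrightarrow> p \<noteq> i" for p using insert.hyps by auto
      then have "(\<Sum>p\<in>S. \<Sum>q\<in>S. (a(i := 0)) p * (a(i := 0)) q * k p q) = (\<Sum>p\<in>S. \<Sum>q\<in>S. a p * a q * k p q)"
        by (intro sum.cong refl) auto
      then show ?thesis using nn[of "a(i := 0)"] by simp
    qed
  qed (use sym in auto)
  have cS: "card (insert i S) = Suc (card S)" using insert.hyps by simp
  have kii: "k i i \<ge> 0"
  proof -
    define a where "a = (\<lambda>p. if p = i then 1 else (0 :: real))"
    have a: "a i = 1" "p \<in> S \<Longrightarrow> a p = 0" for p using insert.hyps by (auto simp: a_def)
    have "(\<Sum>j\<in>S. a j * k i j) = 0" "(\<Sum>p\<in>S. \<Sum>q\<in>S. a p * a q * k p q) = 0"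
      by (intro sum.neutral ballI; simp add: a)+
    then show ?thesis using nn[of a] a by simp
  qed
  show ?case
  proof (cases "k i i = 0")
    case True
    have k0: "k i j = 0" if j: "j \<in> S" for j
    proof -
      have ij: "j \<noteq> i" using j insert.hyps by auto
      \<comment> \<open>the form at \<open>t e\<^sub>i + e\<^sub>j\<close> is linear in \<open>t\<close>, so it is nonnegative only if the slope vanishes\<close>
      have *: "0 \<le> 2 * t * k i j + k j j" for t
      proof -
        define a where "a = (\<lambda>p. if p = i then t else if p = j then 1 else (0::real))"
        have ap: "p \<in> S \<Longrightarrow> a p = (if p = j then 1 else 0)" for p using insert.hyps by (auto simp: a_def)
        have "(\<Sum>q\<in>S. a q * k i q) = (\<Sum>q\<in>S. if q = j then k i q else 0)"
          by (intro sum.cong) (auto simp: ap)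
        moreover have "(\<Sum>p\<in>S. \<Sum>q\<in>S. a p * a q * k p q) = (\<Sum>p\<in>S. if p = j then (\<Sum>q\<in>S. if q = j then k p q else 0) else 0)"
          by (intro sum.cong) (auto simp: ap intro!: sum.cong)
        ultimately show ?thesis using nn[of a] True j insert.hyps(1) by (simp add: a_def)
      qed
      show ?thesis
      proof (rule ccontr)
        assume "k i j \<noteq> 0"
        then have "2 * (- (k j j + 1) / (2 * k i j)) * k i j + k j j = -1" by (simp add: field_simps)
        with *[of "- (k j j + 1) / (2 * k i j)"] show False by simp
      qed
    qed
    obtain f where f: "\<forall>p\<in>S. \<forall>q\<in>S. k p q = (\<Sum>l<card S. f p l * f q l)" using insert.IH[OF \<open>psd_on S k\<close>] by blast
    define g where "g p l = (if p = i \<or> l = card S then 0 else f p l)" for p l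
    have "k p q = (\<Sum>l<Suc (card S). g p l * g q l)" if pq: "p \<in> insert i S" "q \<in> insert i S" for p q
    proof (cases "p = i \<or> q = i")
      case True
      then have "k p q = 0" using k0 \<open>k i i = 0\<close> sym[OF pq] pq by auto
      then show ?thesis using True by (auto simp: g_def)
    next
      case False
      then have "k p q = (\<Sum>l<card S. f p l * f q l)" using f pq by auto
      also have "\<dots> = (\<Sum>l<card S. g p l * g q l)" using False by (intro sum.cong) (auto simp: g_def)
      finally show ?thesis using False by (simp add: g_def)
    qed
    then show ?thesis unfolding cS by (intro exI[of _ g]) blast
  next
    case False
    then have pos: "k i i > 0" using kii by simp
    \<comment> \<open>the Schur complement of the entry at \<open>i\<close>\<close>
    define k' where "k' p q = k p q - k i p * k i q / k i i" for p q
    have "psd_on S k'" unfolding psd_on_def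
    proof (intro conjI allI ballI)
      fix a
      define b where "b = (\<Sum>j\<in>S. a j * k i j)"
      \<comment> \<open>the choice of the coordinate at \<open>i\<close> that minimises the form\<close>
      define a' where "a' = a(i := - b / k i i)"
      have a': "p \<in> S \<Longrightarrow> a' p = a p" for p using insert.hyps by (auto simp: a'_def)
      have "(\<Sum>j\<in>S. a' j * k i j) = b" unfolding b_def by (intro sum.cong) (auto simp: a')
      moreover have "(\<Sum>p\<in>S. \<Sum>q\<in>S. a' p * a' q * k p q) = (\<Sum>p\<in>S. \<Sum>q\<in>S. a p * a q * k p q)"
        by (intro sum.cong) (auto simp: a')
      ultimately have "0 \<le> (b / k i i)\<^sup>2 * k i i - 2 * (b / k i i) * b + (\<Sum>p\<in>S. \<Sum>q\<in>S. a p * a q * k p q)"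
        using nn[of a'] by (simp add: a'_def)
      also have "(b / k i i)\<^sup>2 * k i i - 2 * (b / k i i) * b = - (b * b / k i i)"
        using pos by (simp add: power2_eq_square field_simps)
      also have "- (b * b / k i i) + (\<Sum>p\<in>S. \<Sum>q\<in>S. a p * a q * k p q) = (\<Sum>p\<in>S. \<Sum>q\<in>S. a p * a q * k' p q)"
      proof -
        have "b * b = (\<Sum>p\<in>S. \<Sum>q\<in>S. (a p * k i p) * (a q * k i q))" unfolding b_def by (rule sum_product)
        then have "b * b / k i i = (\<Sum>p\<in>S. \<Sum>q\<in>S. (a p * k i p) * (a q * k i q) / k i i)"
          by (simp add: sum_divide_distrib)
        then show ?thesis by (simp add: k'_def right_diff_distrib sum_subtractf mult_ac)
      qed
      finally show "0 \<le> (\<Sum>p\<in>S. \<Sum>q\<in>S. a p * a q * k' p q)" .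
    next
      fix p q assume "p \<in> S" "q \<in> S"
      then show "k' p q = k' q p" using sym[of p q] by (simp add: k'_def mult.commute)
    qed
    from insert.IH[OF this] obtain f where f: "\<forall>p\<in>S. \<forall>q\<in>S. k' p q = (\<Sum>l<card S. f p l * f q l)" by blast
    define g where "g p l = (if l = card S then k i p / sqrt (k i i) else if p = i then 0 else f p l)" for p l
    have sq: "x / sqrt (k i i) * (y / sqrt (k i i)) = x * y / k i i" for x y
      using pos by (simp add: real_sqrt_mult_self field_simps)
    have "k p q = (\<Sum>l<Suc (card S). g p l * g q l)" if pq: "p \<in> insert i S" "q \<in> insert i S" for p q
    proof (cases "p = i \<or> q = i")
      case True
      have "(\<Sum>l<card S. g p l * g q l) = 0" using True by (intro sum.neutral) (auto simp: g_def)
      moreover have "k i p * k i q / k i i = k p q" using True sym[OF pq] sym[of p i] pq pos by auto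
      ultimately show ?thesis using sq[of "k i p" "k i q"] by (simp add: g_def)
    next
      case False
      then have "k' p q = (\<Sum>l<card S. f p l * f q l)" using f pq by auto
      also have "\<dots> = (\<Sum>l<card S. g p l * g q l)" using False by (intro sum.cong) (auto simp: g_def)
      finally have "k' p q = (\<Sum>l<card S. g p l * g q l)" .
      moreover have "g p (card S) * g q (card S) = k i p * k i q / k i i"
        using sq[of "k i p" "k i q"] by (simp only: g_def refl if_True)
      ultimately show ?thesis by (simp only: sum.lessThan_Suc k'_def diff_eq_eq)
    qed
    then show ?thesis unfolding cS by (intro exI[of _ g]) blast
  qed
qed

lemma psd_on_coordinates:
  fixes f :: "'i \<Rightarrow> nat \<Rightarrow> real"
  shows "psd_on S (\<lambda>i j. \<Sum>l<m. f i l * f j l)"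
  unfolding psd_on_def
proof (intro conjI allI ballI)
  fix a :: "'i \<Rightarrow> real"
  have "(\<Sum>i\<in>S. \<Sum>j\<in>S. a i * a j * (\<Sum>l<m. f i l * f j l)) = (\<Sum>i\<in>S. \<Sum>j\<in>S. \<Sum>l<m. (a i * f i l) * (a j * f j l))"
    by (simp add: sum_distrib_left mult_ac)
  also have "\<dots> = (\<Sum>i\<in>S. \<Sum>l<m. \<Sum>j\<in>S. (a i * f i l) * (a j * f j l))"
    by (intro sum.cong refl sum.swap)
  also have "\<dots> = (\<Sum>l<m. \<Sum>i\<in>S. \<Sum>j\<in>S. (a i * f i l) * (a j * f j l))"
    by (rule sum.swap)
  also have "\<dots> = (\<Sum>l<m. (\<Sum>i\<in>S. a i * f i l)\<^sup>2)"
    by (simp add: power2_eq_square sum_product)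
  also have "\<dots> \<ge> 0" by (intro sum_nonneg) simp
  finally show "0 \<le> (\<Sum>i\<in>S. \<Sum>j\<in>S. a i * a j * (\<Sum>l<m. f i l * f j l))" .
qed (simp add: mult.commute)

lemma psd_on_pullback:
  assumes "finite V" "psd_on V X" "\<And>i. i \<in> T \<Longrightarrow> c i \<in> V"
  shows "psd_on T (\<lambda>i j. X (c i) (c j))"
proof -
  obtain f where f: "\<forall>i\<in>V. \<forall>j\<in>V. X i j = (\<Sum>l<card V. f i l * f j l)"
    using gram_coordinates[OF assms(1,2)] by blast
  have "psd_on T (\<lambda>i j. \<Sum>l<card V. f (c i) l * f (c j) l)" by (rule psd_on_coordinates)
  moreover have "X (c i) (c j) = (\<Sum>l<card V. f (c i) l * f (c j) l)" if "i \<in> T" "j \<in> T" for i j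
    using f assms(3) that by blast
  ultimately show ?thesis unfolding psd_on_def by (simp cong: sum.cong)
qed

lemma gram_four:
  assumes "finite S" "card S = 4" "psd_on S k"
  shows "\<exists>g :: 'i \<Rightarrow> complex \<times> complex. \<forall>i\<in>S. \<forall>j\<in>S. k i j = inner (g i) (g j)"
proof -
  obtain f where f: "\<forall>i\<in>S. \<forall>j\<in>S. k i j = (\<Sum>l<4::nat. f i l * f j l)"
    using gram_coordinates[OF assms(1,3)] assms(2) by auto
  define g where "g i = (Complex (f i 0) (f i 1), Complex (f i 2) (f i 3))" for i
  have "k i j = inner (g i) (g j)" if "i \<in> S" "j \<in> S" for i j
  proof -
    have "k i j = (\<Sum>l<4::nat. f i l * f j l)" using f that by blast
    also have "\<dots> = inner (g i) (g j)"
      by (simp add: g_def inner_complex_def eval_nat_numeral)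
    finally show ?thesis .
  qed
  then show ?thesis by blast
qed

section \<open>Planar contractions\<close>

lemma unit_inner_eq_1:
  fixes x y :: "'v::real_inner"
  assumes "norm x = 1" "norm y = 1" "inner x y = 1" shows "x = y"
proof -
  have "(norm (x - y))\<^sup>2 = 0"
    using assms by (simp add: power2_norm_eq_inner inner_diff_left inner_diff_right inner_commute norm_eq_1)
  then show ?thesis by simp
qed

lemma unit_inner_le_1:
  fixes x y :: "'v::real_inner"
  assumes "norm x = 1" "norm y = 1" shows "inner x y \<le> 1"
  using norm_cauchy_schwarz[of x y] assms by simp

text \<open>
  A rotation of the plane takes \<open>z0\<close> to 1 and \<open>z1\<close> to \<open>x + i
  s\<close>, where \<open>x\<close> is the common inner product. Send 1 to \<open>u0\<close> and
  \<open>i\<close> to the unit vector \<open>p\<close> orthogonal to \<open>u0\<close> for which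
  \<open>u1 = x u0 + s p\<close>. If the two vectors are parallel, any orthogonal unit vector serves
  as \<open>p\<close>.
\<close>

lemma planar_isometry:
  fixes u0 u1 :: "'v::euclidean_space"
  assumes "DIM('v) \<ge> 2" "norm u0 = 1" "norm u1 = 1" "norm z0 = 1" "norm z1 = 1" "inner z0 z1 = inner u0 u1"
  obtains J :: "complex \<Rightarrow> 'v" where "linear J" "\<And>x y. inner (J x) (J y) = inner x y" "J z0 = u0" "J z1 = u1"
proof -
  define x where "x = inner u0 u1"
  define s where "s = Im (z1 * cnj z0)"
  have z0: "(Re z0)\<^sup>2 + (Im z0)\<^sup>2 = 1" using assms(4) by (simp add: cmod_def)
  have z1: "(Re z1)\<^sup>2 + (Im z1)\<^sup>2 = 1" using assms(5) by (simp add: cmod_def)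
  have x: "x = Re (z1 * cnj z0)" using assms(6) by (simp add: x_def inner_complex_def mult.commute)
  have "x\<^sup>2 + s\<^sup>2 = (cmod (z1 * cnj z0))\<^sup>2" by (simp add: x s_def cmod_def)
  then have s: "s\<^sup>2 = 1 - x\<^sup>2" using assms(4,5) by (simp add: norm_mult)
  have uu: "inner u0 u0 = 1" "inner u1 u1 = 1" using assms(2,3) by (simp_all add: norm_eq_1)
  have nn: "(norm (u1 - x *\<^sub>R u0))\<^sup>2 = 1 - x\<^sup>2"
    unfolding power2_norm_eq_inner
    by (simp add: inner_diff_left inner_diff_right uu x_def[symmetric] inner_commute[of u1 u0] power2_eq_square)
  have "\<exists>p. norm p = 1 \<and> inner u0 p = 0 \<and> u1 = x *\<^sub>R u0 + s *\<^sub>R p"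
  proof (cases "s = 0")
    case True
    then have "norm (u1 - x *\<^sub>R u0) = 0" using nn s by simp
    then have u1: "u1 = x *\<^sub>R u0" by simp
    obtain y where y: "y \<noteq> 0" "orthogonal u0 y" using vector_in_orthogonal_basis orthogonal_to_vector_exists[OF assms(1)] by metis
    then have "norm (y /\<^sub>R norm y) = 1" "inner u0 (y /\<^sub>R norm y) = 0" by (auto simp: orthogonal_def)
    then show ?thesis using True u1 by (intro exI[of _ "y /\<^sub>R norm y"]) simp
  next
    case False
    define p where "p = (1 / s) *\<^sub>R (u1 - x *\<^sub>R u0)"
    have "(norm p)\<^sup>2 = (1 / s)\<^sup>2 * (norm (u1 - x *\<^sub>R u0))\<^sup>2" by (simp add: p_def power_mult_distrib power_divide)
    also have "\<dots> = 1" unfolding nn s[symmetric] using False by (simp add: power_divide)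
    finally have "(norm p)\<^sup>2 = 1" .
    then have "norm p = 1" by (simp add: power2_eq_1_iff) (use norm_ge_zero[of p] in linarith)
    moreover have "inner u0 p = 0" by (simp add: p_def inner_diff_right uu x_def)
    moreover have "s *\<^sub>R p = u1 - x *\<^sub>R u0" using False by (simp add: p_def)
    ultimately show ?thesis by (intro exI[of _ p] conjI) simp_all
  qed
  then obtain p where p: "norm p = 1" "inner u0 p = 0" "u1 = x *\<^sub>R u0 + s *\<^sub>R p" by blast
  have pp: "inner p p = 1" using p(1) by (simp add: norm_eq_1)
  define J where "J z = Re (z * cnj z0) *\<^sub>R u0 + Im (z * cnj z0) *\<^sub>R p" for z
  have "linear J" by (rule linearI) (simp_all add: J_def algebra_simps)
  moreover have "inner (J a) (J b) = inner a b" for a b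
  proof -
    have "inner (J a) (J b) = Re (a * cnj z0) * Re (b * cnj z0) + Im (a * cnj z0) * Im (b * cnj z0)"
      by (simp add: J_def inner_add_left inner_add_right uu pp p(2) inner_commute[of p u0])
    also have "\<dots> = (Re a * Re b + Im a * Im b) * ((Re z0)\<^sup>2 + (Im z0)\<^sup>2)"
      by (simp add: power2_eq_square algebra_simps)
    finally show ?thesis using z0 by (simp add: inner_complex_def)
  qed
  moreover have "J z0 = u0"
  proof -
    have "z0 * cnj z0 = 1" using assms(4) by (simp add: complex_norm_square[symmetric] flip: complex_norm_square)
    then show ?thesis by (simp add: J_def)
  qed
  moreover have "J z1 = u1" by (simp add: J_def p(3) x s_def)
  ultimately show thesis by (rule that)
qed

text \<open>
  Every real-linear map of the complex plane has the form \<open>y \<mapsto> \<gamma> y + \<delta>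
  cnj y\<close>, and its operator norm is \<open>\<bar>\<gamma>\<bar> +
  \<bar>\<delta>\<bar>\<close>. The adjoint of \<open>J\<close> composed with \<open>J'\<close> is a
  contraction because both are isometries.
\<close>

lemma planar_contraction:
  fixes J J' :: "complex \<Rightarrow> 'v::euclidean_space"
  assumes "linear J" "\<And>x y. inner (J x) (J y) = inner x y" "linear J'" "\<And>x y. inner (J' x) (J' y) = inner x y"
  obtains \<gamma> \<delta> where "\<And>x y. inner (J x) (J' y) = inner x (\<gamma> * y + \<delta> * cnj y)" "norm \<gamma> + norm \<delta> \<le> 1"
proof -
  define m1 where "m1 = Complex (inner (J 1) (J' 1)) (inner (J \<i>) (J' 1))"
  define m2 where "m2 = Complex (inner (J 1) (J' \<i>)) (inner (J \<i>) (J' \<i>))"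
  define \<gamma> where "\<gamma> = (m1 - \<i> * m2) / 2"
  define \<delta> where "\<delta> = (m1 + \<i> * m2) / 2"
  have Jx: "J x = Re x *\<^sub>R J 1 + Im x *\<^sub>R J \<i>" for x
  proof -
    have "x = Re x *\<^sub>R 1 + Im x *\<^sub>R \<i>" by (simp add: complex_eq_iff)
    then have "J x = J (Re x *\<^sub>R 1 + Im x *\<^sub>R \<i>)" by simp
    also have "\<dots> = Re x *\<^sub>R J 1 + Im x *\<^sub>R J \<i>" using assms(1) by (simp add: linear_add linear_scale)
    finally show ?thesis .
  qed
  have J'x: "J' x = Re x *\<^sub>R J' 1 + Im x *\<^sub>R J' \<i>" for x
  proof -
    have "x = Re x *\<^sub>R 1 + Im x *\<^sub>R \<i>" by (simp add: complex_eq_iff)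
    then have "J' x = J' (Re x *\<^sub>R 1 + Im x *\<^sub>R \<i>)" by simp
    also have "\<dots> = Re x *\<^sub>R J' 1 + Im x *\<^sub>R J' \<i>" using assms(3) by (simp add: linear_add linear_scale)
    finally show ?thesis .
  qed
  have B: "inner (J x) (J' y) = inner x (\<gamma> * y + \<delta> * cnj y)" for x y
  proof -
    have "inner (J x) (J' y) = Re x * Re y * inner (J 1) (J' 1) + Re x * Im y * inner (J 1) (J' \<i>)
        + Im x * Re y * inner (J \<i>) (J' 1) + Im x * Im y * inner (J \<i>) (J' \<i>)"
      by (subst Jx, subst J'x) (simp add: inner_add_left inner_add_right algebra_simps)
    also have "\<dots> = inner x (\<gamma> * y + \<delta> * cnj y)"
      by (simp add: inner_complex_def \<gamma>_def \<delta>_def m1_def m2_def field_simps)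
    finally show ?thesis .
  qed
  \<comment> \<open>at this unit vector \<open>y\<close> the two summands point in the same direction, so the norm is attained\<close>
  define g where "g = Arg \<gamma>"
  define h where "h = Arg \<delta>"
  define y where "y = cis ((h - g) / 2)"
  have "\<gamma> * y = cmod \<gamma> * cis ((g + h) / 2)"
  proof -
    have "\<gamma> * y = cmod \<gamma> * cis g * cis ((h - g) / 2)" by (simp add: y_def g_def rcis_cmod_Arg[unfolded rcis_def])
    also have "\<dots> = cmod \<gamma> * (cis g * cis ((h - g) / 2))" by simp
    also have "cis g * cis ((h - g) / 2) = cis (g + (h - g) / 2)" by (rule cis_mult)
    also have "g + (h - g) / 2 = (g + h) / 2" by (simp add: field_simps)
    finally show ?thesis .
  qed
  moreover have "\<delta> * cnj y = cmod \<delta> * cis ((g + h) / 2)"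
  proof -
    have "\<delta> * cnj y = cmod \<delta> * cis h * cis (- ((h - g) / 2))" by (simp add: y_def h_def cis_cnj rcis_cmod_Arg[unfolded rcis_def])
    also have "\<dots> = cmod \<delta> * (cis h * cis (- ((h - g) / 2)))" by simp
    also have "cis h * cis (- ((h - g) / 2)) = cis (h + - ((h - g) / 2))" by (rule cis_mult)
    also have "h + - ((h - g) / 2) = (g + h) / 2" by (simp add: field_simps)
    finally show ?thesis .
  qed
  ultimately have "\<gamma> * y + \<delta> * cnj y = complex_of_real (cmod \<gamma> + cmod \<delta>) * cis ((g + h) / 2)"
    by (simp add: algebra_simps)
  then have nm: "norm (\<gamma> * y + \<delta> * cnj y) = cmod \<gamma> + cmod \<delta>"
    by (simp only: norm_mult norm_of_real norm_cis) simp
  define m where "m = \<gamma> * y + \<delta> * cnj y"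
  have "norm (J m) = norm m" "norm (J' y) = norm y" using assms(2,4) by (simp_all add: norm_eq_sqrt_inner)
  then have "inner (J m) (J' y) \<le> norm m * 1" using norm_cauchy_schwarz[of "J m" "J' y"] by (simp add: y_def)
  then have "inner m m \<le> norm m" using B[of m y] by (simp add: m_def)
  then have "norm m * norm m \<le> norm m * 1" by (simp add: power2_norm_eq_inner[symmetric] power2_eq_square)
  then have "norm m \<le> 1" by (metis mult_le_cancel_left_pos norm_ge_zero order_le_less zero_le_one)
  then have "norm \<gamma> + norm \<delta> \<le> 1" using nm by (simp add: m_def)
  with B show thesis by (rule that)
qed

lemma convex_choice:
  fixes mu f :: "'k \<Rightarrow> real"
  assumes "finite K" "\<And>k. k \<in> K \<Longrightarrow> 0 \<le> mu k" "sum mu K = 1"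
  obtains k where "k \<in> K" "mu k > 0" "(\<Sum>k\<in>K. mu k * f k) \<le> f k"
proof -
  have "\<exists>k\<in>K. mu k > 0 \<and> (\<Sum>k\<in>K. mu k * f k) \<le> f k"
  proof (rule ccontr)
    let ?F = "\<Sum>k\<in>K. mu k * f k"
    assume "\<not> ?thesis"
    then have lt: "\<And>k. k \<in> K \<Longrightarrow> mu k > 0 \<Longrightarrow> f k < ?F" by force
    have le: "mu k * f k \<le> mu k * ?F" if "k \<in> K" for k
      using lt[OF that] assms(2)[OF that] by (cases "mu k = 0") (auto intro: mult_left_mono)
    have "\<exists>k\<in>K. mu k \<noteq> 0"
    proof (rule ccontr)
      assume "\<not> ?thesis"
      then have "sum mu K = 0" by (intro sum.neutral) auto
      with assms(3) show False by simp
    qed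
    then obtain k where k: "k \<in> K" "mu k > 0" using assms(2) by force
    have "?F < (\<Sum>k\<in>K. mu k * ?F)"
      by (rule sum_strict_mono_ex1[OF assms(1)]) (use le k lt in \<open>auto intro!: bexI[of _ k]\<close>)
    also have "\<dots> = ?F" using assms(3) by (simp add: sum_distrib_right[symmetric])
    finally show False by simp
  qed
  then show thesis using that by blast
qed

lemma convex_eq_1:
  fixes mu f :: "'k \<Rightarrow> real"
  assumes "finite K" "\<And>k. k \<in> K \<Longrightarrow> 0 \<le> mu k" "sum mu K = 1" "\<And>k. k \<in> K \<Longrightarrow> f k \<le> 1"
    "(\<Sum>k\<in>K. mu k * f k) = 1" "k \<in> K" "mu k > 0"
  shows "f k = 1"
proof -
  have "(\<Sum>k\<in>K. mu k * (1 - f k)) = 0"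
    using assms(3,5) by (simp add: right_diff_distrib sum_subtractf)
  moreover have "\<And>k. k \<in> K \<Longrightarrow> 0 \<le> mu k * (1 - f k)" using assms(2,4) by simp
  ultimately have "mu k * (1 - f k) = 0" using assms(1,6) by (simp add: sum_nonneg_eq_0_iff)
  then show ?thesis using assms(7) by simp
qed

text \<open>
  The heart of the rank bound. The unit vectors \<open>u\<close> of one tree node are already
  realised in the plane by \<open>z\<close>, and the unit vectors \<open>v\<close> of the next tree
  node are to be realised by \<open>y\<close>. Let \<open>J\<close> and \<open>J'\<close> be
  isometries from the plane that hit \<open>u\<close> and \<open>v\<close>. The inner products
  between the \<open>u\<close> and the \<open>v\<close> are those of \<open>z\<close> with a
  contraction of a planar realisation \<open>\<eta>\<close> of \<open>v\<close>. By
  \<open>planar_contraction\<close> this contraction is a convex combination of isometries of the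
  plane, so the objective at \<open>u\<close>, \<open>v\<close> is an average of objectives at
  planar configurations, one of which is at least as good. Inner products 1 are extreme values,
  hence preserved by every isometry of positive weight: this is what will make the configuration
  constant on branch sets.
\<close>

lemma block_config:
  fixes u v :: "nat \<Rightarrow> 'v::euclidean_space" and z :: "nat \<Rightarrow> complex" and w :: "'e \<Rightarrow> real"
  assumes "DIM('v) \<ge> 2"
    and nu: "\<And>s. s < 2 \<Longrightarrow> norm (u s) = 1" and nv: "\<And>s. s < 2 \<Longrightarrow> norm (v s) = 1"
    and nz: "\<And>s. s < 2 \<Longrightarrow> norm (z s) = 1" and zu: "inner (z 0) (z 1) = inner (u 0) (u 1)"
    and I: "finite I" "\<And>e. e \<in> I \<Longrightarrow> s e < 2 \<and> s' e < (2::nat)"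
  shows "\<exists>y :: nat \<Rightarrow> complex. (\<forall>s<2. norm (y s) = 1) \<and> inner (y 0) (y 1) = inner (v 0) (v 1) \<and>
    (\<forall>s<2. \<forall>s'<2. inner (u s) (v s') = 1 \<longrightarrow> z s = y s') \<and>
    (\<Sum>e\<in>I. w e * inner (u (s e)) (v (s' e))) \<le> (\<Sum>e\<in>I. w e * inner (z (s e)) (y (s' e)))"
proof -
  define x where "x = inner (v 0) (v 1)"
  have "\<bar>x\<bar> \<le> 1" using Cauchy_Schwarz_ineq2[of "v 0" "v 1"] nv by (simp add: x_def)
  then have x2: "x\<^sup>2 \<le> 1" by (simp add: abs_square_le_1)
  define \<eta> where "\<eta> s = (if s = 0 then 1 else Complex x (sqrt (1 - x\<^sup>2)))" for s :: nat
  have n\<eta>: "norm (\<eta> s) = 1" for s using x2 by (simp add: \<eta>_def cmod_def)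
  have in\<eta>: "inner (\<eta> 0) (\<eta> 1) = inner (v 0) (v 1)" by (simp add: \<eta>_def inner_complex_def x_def)
  obtain J :: "complex \<Rightarrow> 'v" where J: "linear J" "\<And>x y. inner (J x) (J y) = inner x y" "J (z 0) = u 0" "J (z 1) = u 1"
    by (rule planar_isometry[OF assms(1), of "u 0" "u 1" "z 0" "z 1"]) (use nu nz zu in auto)
  obtain J' :: "complex \<Rightarrow> 'v" where J': "linear J'" "\<And>x y. inner (J' x) (J' y) = inner x y" "J' (\<eta> 0) = v 0" "J' (\<eta> 1) = v 1"
    by (rule planar_isometry[OF assms(1), of "v 0" "v 1" "\<eta> 0" "\<eta> 1"]) (use nv n\<eta> in\<eta> in auto)
  obtain \<gamma> \<delta> where gd: "\<And>x y. inner (J x) (J' y) = inner x (\<gamma> * y + \<delta> * cnj y)" "norm \<gamma> + norm \<delta> \<le> 1"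
    by (rule planar_contraction[OF J(1,2) J'(1,2)]) (rule that)
  have s2: "s < 2 \<Longrightarrow> s = 0 \<or> s = 1" for s :: nat by auto
  have Ju: "J (z s) = u s" "J' (\<eta> s) = v s" if "s < 2" for s using s2[OF that] J(3,4) J'(3,4) by auto
  \<comment> \<open>the missing weight \<open>1 - \<bar>\<gamma>\<bar> - \<bar>\<delta>\<bar>\<close> is spread over the identity and its negative, which cancel\<close>
  define mu where "mu k = (if k = 0 then norm \<gamma> else if k = 1 then norm \<delta> else (1 - norm \<gamma> - norm \<delta>) / 2)" for k :: nat
  define Q where "Q k y = (if k = 0 then cis (Arg \<gamma>) * y else if k = 1 then cis (Arg \<delta>) * cnj y
      else if k = 2 then y else - y)" for k :: nat and y
  have lam: "0 \<le> mu k" for k using gd(2) by (simp add: mu_def)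
  have K: "{..<4} = {0, 1, 2, 3::nat}" by auto
  have sum1: "sum mu {..<4} = 1" unfolding K by (simp add: mu_def)
  have Qn: "norm (Q k y) = norm y" for k y by (simp add: Q_def norm_mult)
  have Qi: "inner (Q k a) (Q k b) = inner a b" for k a b
  proof -
    have r: "(C * p - S * q) * (C * p' - S * q') + (C * q + S * p) * (C * q' + S * p') = (C\<^sup>2 + S\<^sup>2) * (p * p' + q * q')"
      for C S p q p' q' :: real by (simp add: algebra_simps power2_eq_square)
    have c: "inner (cis t * a) (cis t * b) = inner a b" for t a b
    proof -
      have "inner (cis t * a) (cis t * b) = ((cos t)\<^sup>2 + (sin t)\<^sup>2) * (Re a * Re b + Im a * Im b)"
        unfolding inner_complex_def times_complex.sel cis.sel by (rule r)
      then show ?thesis by (simp add: inner_complex_def)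
    qed
    have "inner (cnj a) (cnj b) = inner a b" by (simp add: inner_complex_def)
    then show ?thesis by (simp add: Q_def c)
  qed
  have avg: "inner (u s) (v s') = (\<Sum>k<4. mu k * inner (z s) (Q k (\<eta> s')))" if "s < 2" "s' < 2" for s s'
  proof -
    have "\<gamma> * \<eta> s' + \<delta> * cnj (\<eta> s') = (\<Sum>k<4. mu k *\<^sub>R Q k (\<eta> s'))"
      unfolding K
      by (simp add: mu_def Q_def scaleR_conv_of_real) (metis mult.assoc rcis_cmod_Arg rcis_def)
    then show ?thesis using gd(1)[of "z s" "\<eta> s'"] Ju that by (simp add: inner_sum_right)
  qed
  define f where "f k = (\<Sum>e\<in>I. w e * inner (z (s e)) (Q k (\<eta> (s' e))))" for k
  obtain k where k: "k \<in> {..<4}" "mu k > 0" "(\<Sum>k<4. mu k * f k) \<le> f k"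
    using convex_choice[of "{..<4}" mu f] lam sum1 by auto
  show ?thesis
  proof (intro exI[of _ "\<lambda>s. Q k (\<eta> s)"] conjI allI impI)
    show "norm (Q k (\<eta> s)) = 1" for s using Qn n\<eta> by simp
    show "inner (Q k (\<eta> 0)) (Q k (\<eta> 1)) = inner (v 0) (v 1)" using Qi in\<eta> by simp
    have "(\<Sum>e\<in>I. w e * inner (u (s e)) (v (s' e))) = (\<Sum>e\<in>I. w e * (\<Sum>k<4. mu k * inner (z (s e)) (Q k (\<eta> (s' e)))))"
      using avg I(2) by (intro sum.cong) auto
    also have "\<dots> = (\<Sum>k<4. mu k * f k)"
      unfolding f_def sum_distrib_left by (subst sum.swap) (simp add: mult_ac)
    finally show "(\<Sum>e\<in>I. w e * inner (u (s e)) (v (s' e))) \<le> (\<Sum>e\<in>I. w e * inner (z (s e)) (Q k (\<eta> (s' e))))"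
      using k(3) by (simp add: f_def)
    fix s s' :: nat assume s: "s < 2" "s' < 2" "inner (u s) (v s') = 1"
    have *: "inner (z s) (Q k (\<eta> s')) = 1"
      by (rule convex_eq_1[of "{..<4::nat}" mu "\<lambda>k. inner (z s) (Q k (\<eta> s'))", OF _ lam sum1])
        (use s avg[OF s(1,2)] k nz[OF s(1)] Qn n\<eta> in \<open>auto intro: unit_inner_le_1\<close>)
    show "z s = Q k (\<eta> s')"
      by (rule unit_inner_eq_1[OF nz[OF s(1)] _ *]) (simp add: Qn n\<eta>)
  qed
qed

section \<open>Planar configurations along a tree\<close>

text \<open>
  The matrix entries at the positions \<open>(t, s)\<close> of the product of a tree with
  \<open>K\<^sub>2\<close> are matched by vectors in the plane, leaf by leaf. At a single tree node
  two unit vectors with the given inner product lie in a plane anyway. A new leaf \<open>u\<close>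
  at \<open>v\<close> involves only the four positions over \<open>u\<close> and \<open>v\<close>,
  to which \<open>block_config\<close> applies with the vectors at \<open>v\<close> already fixed.
  Several index pairs may sit at the same tree edge; the objective is a sum over arbitrary indices
  \<open>e\<close> to allow for this.
\<close>

lemma tree_config:
  fixes X :: "'v \<Rightarrow> 'v \<Rightarrow> real" and c :: "'t \<Rightarrow> nat \<Rightarrow> 'v" and w :: "'e \<Rightarrow> real"
  assumes "grown_tree S F" and fV: "finite V" and X: "psd_on V X" "\<And>v. v \<in> V \<Longrightarrow> X v v = 1"
    and c: "\<And>t s. t \<in> S \<Longrightarrow> s < 2 \<Longrightarrow> c t s \<in> V"
    and I: "finite I" "\<And>e. e \<in> I \<Longrightarrow> t1 e \<in> S \<and> t2 e \<in> S \<and> s1 e < 2 \<and> s2 e < 2 \<and> (t1 e = t2 e \<or> (t1 e, t2 e) \<in> F)"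
  shows "\<exists>z :: 't \<Rightarrow> nat \<Rightarrow> complex. (\<forall>t\<in>S. \<forall>s<2. norm (z t s) = 1) \<and>
     (\<forall>t\<in>S. \<forall>s<2. \<forall>s'<2. inner (z t s) (z t s') = X (c t s) (c t s')) \<and>
     (\<forall>t t'. (t, t') \<in> F \<longrightarrow> (\<forall>s<2. \<forall>s'<2. X (c t s) (c t' s') = 1 \<longrightarrow> z t s = z t' s')) \<and>
     (\<Sum>e\<in>I. w e * X (c (t1 e) (s1 e)) (c (t2 e) (s2 e))) \<le> (\<Sum>e\<in>I. w e * inner (z (t1 e) (s1 e)) (z (t2 e) (s2 e)))"
  using assms(1) c I
proof (induction arbitrary: I rule: grown_tree.induct)
  case (grown_tree_single r)
  define x where "x = X (c r 0) (c r 1)"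
  have cr: "c r 0 \<in> V" "c r 1 \<in> V" using grown_tree_single(1) by auto
  have sym: "X p q = X q p" if "p \<in> V" "q \<in> V" for p q using X(1) that by (auto simp: psd_on_def)
  obtain f where f: "\<forall>i\<in>V. \<forall>j\<in>V. X i j = (\<Sum>l<card V. f i l * f j l)" using gram_coordinates[OF fV X(1)] by blast
  have "x\<^sup>2 \<le> 1"
  proof -
    have "(\<Sum>l<card V. f (c r 0) l * f (c r 1) l)\<^sup>2 \<le> (\<Sum>l<card V. (f (c r 0) l)\<^sup>2) * (\<Sum>l<card V. (f (c r 1) l)\<^sup>2)"
      by (rule Cauchy_Schwarz_ineq_sum)
    moreover have "(\<Sum>l<card V. (f v l)\<^sup>2) = 1" if "v \<in> V" for v
      using f X(2)[OF that] that by (simp add: power2_eq_square)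
    ultimately show ?thesis using f cr by (simp add: x_def)
  qed
  define z where "z t s = (if s = (0::nat) then 1 else Complex x (sqrt (1 - x\<^sup>2)))" for t :: 't and s
  have two: "s < 2 \<Longrightarrow> s = 0 \<or> s = 1" for s :: nat by auto
  have n: "norm (z t s) = 1" for t s using \<open>x\<^sup>2 \<le> 1\<close> by (simp add: z_def cmod_def)
  have nn: "inner (z t s) (z t s) = 1" for t s using n[of t s] by (simp add: norm_eq_1)
  have g: "inner (z t s) (z t s') = X (c r s) (c r s')" if "s < 2" "s' < 2" for t s s'
    using two[OF that(1)] two[OF that(2)]
  proof (elim disjE)
    assume "s = 0" "s' = 1" then show ?thesis by (simp add: z_def inner_complex_def x_def)
  next
    assume "s = 1" "s' = 0" then show ?thesis using sym[OF cr] by (simp add: z_def inner_complex_def x_def)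
  qed (use nn X(2) cr in auto)
  have "(\<Sum>e\<in>I. w e * X (c (t1 e) (s1 e)) (c (t2 e) (s2 e))) = (\<Sum>e\<in>I. w e * inner (z (t1 e) (s1 e)) (z (t2 e) (s2 e)))"
  proof (rule sum.cong[OF refl])
    fix e assume "e \<in> I"
    then have "t1 e = r" "t2 e = r" "s1 e < 2" "s2 e < 2" using grown_tree_single(3) by auto
    then show "w e * X (c (t1 e) (s1 e)) (c (t2 e) (s2 e)) = w e * inner (z (t1 e) (s1 e)) (z (t2 e) (s2 e))"
      using g[of "s1 e" "s2 e" r] by simp
  qed
  then show ?case using n g by (intro exI[of _ z]) auto
next
  case (grown_tree_leaf S F v u)
  note b = grown_tree_basic[OF grown_tree_leaf(1)]
  have sym: "X p q = X q p" if "p \<in> V" "q \<in> V" for p q using X(1) that by (auto simp: psd_on_def)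
  \<comment> \<open>the terms of the old tree, of the new tree edge, and inside the new leaf\<close>
  define I0 where "I0 = {e\<in>I. t1 e \<in> S \<and> t2 e \<in> S}"
  define I1 where "I1 = {e\<in>I. (t1 e, t2 e) \<in> {(u, v), (v, u)}}"
  define I2 where "I2 = {e\<in>I. t1 e = u \<and> t2 e = u}"
  have uv: "u \<noteq> v" using grown_tree_leaf by auto
  have I: "I = I0 \<union> I1 \<union> I2"
  proof
    show "I \<subseteq> I0 \<union> I1 \<union> I2"
    proof
      fix e assume e: "e \<in> I"
      have "(t1 e, t2 e) \<in> F \<Longrightarrow> t1 e \<in> S \<and> t2 e \<in> S" using b by auto
      then show "e \<in> I0 \<union> I1 \<union> I2"
        using grown_tree_leaf.prems(3)[OF e] e by (auto simp: I0_def I1_def I2_def)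
    qed
  qed (auto simp: I0_def I1_def I2_def)
  have dj: "I0 \<inter> I1 = {}" "(I0 \<union> I1) \<inter> I2 = {}" using grown_tree_leaf(3) uv by (auto simp: I0_def I1_def I2_def)
  have fin: "finite I0" "finite I1" "finite I2" using grown_tree_leaf.prems(2) I by auto
  have split: "(\<Sum>e\<in>I. h e) = (\<Sum>e\<in>I0. h e) + (\<Sum>e\<in>I1. h e) + (\<Sum>e\<in>I2. h e)" for h :: "'e \<Rightarrow> real"
    unfolding I using dj fin by (simp add: sum.union_disjoint)
  have c0: "c t s \<in> V" if "t \<in> S" "s < 2" for t s using grown_tree_leaf.prems(1) that by auto
  have loc0: "t1 e \<in> S \<and> t2 e \<in> S \<and> s1 e < 2 \<and> s2 e < 2 \<and> (t1 e = t2 e \<or> (t1 e, t2 e) \<in> F)" if "e \<in> I0" for e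
    using grown_tree_leaf.prems(3)[of e] that grown_tree_leaf(3) by (auto simp: I0_def)
  obtain z :: "'t \<Rightarrow> nat \<Rightarrow> complex" where z: "\<forall>t\<in>S. \<forall>s<2. norm (z t s) = 1"
     "\<forall>t\<in>S. \<forall>s<2. \<forall>s'<2. inner (z t s) (z t s') = X (c t s) (c t s')"
     "\<forall>t t'. (t, t') \<in> F \<longrightarrow> (\<forall>s<2. \<forall>s'<2. X (c t s) (c t' s') = 1 \<longrightarrow> z t s = z t' s')"
     "(\<Sum>e\<in>I0. w e * X (c (t1 e) (s1 e)) (c (t2 e) (s2 e))) \<le> (\<Sum>e\<in>I0. w e * inner (z (t1 e) (s1 e)) (z (t2 e) (s2 e)))"
    using grown_tree_leaf.IH[OF c0 fin(1) loc0] by blast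
  define Q where "Q = {v, u} \<times> {..<2::nat}"
  have Q: "finite Q" "card Q = 4" using uv by (auto simp: Q_def card_cartesian_product)
  have cQ: "c (fst i) (snd i) \<in> V" if "i \<in> Q" for i using grown_tree_leaf.prems(1) grown_tree_leaf(2) that by (auto simp: Q_def)
  have psdQ: "psd_on Q (\<lambda>i j. X (c (fst i) (snd i)) (c (fst j) (snd j)))"
    by (rule psd_on_pullback[OF fV X(1)]) (rule cQ)
  from gram_four[OF Q psdQ] obtain g :: "'t \<times> nat \<Rightarrow> complex \<times> complex" where
    g': "\<forall>i\<in>Q. \<forall>j\<in>Q. X (c (fst i) (snd i)) (c (fst j) (snd j)) = inner (g i) (g j)"
    by (elim exE) (rule that)
  have g: "X (c (fst i) (snd i)) (c (fst j) (snd j)) = inner (g i) (g j)" if "i \<in> Q" "j \<in> Q" for i j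
    using g' that by simp
  define gu where "gu s = g (v, s)" for s
  define gv where "gv s = g (u, s)" for s
  have mem: "(v, s) \<in> Q" "(u, s) \<in> Q" if "s < 2" for s using that by (auto simp: Q_def)
  have gX: "inner (gu s) (gv s') = X (c v s) (c u s')" "inner (gu s) (gu s') = X (c v s) (c v s')"
    "inner (gv s) (gv s') = X (c u s) (c u s')" if "s < 2" "s' < 2" for s s'
    using g[OF mem(1)[OF that(1)] mem(2)[OF that(2)]] g[OF mem(1)[OF that(1)] mem(1)[OF that(2)]]
      g[OF mem(2)[OF that(1)] mem(2)[OF that(2)]] by (simp_all add: gu_def gv_def)
  have ng: "norm (gu s) = 1" "norm (gv s) = 1" if "s < 2" for s
    using gX(2,3)[OF that that] X(2) grown_tree_leaf.prems(1) grown_tree_leaf(2) that by (auto simp: norm_eq_1)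
  \<comment> \<open>the index at \<open>v\<close> and the index at \<open>u\<close>, whichever way round the term lists them\<close>
  define a where "a e = (if t1 e = v then s1 e else s2 e)" for e
  define b' where "b' e = (if t1 e = v then s2 e else s1 e)" for e
  have ab: "a e < 2 \<and> b' e < 2" if "e \<in> I1" for e using grown_tree_leaf.prems(3)[of e] that by (auto simp: I1_def a_def b'_def)
  have nz: "norm (z v s) = 1" if "s < 2" for s using z(1) grown_tree_leaf(2) that by auto
  have zu: "inner (z v 0) (z v 1) = inner (gu 0) (gu 1)" using z(2) grown_tree_leaf(2) gX(2)[of 0 1] by auto
  have dim: "DIM(complex \<times> complex) \<ge> 2" by simp
  have "\<exists>y :: nat \<Rightarrow> complex. (\<forall>s<2. norm (y s) = 1) \<and> inner (y 0) (y 1) = inner (gv 0) (gv 1) \<and>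
    (\<forall>s<2. \<forall>s'<2. inner (gu s) (gv s') = 1 \<longrightarrow> z v s = y s') \<and>
    (\<Sum>e\<in>I1. w e * inner (gu (a e)) (gv (b' e))) \<le> (\<Sum>e\<in>I1. w e * inner (z v (a e)) (y (b' e)))"
    by (rule block_config[of gu gv "z v" I1 a b' w, OF dim ng(1) ng(2) nz zu fin(2) ab])
  then obtain y :: "nat \<Rightarrow> complex" where y': "\<forall>s<2. norm (y s) = 1" "inner (y 0) (y 1) = inner (gv 0) (gv 1)"
    "\<forall>s<2. \<forall>s'<2. inner (gu s) (gv s') = 1 \<longrightarrow> z v s = y s'"
    "(\<Sum>e\<in>I1. w e * inner (gu (a e)) (gv (b' e))) \<le> (\<Sum>e\<in>I1. w e * inner (z v (a e)) (y (b' e)))"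
    by (elim exE conjE) (rule that)
  have y: "\<And>s. s < 2 \<Longrightarrow> norm (y s) = 1" "inner (y 0) (y 1) = inner (gv 0) (gv 1)"
    "\<And>s s'. s < 2 \<Longrightarrow> s' < 2 \<Longrightarrow> inner (gu s) (gv s') = 1 \<Longrightarrow> z v s = y s'"
    "(\<Sum>e\<in>I1. w e * inner (gu (a e)) (gv (b' e))) \<le> (\<Sum>e\<in>I1. w e * inner (z v (a e)) (y (b' e)))"
    using y' by simp_all
  define z' where "z' = z(u := y)"
  have zS: "t \<in> S \<Longrightarrow> z' t = z t" for t using grown_tree_leaf(3) by (auto simp: z'_def)
  have zu': "z' u = y" "z' v = z v" using uv by (auto simp: z'_def)
  have two: "s < 2 \<Longrightarrow> s = 0 \<or> s = 1" for s :: nat by auto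
  have yX: "inner (y s) (y s') = X (c u s) (c u s')" if s: "s < 2" "s' < 2" for s s'
    using two[OF s(1)] two[OF s(2)]
  proof (elim disjE)
    assume "s = 0" "s' = 1" then show ?thesis using y(2) gX(3)[of 0 1] by simp
  next
    assume "s = 1" "s' = 0" then show ?thesis using y(2) gX(3)[of 1 0] by (simp add: inner_commute)
  qed (use y(1)[OF s(1)] y(1)[OF s(2)] X(2) grown_tree_leaf.prems(1) in \<open>auto simp: norm_eq_1\<close>)
  have eq: "X (c v s) (c u s') = 1 \<Longrightarrow> z v s = y s'" if "s < 2" "s' < 2" for s s'
    using y(3)[OF that] gX(1)[OF that] by simp
  have cV: "c v s \<in> V" "c u s \<in> V" if "s < 2" for s using grown_tree_leaf.prems(1) grown_tree_leaf(2) that by auto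
  have 1: "\<forall>t\<in>insert u S. \<forall>s<2. norm (z' t s) = 1" using z(1) y(1) zS zu' by auto
  have 2: "\<forall>t\<in>insert u S. \<forall>s<2. \<forall>s'<2. inner (z' t s) (z' t s') = X (c t s) (c t s')"
    using z(2) yX zS zu' by auto
  have 3: "z' t s = z' t' s'" if t: "(t, t') \<in> insert (u, v) (insert (v, u) F)" "s < 2" "s' < 2" "X (c t s) (c t' s') = 1" for t t' s s'
  proof -
    consider "t = u" "t' = v" | "t = v" "t' = u" | "(t, t') \<in> F" using t(1) by auto
    then show ?thesis
    proof cases
      case 1
      then have "X (c v s') (c u s) = 1" using t(4) sym[OF cV(2)[OF t(2)] cV(1)[OF t(3)]] by simp
      then show ?thesis using eq[OF t(3,2)] zu' 1 by simp
    next
      case 2 then show ?thesis using eq[OF t(2,3)] t(4) zu' by simp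
    next
      case 3
      then have "t \<in> S" "t' \<in> S" using b by auto
      then show ?thesis using z(3) 3 t zS by auto
    qed
  qed
  have 4: "(\<Sum>e\<in>I. w e * X (c (t1 e) (s1 e)) (c (t2 e) (s2 e))) \<le> (\<Sum>e\<in>I. w e * inner (z' (t1 e) (s1 e)) (z' (t2 e) (s2 e)))"
    unfolding split
  proof (intro add_mono)
    have "(\<Sum>e\<in>I0. w e * inner (z (t1 e) (s1 e)) (z (t2 e) (s2 e))) = (\<Sum>e\<in>I0. w e * inner (z' (t1 e) (s1 e)) (z' (t2 e) (s2 e)))"
      by (intro sum.cong) (auto simp: zS I0_def)
    with z(4) show "(\<Sum>e\<in>I0. w e * X (c (t1 e) (s1 e)) (c (t2 e) (s2 e))) \<le> (\<Sum>e\<in>I0. w e * inner (z' (t1 e) (s1 e)) (z' (t2 e) (s2 e)))" by simp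
    have "(\<Sum>e\<in>I1. w e * X (c (t1 e) (s1 e)) (c (t2 e) (s2 e))) = (\<Sum>e\<in>I1. w e * inner (gu (a e)) (gv (b' e)))"
    proof (rule sum.cong[OF refl])
      fix e assume e: "e \<in> I1"
      then have s: "s1 e < 2" "s2 e < 2" using grown_tree_leaf.prems(3)[of e] by (auto simp: I1_def)
      consider "t1 e = v" "t2 e = u" | "t1 e = u" "t2 e = v" using e by (auto simp: I1_def)
      then show "w e * X (c (t1 e) (s1 e)) (c (t2 e) (s2 e)) = w e * inner (gu (a e)) (gv (b' e))"
      proof cases
        case 1 then show ?thesis using gX(1)[OF s] by (simp add: a_def b'_def)
      next
        case 2 then show ?thesis using gX(1)[OF s(2,1)] uv sym[OF cV(2)[OF s(1)] cV(1)[OF s(2)]] by (simp add: a_def b'_def)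
      qed
    qed
    moreover have "(\<Sum>e\<in>I1. w e * inner (z v (a e)) (y (b' e))) = (\<Sum>e\<in>I1. w e * inner (z' (t1 e) (s1 e)) (z' (t2 e) (s2 e)))"
    proof (rule sum.cong[OF refl])
      fix e assume "e \<in> I1"
      then consider "t1 e = v" "t2 e = u" | "t1 e = u" "t2 e = v" by (auto simp: I1_def)
      then show "w e * inner (z v (a e)) (y (b' e)) = w e * inner (z' (t1 e) (s1 e)) (z' (t2 e) (s2 e))"
        using uv by cases (simp_all add: a_def b'_def zu' inner_commute)
    qed
    ultimately show "(\<Sum>e\<in>I1. w e * X (c (t1 e) (s1 e)) (c (t2 e) (s2 e))) \<le> (\<Sum>e\<in>I1. w e * inner (z' (t1 e) (s1 e)) (z' (t2 e) (s2 e)))"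
      using y(4) by simp
    show "(\<Sum>e\<in>I2. w e * X (c (t1 e) (s1 e)) (c (t2 e) (s2 e))) \<le> (\<Sum>e\<in>I2. w e * inner (z' (t1 e) (s1 e)) (z' (t2 e) (s2 e)))"
    proof (intro sum_mono)
      fix e assume e: "e \<in> I2"
      then have s: "s1 e < 2" "s2 e < 2" using grown_tree_leaf.prems(3)[of e] by (auto simp: I2_def)
      show "w e * X (c (t1 e) (s1 e)) (c (t2 e) (s2 e)) \<le> w e * inner (z' (t1 e) (s1 e)) (z' (t2 e) (s2 e))"
        using e yX[OF s] by (simp add: I2_def zu')
    qed
  qed
  show ?case
    using 1 2 3 4 by (intro exI[of _ z'] conjI) blast+
qed

text \<open>
  Pull \<open>X\<close> back along the branch sets to the product of the tree with
  \<open>K\<^sub>2\<close>. Neighbouring positions in the same branch set carry the entry \<open>X v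
  v = 1\<close>, so \<open>tree_config\<close> gives them equal vectors, and the vector of a branch
  set is well defined.
\<close>

theorem planar_config_of_model:
  fixes X :: "'v \<Rightarrow> 'v \<Rightarrow> real" and S :: "'t set" and w :: "'e \<Rightarrow> real"
    and \<beta> :: "'v \<Rightarrow> ('t \<times> nat) set"
  assumes tg: "grown_tree S F" and m: "model EM V E' (S \<times> {..<2}) \<beta>"
    and E': "\<And>t s t' s'. ((t, s), (t', s')) \<in> E' \<Longrightarrow> t = t' \<or> (t, t') \<in> F"
    and fV: "finite V" and X: "psd_on V X" "\<And>v. v \<in> V \<Longrightarrow> X v v = 1"
    and I: "finite I" "\<And>e. e \<in> I \<Longrightarrow> p e \<in> V \<and> q e \<in> V \<and> (p e, q e) \<in> EM"
  obtains \<zeta> :: "'v \<Rightarrow> complex" where "\<And>v. v \<in> V \<Longrightarrow> norm (\<zeta> v) = 1"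
    "(\<Sum>e\<in>I. w e * X (p e) (q e)) \<le> (\<Sum>e\<in>I. w e * inner (\<zeta> (p e)) (\<zeta> (q e)))"
proof (cases "V = {}")
  case True
  then have "I = {}" using I(2) by blast
  then show thesis using that[of "\<lambda>_. 1"] by simp
next
  case False
  then obtain v0 where v0: "v0 \<in> V" by auto
  note M = modelD[OF m]
  \<comment> \<open>the node whose branch set contains the position; unused positions repeat some node \<open>v0\<close>\<close>
  define c where "c t s = (if \<exists>v\<in>V. (t, s) \<in> \<beta> v then SOME v. v \<in> V \<and> (t, s) \<in> \<beta> v else v0)" for t and s :: nat
  have cV: "c t s \<in> V" for t s
  proof (cases "\<exists>v\<in>V. (t, s) \<in> \<beta> v")
    case True
    then have "\<exists>v. v \<in> V \<and> (t, s) \<in> \<beta> v" by blast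
    from someI_ex[OF this] show ?thesis using True by (simp add: c_def)
  qed (simp add: c_def v0)
  have c: "c t s = v" if v: "v \<in> V" "(t, s) \<in> \<beta> v" for t s v
  proof -
    have "\<exists>v. v \<in> V \<and> (t, s) \<in> \<beta> v" using v by blast
    from someI_ex[OF this] have *: "c t s \<in> V" "(t, s) \<in> \<beta> (c t s)" using v by (auto simp: c_def)
    then show ?thesis using M(4)[OF *(1) v(1)] v(2) by blast
  qed
  have "\<forall>e\<in>I. \<exists>l. fst l \<in> \<beta> (p e) \<and> snd l \<in> \<beta> (q e) \<and> l \<in> E'"
  proof
    fix e assume "e \<in> I"
    then have "adj E' (\<beta> (p e)) (\<beta> (q e))" using I(2) M(5) by blast
    then obtain x y where "x \<in> \<beta> (p e)" "y \<in> \<beta> (q e)" "(x, y) \<in> E'" by (auto simp: adj_def)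
    then show "\<exists>l. fst l \<in> \<beta> (p e) \<and> snd l \<in> \<beta> (q e) \<and> l \<in> E'" by (intro exI[of _ "(x, y)"]) simp
  qed
  from bchoice[OF this] obtain l where l: "\<And>e. e \<in> I \<Longrightarrow> fst (l e) \<in> \<beta> (p e) \<and> snd (l e) \<in> \<beta> (q e) \<and> l e \<in> E'" by blast
  define t1 s1 t2 s2 where "t1 e = fst (fst (l e))" and "s1 e = snd (fst (l e))" and
    "t2 e = fst (snd (l e))" and "s2 e = snd (snd (l e))" for e
  have loc: "t1 e \<in> S \<and> t2 e \<in> S \<and> s1 e < 2 \<and> s2 e < 2 \<and> (t1 e = t2 e \<or> (t1 e, t2 e) \<in> F)"
    and cl: "c (t1 e) (s1 e) = p e" "c (t2 e) (s2 e) = q e" "(t1 e, s1 e) \<in> \<beta> (p e)" "(t2 e, s2 e) \<in> \<beta> (q e)" if e: "e \<in> I" for e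
  proof -
    have b: "(t1 e, s1 e) \<in> \<beta> (p e)" "(t2 e, s2 e) \<in> \<beta> (q e)" "((t1 e, s1 e), (t2 e, s2 e)) \<in> E'"
      using l[OF e] by (simp_all add: t1_def s1_def t2_def s2_def)
    have pq: "p e \<in> V" "q e \<in> V" using I(2)[OF e] by auto
    show "t1 e \<in> S \<and> t2 e \<in> S \<and> s1 e < 2 \<and> s2 e < 2 \<and> (t1 e = t2 e \<or> (t1 e, t2 e) \<in> F)"
      using b M(2)[OF pq(1)] M(2)[OF pq(2)] E'[OF b(3)] by auto
    show "c (t1 e) (s1 e) = p e" "c (t2 e) (s2 e) = q e" using c[OF pq(1) b(1)] c[OF pq(2) b(2)] .
    show "(t1 e, s1 e) \<in> \<beta> (p e)" "(t2 e, s2 e) \<in> \<beta> (q e)" by (rule b)+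
  qed
  obtain z :: "'t \<Rightarrow> nat \<Rightarrow> complex" where z: "\<forall>t\<in>S. \<forall>s<2. norm (z t s) = 1"
     "\<forall>t\<in>S. \<forall>s<2. \<forall>s'<2. inner (z t s) (z t s') = X (c t s) (c t s')"
     "\<forall>t t'. (t, t') \<in> F \<longrightarrow> (\<forall>s<2. \<forall>s'<2. X (c t s) (c t' s') = 1 \<longrightarrow> z t s = z t' s')"
     "(\<Sum>e\<in>I. w e * X (c (t1 e) (s1 e)) (c (t2 e) (s2 e))) \<le> (\<Sum>e\<in>I. w e * inner (z (t1 e) (s1 e)) (z (t2 e) (s2 e)))"
  proof -
    note * = tree_config[where c = c and I = I and w = w and ?t1.0 = t1 and ?t2.0 = t2 and ?s1.0 = s1 and ?s2.0 = s2,
        OF tg fV X(1)]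
    have "\<exists>z :: 't \<Rightarrow> nat \<Rightarrow> complex. (\<forall>t\<in>S. \<forall>s<2. norm (z t s) = 1) \<and>
     (\<forall>t\<in>S. \<forall>s<2. \<forall>s'<2. inner (z t s) (z t s') = X (c t s) (c t s')) \<and>
     (\<forall>t t'. (t, t') \<in> F \<longrightarrow> (\<forall>s<2. \<forall>s'<2. X (c t s) (c t' s') = 1 \<longrightarrow> z t s = z t' s')) \<and>
     (\<Sum>e\<in>I. w e * X (c (t1 e) (s1 e)) (c (t2 e) (s2 e))) \<le> (\<Sum>e\<in>I. w e * inner (z (t1 e) (s1 e)) (z (t2 e) (s2 e)))"
      by (rule *) (use X(2) cV I(1) loc in auto)
    then show thesis by (elim exE conjE) (rule that)
  qed
  have step: "z t s = z t' s'" if h: "v \<in> V" "(t, s) \<in> \<beta> v" "(t', s') \<in> \<beta> v" "((t, s), (t', s')) \<in> E'" for v t s t' s'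
  proof -
    have ts: "t \<in> S" "s < 2" "t' \<in> S" "s' < 2" using M(2)[OF h(1)] h(2,3) by auto
    have X1: "X (c t s) (c t' s') = 1" using c[OF h(1,2)] c[OF h(1,3)] X(2)[OF h(1)] by simp
    show ?thesis
    proof (cases "t = t'")
      case True
      then have *: "inner (z t s) (z t s') = 1" using z(2) ts X1 by simp
      have n: "norm (z t s) = 1" "norm (z t s') = 1" using z(1) ts by simp_all
      from unit_inner_eq_1[OF n *] show ?thesis using True by simp
    next
      case False
      then have "(t, t') \<in> F" using E'[OF h(4)] by simp
      then show ?thesis using z(3) ts X1 by blast
    qed
  qed
  have const: "z (fst a) (snd a) = z (fst b) (snd b)" if v: "v \<in> V" "a \<in> \<beta> v" "b \<in> \<beta> v" for v a b
  proof -
    have "(a, b) \<in> (E' \<inter> \<beta> v \<times> \<beta> v)\<^sup>*" by (rule linkedD[OF M(3)[OF v(1)] v(2,3)])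
    then show ?thesis
    proof (induction rule: rtrancl_induct)
      case (step x y)
      then have "x \<in> \<beta> v" "y \<in> \<beta> v" "(x, y) \<in> E'" by auto
      then show ?case using step.IH \<open>\<And>v t s t' s'. v \<in> V \<Longrightarrow> (t, s) \<in> \<beta> v \<Longrightarrow> (t', s') \<in> \<beta> v \<Longrightarrow> ((t, s), (t', s')) \<in> E' \<Longrightarrow> z t s = z t' s'\<close>[OF v(1), of "fst x" "snd x" "fst y" "snd y"]
        by simp
    qed simp
  qed
  define \<zeta> where "\<zeta> v = (let a = SOME a. a \<in> \<beta> v in z (fst a) (snd a))" for v
  have some: "(SOME a. a \<in> \<beta> v) \<in> \<beta> v" if "v \<in> V" for v using M(1)[OF that] by (simp add: some_in_eq)
  have \<zeta>: "\<zeta> v = z t s" if "v \<in> V" "(t, s) \<in> \<beta> v" for v t s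
    using const[OF that(1) some[OF that(1)] that(2)] by (simp add: \<zeta>_def Let_def)
  show thesis
  proof (rule that[of \<zeta>])
    fix v assume v: "v \<in> V"
    have "(SOME a. a \<in> \<beta> v) \<in> S \<times> {..<2}" using M(2)[OF v] some[OF v] by blast
    then show "norm (\<zeta> v) = 1" using z(1) by (auto simp: \<zeta>_def Let_def mem_Times_iff)
  next
    have "(\<Sum>e\<in>I. w e * X (p e) (q e)) = (\<Sum>e\<in>I. w e * X (c (t1 e) (s1 e)) (c (t2 e) (s2 e)))"
      using cl(1,2) by (intro sum.cong) auto
    also have "\<dots> \<le> (\<Sum>e\<in>I. w e * inner (z (t1 e) (s1 e)) (z (t2 e) (s2 e)))" by (rule z(4))
    also have "\<dots> = (\<Sum>e\<in>I. w e * inner (\<zeta> (p e)) (\<zeta> (q e)))"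
    proof (rule sum.cong[OF refl])
      fix e assume e: "e \<in> I"
      have "p e \<in> V" "q e \<in> V" using I(2)[OF e] by simp_all
      then show "w e * inner (z (t1 e) (s1 e)) (z (t2 e) (s2 e)) = w e * inner (\<zeta> (p e)) (\<zeta> (q e))"
        by (simp add: \<zeta>[OF _ cl(3)[OF e]] \<zeta>[OF _ cl(4)[OF e]])
    qed
    finally show "(\<Sum>e\<in>I. w e * X (p e) (q e)) \<le> (\<Sum>e\<in>I. w e * inner (\<zeta> (p e)) (\<zeta> (q e)))" .
  qed
qed

section \<open>Rank gaps\<close>

lemma relpow_norm_bound:
  fixes z :: "'v \<Rightarrow> 'a::real_normed_vector"
  assumes "(a, b) \<in> R ^^ n" "\<And>p q. (p, q) \<in> R \<Longrightarrow> norm (z p - z q) \<le> m"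
  shows "norm (z a - z b) \<le> real n * m"
  using assms(1)
proof (induction n arbitrary: b)
  case (Suc n)
  then obtain c where c: "(a, c) \<in> R ^^ n" "(c, b) \<in> R" by auto
  have "norm (z a - z b) \<le> norm (z a - z c) + norm (z c - z b)"
    using norm_triangle_ineq[of "z a - z c" "z c - z b"] by simp
  also have "\<dots> \<le> real n * m + m" using Suc.IH[OF c(1)] assms(2)[OF c(2)] by simp
  finally show ?case by (simp add: algebra_simps)
qed simp

lemma unit_inner_dist:
  fixes x y :: "'v::real_inner"
  assumes "norm x = 1" "norm y = 1" shows "inner x y = 1 - (norm (x - y))\<^sup>2 / 2"
proof -
  have "inner x x = 1" "inner y y = 1" using assms by (simp_all add: norm_eq_1)
  then show ?thesis
    unfolding power2_norm_eq_inner by (simp add: inner_diff_left inner_diff_right inner_commute[of y x] field_simps)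
qed

lemma inner_perturb:
  fixes x y :: "'v::real_inner"
  assumes "norm x = 1" "norm y' = 1"
  shows "inner x y - inner x' y' \<le> norm (x - x') + norm (y - y')"
proof -
  have "inner x y - inner x' y' = inner x (y - y') + inner (x - x') y'"
    by (simp add: inner_diff_left inner_diff_right)
  also have "\<dots> \<le> norm x * norm (y - y') + norm (x - x') * norm y'"
    by (intro add_mono norm_cauchy_schwarz)
  finally show ?thesis using assms by simp
qed

text \<open>
  A gap between the planar optimum and the optimum in a larger space is inherited from a minor
  \<open>M\<close> by the whole graph. Give one representative edge for each arc of \<open>M\<close>
  the weight of that arc, and all edges inside branch sets a large weight \<open>K\<close>. Let
  \<open>z\<close> be a planar configuration that beats every configuration, and \<open>T\<close>
  the sum of its squared distances along the heavy edges. Replacing \<open>z\<close> by one value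
  per branch set changes the rest of the objective by at most \<open>A t\<close>, where \<open>t =
  \<surd>T\<close>, while the heavy edges cost \<open>K T / 2\<close>. So the gap
  \<open>\<epsilon>\<close> satisfies \<open>\<epsilon> + K t\<^sup>2 / 2 \<le> A t\<close>, which
  is impossible for large \<open>K\<close>.
\<close>

lemma gap_contradiction:
  fixes y :: "'m \<Rightarrow> 'w::euclidean_space" and WM :: "'m \<times> 'm \<Rightarrow> real" and E :: "('v \<times> 'v) set"
  assumes E: "finite E" and m: "model EM VM E V \<beta>" and EM: "finite EM" "EM \<subseteq> VM \<times> VM" "irrefl EM"
    and y: "\<And>x. x \<in> VM \<Longrightarrow> norm (y x) = 1" and eps: "\<epsilon> > 0"
    and gap: "\<And>z :: 'm \<Rightarrow> complex. (\<And>x. x \<in> VM \<Longrightarrow> norm (z x) = 1) \<Longrightarrow>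
        (\<Sum>a\<in>EM. WM a * inner (z (fst a)) (z (snd a))) + \<epsilon> \<le> (\<Sum>a\<in>EM. WM a * inner (y (fst a)) (y (snd a)))"
    and planar: "\<And>W :: 'v \<times> 'v \<Rightarrow> real. \<exists>z :: 'v \<Rightarrow> complex. (\<forall>v\<in>V. norm (z v) = 1) \<and>
        (\<forall>Y :: 'v \<Rightarrow> 'w. (\<forall>v\<in>V. norm (Y v) = 1) \<longrightarrow>
          (\<Sum>e\<in>E. W e * inner (Y (fst e)) (Y (snd e))) \<le> (\<Sum>e\<in>E. W e * inner (z (fst e)) (z (snd e))))"
    and EV: "E \<subseteq> V \<times> V"
  shows False
proof -
  note M = modelD[OF m]
  define N where "N = real (card E)"
  define C where "C = (\<Sum>a\<in>EM. \<bar>WM a\<bar>)"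
  define A where "A = 2 * C * N"
  \<comment> \<open>any \<open>K > A\<^sup>2 / (2 \<epsilon>)\<close> makes the quadratic \<open>\<epsilon> - A t + K t\<^sup>2 / 2\<close> positive\<close>
  define K where "K = A\<^sup>2 / \<epsilon> + 1"
  have "\<forall>a\<in>EM. \<exists>e. e \<in> E \<and> fst e \<in> \<beta> (fst a) \<and> snd e \<in> \<beta> (snd a)"
  proof
    fix a assume a: "a \<in> EM"
    then have "fst a \<in> VM" "snd a \<in> VM" "(fst a, snd a) \<in> EM" using EM(2) by auto
    from M(5)[OF this] obtain u v where uv: "u \<in> \<beta> (fst a)" "v \<in> \<beta> (snd a)" "(u, v) \<in> E" by (auto simp: adj_def)
    then show "\<exists>e. e \<in> E \<and> fst e \<in> \<beta> (fst a) \<and> snd e \<in> \<beta> (snd a)" by (intro exI[of _ "(u, v)"]) simp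
  qed
  from bchoice[OF this] obtain rep where rep: "\<forall>a\<in>EM. rep a \<in> E \<and> fst (rep a) \<in> \<beta> (fst a) \<and> snd (rep a) \<in> \<beta> (snd a)" by blast
  have uniq: "x = x'" if "x \<in> VM" "x' \<in> VM" "v \<in> \<beta> x" "v \<in> \<beta> x'" for x x' v using M(4)[OF that(1,2)] that(3,4) by blast
  have aVM: "fst a \<in> VM" "snd a \<in> VM" "fst a \<noteq> snd a" if "a \<in> EM" for a
  proof -
    show "fst a \<in> VM" "snd a \<in> VM" using that EM(2) by auto
    show "fst a \<noteq> snd a" using that EM(3) by (cases a) (auto simp: irrefl_def)
  qed
  have inj: "inj_on rep EM"
  proof (rule inj_onI)
    fix a b assume ab: "a \<in> EM" "b \<in> EM" "rep a = rep b"
    have r: "fst (rep a) \<in> \<beta> (fst a)" "fst (rep a) \<in> \<beta> (fst b)" "snd (rep a) \<in> \<beta> (snd a)" "snd (rep a) \<in> \<beta> (snd b)"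
      using rep ab(1,2) unfolding ab(3) using ab(3) by (metis)+
    show "a = b"
      using uniq[OF aVM(1)[OF ab(1)] aVM(1)[OF ab(2)] r(1,2)] uniq[OF aVM(2)[OF ab(1)] aVM(2)[OF ab(2)] r(3,4)]
      by (simp add: prod_eq_iff)
  qed
  define In where "In = {e\<in>E. \<exists>x\<in>VM. fst e \<in> \<beta> x \<and> snd e \<in> \<beta> x}"
  have fIn: "finite In" using E by (simp add: In_def)
  have dj: "In \<inter> rep ` EM = {}"
  proof (rule ccontr)
    assume "In \<inter> rep ` EM \<noteq> {}"
    then obtain a x where ax: "a \<in> EM" "x \<in> VM" "fst (rep a) \<in> \<beta> x" "snd (rep a) \<in> \<beta> x" by (auto simp: In_def)
    have "fst a = x" "snd a = x"
      using uniq[OF aVM(1)[OF ax(1)] ax(2) _ ax(3)] uniq[OF aVM(2)[OF ax(1)] ax(2) _ ax(4)] rep ax(1) by blast+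
    then show False using aVM(3)[OF ax(1)] by simp
  qed
  define W where "W e = (if e \<in> In then K else if e \<in> rep ` EM then WM (the_inv_into EM rep e) else 0)" for e
  have objective: "(\<Sum>e\<in>E. W e * f e) = K * (\<Sum>e\<in>In. f e) + (\<Sum>a\<in>EM. WM a * f (rep a))" for f :: "'v \<times> 'v \<Rightarrow> real"
  proof -
    have sub: "In \<union> rep ` EM \<subseteq> E" using rep by (auto simp: In_def)
    have "(\<Sum>e\<in>E. W e * f e) = (\<Sum>e\<in>In \<union> rep ` EM. W e * f e)"
      by (rule sum.mono_neutral_right[OF E sub]) (auto simp: W_def)
    also have "\<dots> = (\<Sum>e\<in>In. W e * f e) + (\<Sum>e\<in>rep ` EM. W e * f e)"
      by (rule sum.union_disjoint[OF fIn _ dj]) (use EM(1) in simp)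
    also have "(\<Sum>e\<in>In. W e * f e) = K * (\<Sum>e\<in>In. f e)" by (simp add: W_def sum_distrib_left)
    also have "(\<Sum>e\<in>rep ` EM. W e * f e) = (\<Sum>a\<in>EM. W (rep a) * f (rep a))" by (simp add: sum.reindex[OF inj])
    also have "\<dots> = (\<Sum>a\<in>EM. WM a * f (rep a))"
    proof (rule sum.cong[OF refl])
      fix a assume a: "a \<in> EM"
      then have "rep a \<notin> In" using dj by blast
      then show "W (rep a) * f (rep a) = WM a * f (rep a)" using a by (simp add: W_def the_inv_into_f_f[OF inj])
    qed
    finally show ?thesis .
  qed
  obtain z :: "'v \<Rightarrow> complex" where z: "\<forall>v\<in>V. norm (z v) = 1" "\<forall>Y :: 'v \<Rightarrow> 'w. (\<forall>v\<in>V. norm (Y v) = 1) \<longrightarrow>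
          (\<Sum>e\<in>E. W e * inner (Y (fst e)) (Y (snd e))) \<le> (\<Sum>e\<in>E. W e * inner (z (fst e)) (z (snd e)))"
    using planar[of W] by blast
  obtain b0 :: 'w where b0: "b0 \<in> Basis" using nonempty_Basis by blast
  \<comment> \<open>the configuration \<open>y\<close> of the minor, spread over the branch sets; nodes outside of them get any unit vector\<close>
  define Y where "Y v = (if \<exists>x\<in>VM. v \<in> \<beta> x then y (SOME x. x \<in> VM \<and> v \<in> \<beta> x) else b0)" for v
  have Yb: "Y v = y x" if x: "x \<in> VM" "v \<in> \<beta> x" for v x
  proof -
    have "\<exists>x. x \<in> VM \<and> v \<in> \<beta> x" using x by blast
    from someI_ex[OF this] have "(SOME x. x \<in> VM \<and> v \<in> \<beta> x) = x" using uniq x by blast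
    then show ?thesis using x by (auto simp: Y_def)
  qed
  have nY: "norm (Y v) = 1" for v
  proof (cases "\<exists>x\<in>VM. v \<in> \<beta> x")
    case True
    then obtain x where "x \<in> VM" "v \<in> \<beta> x" by blast
    then show ?thesis using Yb y by simp
  next
    case False then show ?thesis using b0 by (simp add: Y_def)
  qed
  define vm where "vm = (\<Sum>a\<in>EM. WM a * inner (y (fst a)) (y (snd a)))"
  have vY: "(\<Sum>e\<in>E. W e * inner (Y (fst e)) (Y (snd e))) = K * real (card In) + vm"
  proof -
    have "inner (Y (fst e)) (Y (snd e)) = 1" if "e \<in> In" for e
    proof -
      obtain x where "x \<in> VM" "fst e \<in> \<beta> x" "snd e \<in> \<beta> x" using \<open>e \<in> In\<close> by (auto simp: In_def)
      then show ?thesis using Yb y[of x] by (simp add: norm_eq_1)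
    qed
    then have "(\<Sum>e\<in>In. inner (Y (fst e)) (Y (snd e))) = real (card In)" by simp
    moreover have "(\<Sum>a\<in>EM. WM a * inner (Y (fst (rep a))) (Y (snd (rep a)))) = vm"
      unfolding vm_def
    proof (rule sum.cong[OF refl])
      fix a assume a: "a \<in> EM"
      have "Y (fst (rep a)) = y (fst a)" "Y (snd (rep a)) = y (snd a)"
        using Yb[OF aVM(1)[OF a]] Yb[OF aVM(2)[OF a]] rep a by auto
      then show "WM a * inner (Y (fst (rep a))) (Y (snd (rep a))) = WM a * inner (y (fst a)) (y (snd a))" by simp
    qed
    ultimately show ?thesis unfolding objective by simp
  qed
  define T where "T = (\<Sum>e\<in>In. (norm (z (fst e) - z (snd e)))\<^sup>2)"
  define t where "t = sqrt T"
  have T0: "T \<ge> 0" by (simp add: T_def sum_nonneg)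
  have nz: "norm (z (fst e)) = 1" "norm (z (snd e)) = 1" if "e \<in> E" for e using z(1) EV that by auto
  have zIn: "(\<Sum>e\<in>In. inner (z (fst e)) (z (snd e))) = real (card In) - T / 2"
  proof -
    have "(\<Sum>e\<in>In. inner (z (fst e)) (z (snd e))) = (\<Sum>e\<in>In. 1 - (norm (z (fst e) - z (snd e)))\<^sup>2 / 2)"
      by (rule sum.cong[OF refl]) (use nz in \<open>auto simp: In_def intro!: unit_inner_dist\<close>)
    then show ?thesis by (simp add: sum_subtractf T_def sum_divide_distrib)
  qed
  have dIn: "norm (z (fst e) - z (snd e)) \<le> t" if e: "e \<in> In" for e
  proof -
    have "(norm (z (fst e) - z (snd e)))\<^sup>2 \<le> T"
      unfolding T_def by (rule member_le_sum[OF e _ fIn]) simp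
    then show ?thesis unfolding t_def by (rule real_le_rsqrt)
  qed
  have t0: "t \<ge> 0" using T0 by (simp add: t_def)
  define r where "r x = (SOME v. v \<in> \<beta> x)" for x
  have r: "r x \<in> \<beta> x" if "x \<in> VM" for x unfolding r_def using M(1)[OF that] by (simp add: some_in_eq)
  have near: "norm (z v - z (r x)) \<le> N * t" if x: "x \<in> VM" "v \<in> \<beta> x" for x v
  proof -
    let ?R = "E \<inter> \<beta> x \<times> \<beta> x"
    have "(v, r x) \<in> ?R\<^sup>*" by (rule linkedD[OF M(3)[OF x(1)] x(2) r[OF x(1)]])
    moreover have fR: "finite ?R" using E by simp
    ultimately obtain n where n: "n \<le> card ?R" "(v, r x) \<in> ?R ^^ n" by (auto simp: rtrancl_finite_eq_relpow)
    have "norm (z v - z (r x)) \<le> real n * t"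
    proof (rule relpow_norm_bound[OF n(2)])
      fix p q assume "(p, q) \<in> ?R"
      then have "(p, q) \<in> In" using x(1) by (auto simp: In_def)
      from dIn[OF this] show "norm (z p - z q) \<le> t" by simp
    qed
    also have "n \<le> card E" using n(1) card_mono[OF E, of ?R] by simp
    then have "real n * t \<le> N * t" using t0 by (intro mult_right_mono) (simp_all add: N_def)
    finally show ?thesis .
  qed
  define \<zeta> where "\<zeta> x = z (r x)" for x
  have n\<zeta>: "norm (\<zeta> x) = 1" if "x \<in> VM" for x using z(1) r[OF that] M(2)[OF that] by (auto simp: \<zeta>_def)
  define vz where "vz = (\<Sum>a\<in>EM. WM a * inner (\<zeta> (fst a)) (\<zeta> (snd a)))"
  have "(\<Sum>a\<in>EM. WM a * inner (z (fst (rep a))) (z (snd (rep a)))) - vz \<le> A * t"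
  proof -
    have "(\<Sum>a\<in>EM. WM a * inner (z (fst (rep a))) (z (snd (rep a)))) - vz =
        (\<Sum>a\<in>EM. WM a * (inner (z (fst (rep a))) (z (snd (rep a))) - inner (\<zeta> (fst a)) (\<zeta> (snd a))))"
      by (simp add: vz_def sum_subtractf right_diff_distrib)
    also have "\<dots> \<le> (\<Sum>a\<in>EM. \<bar>WM a\<bar> * (2 * (N * t)))"
    proof (rule sum_mono)
      fix a assume a: "a \<in> EM"
      let ?p = "z (fst (rep a))" and ?q = "z (snd (rep a))" and ?p' = "\<zeta> (fst a)" and ?q' = "\<zeta> (snd a)"
      have re: "rep a \<in> E" "fst (rep a) \<in> \<beta> (fst a)" "snd (rep a) \<in> \<beta> (snd a)" using rep a by auto
      have d: "norm (?p - ?p') \<le> N * t" "norm (?q - ?q') \<le> N * t"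
        unfolding \<zeta>_def by (rule near[OF aVM(1)[OF a] re(2)], rule near[OF aVM(2)[OF a] re(3)])
      have "inner ?p ?q - inner ?p' ?q' \<le> 2 * (N * t)"
        using inner_perturb[of ?p ?q' ?q ?p', OF nz(1)[OF re(1)] n\<zeta>[OF aVM(2)[OF a]]] d by simp
      moreover have "inner ?p' ?q' - inner ?p ?q \<le> 2 * (N * t)"
        using inner_perturb[of ?p' ?q ?q' ?p, OF n\<zeta>[OF aVM(1)[OF a]] nz(2)[OF re(1)]] d
        by (simp add: norm_minus_commute)
      ultimately have ab: "\<bar>inner ?p ?q - inner ?p' ?q'\<bar> \<le> 2 * (N * t)" by (simp add: abs_le_iff)
      have "WM a * (inner ?p ?q - inner ?p' ?q') \<le> \<bar>WM a\<bar> * \<bar>inner ?p ?q - inner ?p' ?q'\<bar>"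
        by (metis abs_ge_self abs_mult)
      also have "\<dots> \<le> \<bar>WM a\<bar> * (2 * (N * t))" by (rule mult_left_mono[OF ab]) simp
      finally show "WM a * (inner ?p ?q - inner ?p' ?q') \<le> \<bar>WM a\<bar> * (2 * (N * t))" .
    qed
    also have "\<dots> = C * (2 * (N * t))" unfolding C_def by (rule sum_distrib_right[symmetric])
    also have "\<dots> = A * t" by (simp add: A_def)
    finally show ?thesis .
  qed
  moreover have "vz + \<epsilon> \<le> vm" unfolding vz_def vm_def by (rule gap) (rule n\<zeta>)
  moreover have "K * real (card In) + vm \<le> K * (real (card In) - T / 2) + (\<Sum>a\<in>EM. WM a * inner (z (fst (rep a))) (z (snd (rep a))))"
  proof -
    have "(\<Sum>e\<in>E. W e * inner (Y (fst e)) (Y (snd e))) \<le> (\<Sum>e\<in>E. W e * inner (z (fst e)) (z (snd e)))"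
      using z(2) nY by blast
    then show ?thesis unfolding vY objective zIn .
  qed
  ultimately have "\<epsilon> + K * T / 2 \<le> A * t" by (simp add: algebra_simps)
  moreover have "T = t\<^sup>2" using T0 by (simp add: t_def)
  ultimately have "\<epsilon> + (A\<^sup>2 / \<epsilon> + 1) * t\<^sup>2 / 2 - A * t \<le> 0" by (simp add: K_def)
  moreover have "\<epsilon> + (A\<^sup>2 / \<epsilon> + 1) * t\<^sup>2 / 2 - A * t = ((A * t - \<epsilon>)\<^sup>2 + \<epsilon>\<^sup>2) / (2 * \<epsilon>) + t\<^sup>2 / 2"
    using eps by (simp add: field_simps power2_eq_square)
  moreover have "((A * t - \<epsilon>)\<^sup>2 + \<epsilon>\<^sup>2) / (2 * \<epsilon>) > 0"
    using eps by (intro divide_pos_pos add_nonneg_pos) simp_all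
  moreover have "t\<^sup>2 / 2 \<ge> 0" by simp
  ultimately show False by linarith
qed

text \<open>
  For given \<open>a\<close> and \<open>b\<close> the best \<open>d\<close> is the direction of
  \<open>a + b\<close>, with the value \<open>\<surd>2 \<bar>a + b\<bar> - x = 2 \<surd>(1 + x) -
  x\<close> for \<open>x = inner a b\<close>. This is maximal exactly at \<open>x = 0\<close>, so an
  ear rewards orthogonality of the nodes that it spans. The loss is \<open>x\<^sup>2 / 4\<close> to
  second order; with the factor \<open>1 / 6\<close> the bound holds on the whole interval
  \<open>[-1, 1]\<close>.
\<close>

lemma ear_bound:
  fixes a b d :: "'v::real_inner"
  assumes "norm a = 1" "norm b = 1" "norm d = 1"
  shows "sqrt 2 * (inner a d + inner b d) - inner a b \<le> 2 - (inner a b)\<^sup>2 / 6"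
proof -
  define x where "x = inner a b"
  have x: "\<bar>x\<bar> \<le> 1" using Cauchy_Schwarz_ineq2[of a b] assms by (simp add: x_def)
  have "inner a a = 1" "inner b b = 1" using assms by (simp_all add: norm_eq_1)
  then have n: "(norm (a + b))\<^sup>2 = 2 + 2 * x"
    unfolding power2_norm_eq_inner by (simp add: inner_add_left inner_add_right inner_commute[of b a] x_def)
  have x2: "x\<^sup>2 \<le> 1" using x by (simp add: abs_square_le_1)
  have "inner a d + inner b d \<le> norm (a + b)" using norm_cauchy_schwarz[of "a + b" d] assms by (simp add: inner_add_left)
  then have "sqrt 2 * (inner a d + inner b d) \<le> sqrt 2 * norm (a + b)" by simp
  also have "\<dots> \<le> 2 + x - x\<^sup>2 / 6"
  proof (rule power2_le_imp_le)
    have "(sqrt 2 * norm (a + b))\<^sup>2 = 4 + 4 * x" using n by (simp add: power_mult_distrib)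
    moreover have "(2 + x - x\<^sup>2 / 6)\<^sup>2 - (4 + 4 * x) = x\<^sup>2 * (1/3 - x / 3 + x\<^sup>2 / 36)"
      by (simp add: power2_eq_square field_simps)
    moreover have "0 \<le> x\<^sup>2 * (1/3 - x / 3 + x\<^sup>2 / 36)" using x by (intro mult_nonneg_nonneg add_nonneg_nonneg) auto
    ultimately show "(sqrt 2 * norm (a + b))\<^sup>2 \<le> (2 + x - x\<^sup>2 / 6)\<^sup>2" by linarith
    show "0 \<le> 2 + x - x\<^sup>2 / 6" using x x2 by auto
  qed
  finally show ?thesis by (simp add: x_def)
qed

text \<open>
  Three vectors in the plane cannot be pairwise orthogonal. Doubling the angles turns \<open>2
  (inner a b)\<^sup>2 - 1\<close> into the inner product of the doubled unit vectors \<open>(u a, v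
  a)\<close> and \<open>(u b, v b)\<close>, and the sum of three unit vectors has nonnegative
  square.
\<close>

lemma three_planar_units:
  fixes a b c :: complex
  assumes "norm a = 1" "norm b = 1" "norm c = 1"
  shows "(inner a b)\<^sup>2 + (inner a c)\<^sup>2 + (inner b c)\<^sup>2 \<ge> 3 / 4"
proof -
  define u where "u z = (Re z)\<^sup>2 - (Im z)\<^sup>2" for z
  define v where "v z = 2 * Re z * Im z" for z
  have n: "(Re z)\<^sup>2 + (Im z)\<^sup>2 = 1" if "norm z = 1" for z using that by (simp add: cmod_def)
  have uv: "(u z)\<^sup>2 + (v z)\<^sup>2 = 1" if "norm z = 1" for z
  proof -
    have "(u z)\<^sup>2 + (v z)\<^sup>2 = ((Re z)\<^sup>2 + (Im z)\<^sup>2)\<^sup>2" by (simp add: u_def v_def algebra_simps power2_eq_square)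
    then show ?thesis using n[OF that] by simp
  qed
  have i: "(inner z w)\<^sup>2 = (1 + u z * u w + v z * v w) / 2" if "norm z = 1" "norm w = 1" for z w
  proof -
    have "2 * (inner z w)\<^sup>2 = ((Re z)\<^sup>2 + (Im z)\<^sup>2) * ((Re w)\<^sup>2 + (Im w)\<^sup>2) + u z * u w + v z * v w"
      by (simp add: u_def v_def inner_complex_def algebra_simps power2_eq_square)
    then show ?thesis using n[OF that(1)] n[OF that(2)] by simp
  qed
  have "(u a + u b + u c)\<^sup>2 + (v a + v b + v c)\<^sup>2 =
      ((u a)\<^sup>2 + (v a)\<^sup>2) + ((u b)\<^sup>2 + (v b)\<^sup>2) + ((u c)\<^sup>2 + (v c)\<^sup>2)
      + 2 * (u a * u b + v a * v b + (u a * u c + v a * v c) + (u b * u c + v b * v c))" by (simp add: algebra_simps power2_eq_square)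
  also have "\<dots> = 3 + 2 * (u a * u b + v a * v b + (u a * u c + v a * v c) + (u b * u c + v b * v c))"
    using uv assms by simp
  finally have "0 \<le> 3 + 2 * (u a * u b + v a * v b + (u a * u c + v a * v c) + (u b * u c + v b * v c))"
    by (metis add_nonneg_nonneg zero_le_power2)
  then show ?thesis unfolding i[OF assms(1,2)] i[OF assms(1,3)] i[OF assms(2,3)] by (simp add: field_simps)
qed

text \<open>
  One orientation of each edge. The optimal configuration is an orthonormal basis at the triangle
  with the normalised sums of the basis vectors at the ears.
\<close>

definition F3_arcs :: "(nat \<times> nat) set" where
  "F3_arcs = {(1, 2), (1, 3), (2, 3), (1, 12), (2, 12), (1, 13), (3, 13), (2, 23), (3, 23)}"

definition F3_weight :: "nat \<times> nat \<Rightarrow> real" where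
  "F3_weight a = (if snd a > 3 then sqrt 2 else -1)"

definition F3_config :: "nat \<Rightarrow> complex \<times> real" where
  "F3_config i = (if i = 1 then (1, 0) else if i = 2 then (\<i>, 0) else if i = 3 then (0, 1)
     else if i = 12 then (Complex (1 / sqrt 2) (1 / sqrt 2), 0)
     else if i = 13 then (Complex (1 / sqrt 2) 0, 1 / sqrt 2) else (Complex 0 (1 / sqrt 2), 1 / sqrt 2))"

lemma half_sqrt2: "(1 / sqrt 2)\<^sup>2 = (1 / 2 :: real)" "sqrt 2 * (1 / sqrt 2) = 1"
  by (simp_all add: power_divide)

lemma norm_F3_config: "norm (F3_config i) = 1"
  by (simp add: F3_config_def norm_prod_def cmod_def half_sqrt2 del: power_divide power_one_over)

lemma F3_config_value:
  "(\<Sum>a\<in>F3_arcs. F3_weight a * inner (F3_config (fst a)) (F3_config (snd a))) = 6"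
  by (simp add: F3_arcs_def F3_weight_def F3_config_def inner_complex_def half_sqrt2)

text \<open>
  The objective is a sum of three ears, one over each edge of the triangle.
\<close>

lemma F3_gap:
  fixes z :: "nat \<Rightarrow> complex"
  assumes "\<And>i. i \<in> {1, 2, 3, 12, 13, 23} \<Longrightarrow> norm (z i) = 1"
  shows "(\<Sum>a\<in>F3_arcs. F3_weight a * inner (z (fst a)) (z (snd a))) + 1 / 8 \<le> 6"
proof -
  have n: "norm (z 1) = 1" "norm (z 2) = 1" "norm (z 3) = 1" "norm (z 12) = 1" "norm (z 13) = 1" "norm (z 23) = 1"
    using assms by auto
  have "(\<Sum>a\<in>F3_arcs. F3_weight a * inner (z (fst a)) (z (snd a))) =
     (sqrt 2 * (inner (z 1) (z 12) + inner (z 2) (z 12)) - inner (z 1) (z 2)) +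
     (sqrt 2 * (inner (z 1) (z 13) + inner (z 3) (z 13)) - inner (z 1) (z 3)) +
     (sqrt 2 * (inner (z 2) (z 23) + inner (z 3) (z 23)) - inner (z 2) (z 3))"
    by (simp add: F3_arcs_def F3_weight_def algebra_simps)
  also have "\<dots> \<le> 6 - ((inner (z 1) (z 2))\<^sup>2 + (inner (z 1) (z 3))\<^sup>2 + (inner (z 2) (z 3))\<^sup>2) / 6"
    using add_mono[OF add_mono[OF ear_bound[OF n(1,2,4)] ear_bound[OF n(1,3,5)]] ear_bound[OF n(2,3,6)]]
    by (rule order_trans) (simp add: field_simps)
  also have "\<dots> \<le> 6 - 1 / 8" using three_planar_units[OF n(1-3)] by argo
  finally show ?thesis by linarith
qed

text \<open>
  Again the configuration puts an orthonormal basis at the nodes 1, 2, 3. The node 13 sits at the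
  normalised negative sum of the basis, and the two subdivided edges act as ears, here on \<open>1,
  -2\<close> and \<open>2, -3\<close>.
\<close>

definition H3_arcs :: "(nat \<times> nat) set" where
  "H3_arcs = {(1, 3), (1, 13), (3, 13), (2, 13), (1, 12), (2, 12), (2, 23), (3, 23)}"

definition H3_weight :: "nat \<times> nat \<Rightarrow> real" where
  "H3_weight a = (if a = (1, 3) then -2 else if snd a = 13 then - 2 * sqrt 3
     else if a = (1, 12) \<or> a = (2, 23) then 2 * sqrt 2 else - 2 * sqrt 2)"

definition H3_config :: "nat \<Rightarrow> complex \<times> real" where
  "H3_config i = (if i = 1 then (1, 0) else if i = 2 then (\<i>, 0) else if i = 3 then (0, 1)
     else if i = 12 then (Complex (1 / sqrt 2) (- 1 / sqrt 2), 0)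
     else if i = 13 then (Complex (- 1 / sqrt 3) (- 1 / sqrt 3), - 1 / sqrt 3) else (Complex 0 (1 / sqrt 2), - 1 / sqrt 2))"

lemma norm_H3_config: "norm (H3_config i) = 1"
  by (simp add: H3_config_def norm_prod_def cmod_def power_divide)

lemma H3_config_value:
  "(\<Sum>a\<in>H3_arcs. H3_weight a * inner (H3_config (fst a)) (H3_config (snd a))) = 14"
  by (simp add: H3_arcs_def H3_weight_def H3_config_def inner_complex_def)

text \<open>
  The Gram determinant of three vectors in the plane is zero.
\<close>

lemma planar_gram_det:
  fixes a b c :: complex
  assumes "norm a = 1" "norm b = 1" "norm c = 1"
  shows "(inner a c)\<^sup>2 = 1 + 2 * inner a b * inner a c * inner b c - (inner a b)\<^sup>2 - (inner b c)\<^sup>2"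
proof -
  have n: "(Re z)\<^sup>2 + (Im z)\<^sup>2 = 1" if "norm z = 1" for z using that by (simp add: cmod_def)
  have na: "(Re a)\<^sup>2 + (Im a)\<^sup>2 = 1" and nb: "(Re b)\<^sup>2 + (Im b)\<^sup>2 = 1" and nc: "(Re c)\<^sup>2 + (Im c)\<^sup>2 = 1"
    using n assms by auto
  have "((Re a)\<^sup>2 + (Im a)\<^sup>2) * ((Re b)\<^sup>2 + (Im b)\<^sup>2) * ((Re c)\<^sup>2 + (Im c)\<^sup>2)
      + 2 * inner a b * inner a c * inner b c
      - ((Re c)\<^sup>2 + (Im c)\<^sup>2) * (inner a b)\<^sup>2 - ((Re b)\<^sup>2 + (Im b)\<^sup>2) * (inner a c)\<^sup>2
      - ((Re a)\<^sup>2 + (Im a)\<^sup>2) * (inner b c)\<^sup>2 = 0"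
    by (simp add: inner_complex_def algebra_simps power2_eq_square)
  then show ?thesis unfolding na nb nc by simp
qed

text \<open>
  If the left-hand side were tiny, then \<open>a\<close> and \<open>c\<close> would both be almost
  orthogonal to \<open>b\<close>, hence almost parallel to each other in the plane, so
  \<open>\<bar>inner a c\<bar>\<close> would be close to 1. But \<open>a + b + c\<close> has norm
  close to \<open>\<surd>3\<close>, which forces \<open>inner a c\<close> close to 0. The numbers in
  the proof are a crude version of this; any positive bound suffices.
\<close>

lemma four_planar_units:
  fixes a b c d :: complex
  assumes n: "norm a = 1" "norm b = 1" "norm c = 1" "norm d = 1"
  shows "(norm (a + b + c + sqrt 3 *\<^sub>R d))\<^sup>2 + ((inner a b)\<^sup>2 + (inner b c)\<^sup>2) / 3 \<ge> 1 / 300"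
proof (rule ccontr)
  assume "\<not> ?thesis"
  then have lt: "(norm (a + b + c + sqrt 3 *\<^sub>R d))\<^sup>2 + ((inner a b)\<^sup>2 + (inner b c)\<^sup>2) / 3 < 1 / 300" by simp
  define x y s where "x = inner a b" and "y = inner b c" and "s = inner a c"
  define \<delta> where "\<delta> = norm (a + b + c + sqrt 3 *\<^sub>R d)"
  define R where "R = norm (a + b + c)"
  have pos: "0 \<le> x\<^sup>2" "0 \<le> y\<^sup>2" "0 \<le> \<delta>\<^sup>2" by simp_all
  have xy: "x\<^sup>2 < 1 / 100" "y\<^sup>2 < 1 / 100" "\<delta>\<^sup>2 < 1 / 300"
  proof -
    have "\<delta>\<^sup>2 + (x\<^sup>2 + y\<^sup>2) / 3 < 1 / 300" using lt by (simp only: x_def y_def \<delta>_def)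
    then show "x\<^sup>2 < 1 / 100" "y\<^sup>2 < 1 / 100" "\<delta>\<^sup>2 < 1 / 300" using pos by argo+
  qed
  have small: "\<bar>t\<bar> < 1 / 10" if "t\<^sup>2 < 1 / 100" for t :: real
    by (rule power2_less_imp_less) (use that in \<open>simp_all add: power_divide\<close>)
  have ax: "\<bar>x\<bar> < 1 / 10" "\<bar>y\<bar> < 1 / 10" using small xy by auto
  have d: "\<delta> < 6 / 100" using xy(3) by (intro power2_less_imp_less[of \<delta> "6/100"]) (auto simp: power_divide)
  have d0: "\<delta> \<ge> 0" by (simp add: \<delta>_def)
  have det: "s\<^sup>2 = 1 + 2 * x * s * y - x\<^sup>2 - y\<^sup>2"
    unfolding x_def y_def s_def by (rule planar_gram_det[OF n(1-3)])
  have s1: "\<bar>s\<bar> \<le> 1" using Cauchy_Schwarz_ineq2[of a c] n by (simp add: s_def)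
  have "\<bar>x * y\<bar> \<le> 1 / 10 * (1 / 10)" unfolding abs_mult using ax by (intro mult_mono) auto
  then have "\<bar>x * y\<bar> * \<bar>s\<bar> \<le> 1 / 100 * 1" using s1 by (intro mult_mono) auto
  then have "\<bar>x * s * y\<bar> \<le> 1 / 100" by (simp add: abs_mult mult_ac)
  then have s2: "s\<^sup>2 \<ge> 96 / 100" using det xy by linarith
  have nn: "inner a a = 1" "inner b b = 1" "inner c c = 1" using n by (simp_all add: norm_eq_1)
  have R2: "R\<^sup>2 = 3 + 2 * (x + y + s)"
    unfolding R_def power2_norm_eq_inner
    by (simp add: inner_add_left inner_add_right nn x_def y_def s_def inner_commute[of b a] inner_commute[of c b] inner_commute[of c a])
  have R0: "R \<ge> 0" by (simp add: R_def)
  have nd: "norm (sqrt 3 *\<^sub>R d) = sqrt 3" using n(4) by simp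
  have Rd: "\<bar>R - sqrt 3\<bar> \<le> \<delta>"
    using norm_triangle_ineq3[of "a + b + c" "- (sqrt 3 *\<^sub>R d)"] nd by (simp add: R_def \<delta>_def)
  have s3: "sqrt 3 < 174 / 100" by (rule real_less_lsqrt) (auto simp: power_divide)
  have "\<bar>R\<^sup>2 - 3\<bar> = \<bar>R - sqrt 3\<bar> * (R + sqrt 3)"
  proof -
    have "R\<^sup>2 - 3 = (R - sqrt 3) * (R + sqrt 3)" by (simp add: algebra_simps power2_eq_square)
    then show ?thesis using R0 by (simp add: abs_mult)
  qed
  also have "\<dots> \<le> 6 / 100 * (36 / 10)"
    using Rd d s3 R0 by (intro mult_mono) auto
  finally have h: "\<bar>R\<^sup>2 - 3\<bar> \<le> 6 / 100 * (36 / 10)" .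
  have "R\<^sup>2 - 3 \<le> 6 / 100 * (36 / 10)" "- (R\<^sup>2 - 3) \<le> 6 / 100 * (36 / 10)"
    by (rule abs_le_D1[OF h], rule abs_le_D2[OF h])
  moreover note R2
  moreover have "x < 1 / 10" "- (1 / 10) < x" "y < 1 / 10" "- (1 / 10) < y" using ax by (simp_all add: abs_less_iff)
  ultimately have "s \<le> 4 / 10" "- s \<le> 4 / 10" by argo+
  then have "\<bar>s\<bar> \<le> 4 / 10" by (rule abs_leI)
  then have "s\<^sup>2 \<le> (4 / 10)\<^sup>2" by (metis abs_ge_zero power2_abs power_mono)
  then show False using s2 by (simp add: power_divide)
qed

lemma norm_sum4:
  fixes a b c d :: "'v::real_inner"
  assumes "norm a = 1" "norm b = 1" "norm c = 1" "norm d = 1"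
  shows "(norm (a + b + c + sqrt 3 *\<^sub>R d))\<^sup>2 =
    6 + 2 * (inner a b + inner b c + inner a c) + 2 * sqrt 3 * (inner a d + inner b d + inner c d)"
proof -
  have nn: "inner a a = 1" "inner b b = 1" "inner c c = 1" "inner d d = 1" using assms by (simp_all add: norm_eq_1)
  show ?thesis
    unfolding power2_norm_eq_inner
    by (simp add: inner_add_left inner_add_right nn inner_commute[of b a] inner_commute[of c b] inner_commute[of c a]
       inner_commute[of d a] inner_commute[of d b] inner_commute[of d c] algebra_simps)
qed

text \<open>
  The terms without ears complete a square: together with the inner products that the two ears add,
  they are \<open>6 - \<bar>a + b + c + \<surd>3 d\<bar>\<^sup>2\<close>.
\<close>

lemma H3_gap:
  fixes z :: "nat \<Rightarrow> complex"
  assumes "\<And>i. i \<in> {1, 2, 3, 12, 13, 23} \<Longrightarrow> norm (z i) = 1"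
  shows "(\<Sum>a\<in>H3_arcs. H3_weight a * inner (z (fst a)) (z (snd a))) + 1 / 300 \<le> 14"
proof -
  let ?a = "z 1" and ?b = "z 2" and ?c = "z 3" and ?d = "z 13" and ?e = "z 12" and ?f = "z 23"
  have n: "norm ?a = 1" "norm ?b = 1" "norm ?c = 1" "norm ?d = 1" "norm ?e = 1" "norm ?f = 1"
    using assms by auto
  have nb: "norm (- ?b) = 1" "norm (- ?c) = 1" using n by simp_all
  note sq = norm_sum4[OF n(1-4)]
  have "(\<Sum>a\<in>H3_arcs. H3_weight a * inner (z (fst a)) (z (snd a))) =
     2 * (sqrt 2 * (inner ?a ?e + inner (- ?b) ?e)) + 2 * (sqrt 2 * (inner ?b ?f + inner (- ?c) ?f))
     - 2 * inner ?a ?c - 2 * sqrt 3 * (inner ?a ?d + inner ?b ?d + inner ?c ?d)"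
    by (simp add: H3_arcs_def H3_weight_def algebra_simps)
  also have "\<dots> \<le> 8 - 2 * inner ?a ?b - 2 * inner ?b ?c - ((inner ?a ?b)\<^sup>2 + (inner ?b ?c)\<^sup>2) / 3
     - 2 * inner ?a ?c - 2 * sqrt 3 * (inner ?a ?d + inner ?b ?d + inner ?c ?d)"
  proof -
    have "sqrt 2 * (inner ?a ?e + inner (- ?b) ?e) + inner ?a ?b \<le> 2 - (inner ?a ?b)\<^sup>2 / 6"
      "sqrt 2 * (inner ?b ?f + inner (- ?c) ?f) + inner ?b ?c \<le> 2 - (inner ?b ?c)\<^sup>2 / 6"
      using ear_bound[OF n(1) nb(1) n(5)] ear_bound[OF n(2) nb(2) n(6)] by simp_all
    then show ?thesis by argo
  qed
  also have "\<dots> = 14 - ((norm (?a + ?b + ?c + sqrt 3 *\<^sub>R ?d))\<^sup>2 + ((inner ?a ?b)\<^sup>2 + (inner ?b ?c)\<^sup>2) / 3)"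
    unfolding sq by (simp add: algebra_simps)
  also have "\<dots> \<le> 14 - 1 / 300" using four_planar_units[OF n(1-4)] by linarith
  finally show ?thesis by linarith
qed

section \<open>The semidefinite program\<close>

lemma sdp_feasible_psd_on:
  assumes "X \<in> sdp_feasible n"
  shows "psd_on {..<n} (\<lambda>i j. X $$ (i, j))" "i < n \<Longrightarrow> X $$ (i, i) = 1"
proof -
  have X: "X \<in> carrier_mat n n" "psd X" "\<And>i. i < n \<Longrightarrow> X $$ (i, i) = 1"
    using assms by (auto simp: sdp_feasible_def)
  show "i < n \<Longrightarrow> X $$ (i, i) = 1" by (rule X(3))
  show "psd_on {..<n} (\<lambda>i j. X $$ (i, j))"
    unfolding psd_on_def
  proof (intro conjI ballI allI)
    fix i j assume "i \<in> {..<n}" "j \<in> {..<n}"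
    then have "X\<^sup>T $$ (i, j) = X $$ (j, i)" using X(1) by simp
    then show "X $$ (i, j) = X $$ (j, i)" using X(2) by (simp add: psd_def)
  next
    fix a :: "nat \<Rightarrow> real"
    let ?v = "Matrix.vec n a"
    have "0 \<le> scalar_prod ?v (X *\<^sub>v ?v)" using X(1,2) by (simp add: psd_def)
    also have "scalar_prod ?v (X *\<^sub>v ?v) = (\<Sum>i<n. a i * (\<Sum>j<n. X $$ (i, j) * a j))"
      using X(1) by (simp add: scalar_prod_def atLeast0LessThan)
    also have "\<dots> = (\<Sum>i<n. \<Sum>j<n. a i * a j * X $$ (i, j))"
      by (simp add: sum_distrib_left mult_ac)
    finally show "0 \<le> (\<Sum>i<n. \<Sum>j<n. a i * a j * X $$ (i, j))" .
  qed
qed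

lemma sdp_feasible_of_psd_on:
  assumes "psd_on {..<n} k" "\<And>i. i < n \<Longrightarrow> k i i = 1"
  shows "Matrix.mat n n (\<lambda>(i, j). k i j) \<in> sdp_feasible n"
proof -
  let ?X = "Matrix.mat n n (\<lambda>(i, j). k i j)"
  have "?X\<^sup>T = ?X"
  proof (rule eq_matI)
    fix i j assume "i < dim_row ?X" "j < dim_col ?X"
    then show "?X\<^sup>T $$ (i, j) = ?X $$ (i, j)" using assms(1) by (simp add: psd_on_def)
  qed auto
  moreover have "0 \<le> scalar_prod v (?X *\<^sub>v v)" if v: "v \<in> carrier_vec n" for v
  proof -
    have "scalar_prod v (?X *\<^sub>v v) = (\<Sum>i<n. v $ i * (\<Sum>j<n. k i j * v $ j))"
      using v by (auto simp: scalar_prod_def atLeast0LessThan intro!: sum.cong)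
    also have "\<dots> = (\<Sum>i<n. \<Sum>j<n. v $ i * v $ j * k i j)"
      by (simp add: sum_distrib_left mult_ac)
    finally show ?thesis using assms(1) by (simp add: psd_on_def)
  qed
  ultimately have "psd ?X" by (simp add: psd_def square_mat.simps)
  then show ?thesis using assms(2) by (auto simp: sdp_feasible_def)
qed

lemma psd_on_inner:
  fixes y :: "'i \<Rightarrow> 'v::real_inner"
  assumes "finite S"
  shows "psd_on S (\<lambda>i j. inner (y i) (y j))"
  unfolding psd_on_def
proof (intro conjI ballI allI)
  fix a :: "'i \<Rightarrow> real"
  have "(\<Sum>i\<in>S. \<Sum>j\<in>S. a i * a j * inner (y i) (y j)) = inner (\<Sum>i\<in>S. a i *\<^sub>R y i) (\<Sum>j\<in>S. a j *\<^sub>R y j)"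
    unfolding inner_sum_left inner_sum_right inner_scaleR_left inner_scaleR_right
    by (subst sum.swap) (simp add: mult_ac inner_commute sum_distrib_left)
  then show "0 \<le> (\<Sum>i\<in>S. \<Sum>j\<in>S. a i * a j * inner (y i) (y j))" by simp
qed (rule inner_commute)

lemma sdp_feasible_inner:
  fixes y :: "nat \<Rightarrow> 'v::real_inner"
  assumes "\<And>i. i < n \<Longrightarrow> norm (y i) = 1"
  shows "Matrix.mat n n (\<lambda>(i, j). inner (y i) (y j)) \<in> sdp_feasible n"
  by (rule sdp_feasible_of_psd_on[OF psd_on_inner]) (use assms in \<open>auto simp: norm_eq_1\<close>)

lemma psd_on_entry_le_1:
  assumes "psd_on S k" "finite S" "i \<in> S" "j \<in> S" "k i i = 1" "k j j = 1"
  shows "\<bar>k i j\<bar> \<le> 1"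
proof -
  obtain f where f: "\<forall>i\<in>S. \<forall>j\<in>S. k i j = (\<Sum>l<card S. f i l * f j l)" using gram_coordinates[OF assms(2,1)] by blast
  have "(k i j)\<^sup>2 \<le> (\<Sum>l<card S. (f i l)\<^sup>2) * (\<Sum>l<card S. (f j l)\<^sup>2)"
    using f assms(3,4) Cauchy_Schwarz_ineq_sum[of "f i" "f j" "{..<card S}"] by simp
  moreover have "(\<Sum>l<card S. (f i l)\<^sup>2) = 1" "(\<Sum>l<card S. (f j l)\<^sup>2) = 1"
    using f assms(3-6) by (simp_all add: power2_eq_square)
  ultimately show ?thesis by (simp add: abs_square_le_1)
qed

text \<open>
  The feasible matrices form a compact set, as their entries are bounded by 1. Compactness is used
  for functions on all pairs of numbers, in a product of intervals, so that no topology on matrices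
  is needed.
\<close>

lemma sdp_optimal_exists:
  assumes V: "pverts G = {..<n}" and E: "finite (parcs G)" "parcs G \<subseteq> {..<n} \<times> {..<n}"
  shows "\<exists>X. sdp_optimal G w X"
proof -
  define D where "D = {e \<in> parcs G. fst e < snd e}"
  have D: "D = {(i, j) \<in> parcs G. i < j}" "finite D" "D \<subseteq> {..<n} \<times> {..<n}" using E by (auto simp: D_def)
  define Q :: "(nat \<times> nat \<Rightarrow> real) set" where "Q = {f. psd_on {..<n} (\<lambda>i j. f (i, j)) \<and> (\<forall>i<n. f (i, i) = 1)}"
  define B :: "(nat \<times> nat \<Rightarrow> real) set" where "B = PiE UNIV (\<lambda>_. {-1..1})"
  have "compactin (product_topology (\<lambda>_. euclidean) UNIV) B"
    unfolding B_def compactin_PiE by simp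
  then have cB: "compact B" by (simp add: euclidean_product_topology)
  have cont: "continuous_on UNIV (\<lambda>f :: nat \<times> nat \<Rightarrow> real. f p)" for p by simp
  have "closed Q"
  proof -
    have "Q = (\<Inter>i\<in>{..<n}. \<Inter>j\<in>{..<n}. {f. f (i, j) = f (j, i)}) \<inter>
        (\<Inter>a. {f. 0 \<le> (\<Sum>i<n. \<Sum>j<n. a i * a j * f (i, j))}) \<inter> (\<Inter>i\<in>{..<n}. {f. f (i, i) = 1})"
      by (auto simp: Q_def psd_on_def)
    moreover have "closed \<dots>"
      by (intro closed_Int closed_INT ballI closed_Collect_eq closed_Collect_le continuous_on_const
          continuous_on_sum continuous_on_mult cont)
    ultimately show ?thesis by simp
  qed
  then have "compact (B \<inter> Q)" using cB by (rule compact_Int_closed[rotated])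
  moreover have "B \<inter> Q \<noteq> {}"
  proof -
    have "psd_on {..<n} (\<lambda>i j :: nat. inner (1 :: real) 1)" by (rule psd_on_inner) simp
    then have "(\<lambda>_. 1) \<in> B \<inter> Q" by (simp add: B_def Q_def PiE_def extensional_def)
    then show ?thesis by blast
  qed
  moreover have "continuous_on (B \<inter> Q) (\<lambda>f. \<Sum>e\<in>D. w e * f e)"
    by (intro continuous_on_sum continuous_on_mult continuous_on_const continuous_on_subset[OF cont]) auto
  ultimately obtain f where f: "f \<in> B \<inter> Q" "\<forall>g\<in>B \<inter> Q. (\<Sum>e\<in>D. w e * g e) \<le> (\<Sum>e\<in>D. w e * f e)"
    using continuous_attains_sup by blast
  let ?X = "Matrix.mat n n (\<lambda>(i, j). f (i, j))"
  have X: "?X \<in> sdp_feasible n" by (rule sdp_feasible_of_psd_on) (use f in \<open>auto simp: Q_def\<close>)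
  have vX: "sdp_value G w ?X = (\<Sum>e\<in>D. w e * f e)"
    unfolding sdp_value_def D(1)[symmetric] by (rule sum.cong[OF refl]) (use D(3) in auto)
  have "sdp_value G w Y \<le> sdp_value G w ?X" if Y: "Y \<in> sdp_feasible n" for Y
  proof -
    define g where "g p = (if p \<in> {..<n} \<times> {..<n} then Y $$ p else 0)" for p
    note P = sdp_feasible_psd_on[OF Y]
    have "psd_on {..<n} (\<lambda>i j. g (i, j)) \<longleftrightarrow> psd_on {..<n} (\<lambda>i j. Y $$ (i, j))"
      unfolding psd_on_def by (simp add: g_def)
    then have "g \<in> Q" using P by (simp add: Q_def g_def)
    moreover have "g \<in> B"
    proof -
      have "\<bar>g p\<bar> \<le> 1" for p
        using psd_on_entry_le_1[OF P(1), of "fst p" "snd p"] P(2) by (cases p) (auto simp: g_def)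
      then show ?thesis by (auto simp: B_def abs_le_iff minus_le_iff)
    qed
    ultimately have "(\<Sum>e\<in>D. w e * g e) \<le> (\<Sum>e\<in>D. w e * f e)" using f(2) by blast
    moreover have "sdp_value G w Y = (\<Sum>e\<in>D. w e * g e)"
      unfolding sdp_value_def D(1)[symmetric] by (rule sum.cong[OF refl]) (use D(3) in \<open>auto simp: g_def\<close>)
    ultimately show ?thesis using vX by simp
  qed
  then show ?thesis using X V by (auto simp: sdp_optimal_def intro!: exI[of _ ?X])
qed

text \<open>
  The Gram matrix of planar vectors is the sum of two matrices of rank one, for the real and the
  imaginary parts.
\<close>

lemma rank_planar:
  fixes z :: "nat \<Rightarrow> complex"
  shows "vec_space.rank n (Matrix.mat n n (\<lambda>(i, j). inner (z i) (z j))) \<le> 2"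
proof -
  interpret vec_space "TYPE(real)" n .
  let ?A = "Matrix.mat n n (\<lambda>(i, j). Re (z i) * Re (z j))" and ?B = "Matrix.mat n n (\<lambda>(i, j). Im (z i) * Im (z j))"
  have "Matrix.mat n n (\<lambda>(i, j). inner (z i) (z j)) = ?A + ?B"
    by (rule eq_matI) (auto simp: inner_complex_def)
  moreover have "rank (?A + ?B) \<le> rank ?A + rank ?B" by (rule rank_subadditive) auto
  moreover have "rank ?A \<le> 1" by (rule rank_le_1_product_entries[of _ n "\<lambda>i. Re (z i)" "\<lambda>i. Re (z i)"]) auto
  moreover have "rank ?B \<le> 1" by (rule rank_le_1_product_entries[of _ n "\<lambda>i. Im (z i)" "\<lambda>i. Im (z i)"]) auto
  ultimately show ?thesis by simp
qed

text \<open>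
  Equal columns are dependent for trivial reasons, and are treated separately because linear
  dependence is a property of sets of vectors.
\<close>

lemma three_columns_dependent:
  fixes X :: "real Matrix.mat"
  assumes X: "X \<in> carrier_mat n n" and r: "vec_space.rank n X \<le> 2" and ijk: "i < n" "j < n" "k < n"
  shows "\<exists>\<alpha> \<beta> \<gamma>. (\<alpha> \<noteq> 0 \<or> \<beta> \<noteq> 0 \<or> \<gamma> \<noteq> 0) \<and> (\<forall>l<n. \<alpha> * X $$ (l, i) + \<beta> * X $$ (l, j) + \<gamma> * X $$ (l, k) = 0)"
proof -
  interpret vec_space "TYPE(real)" n .
  have c: "Matrix.col X p $ l = X $$ (l, p)" if "p < n" "l < n" for p l using X that by simp
  consider "Matrix.col X i = Matrix.col X j" | "Matrix.col X i = Matrix.col X k" | "Matrix.col X j = Matrix.col X k" | "distinct [Matrix.col X i, Matrix.col X j, Matrix.col X k]" by auto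
  then show ?thesis
  proof cases
    case 1
    then have "\<forall>l<n. X $$ (l, i) = X $$ (l, j)" using c ijk by metis
    then show ?thesis by (intro exI[of _ 1] exI[of _ "-1"] exI[of _ 0]) simp
  next
    case 2
    then have "\<forall>l<n. X $$ (l, i) = X $$ (l, k)" using c ijk by metis
    then show ?thesis by (intro exI[of _ 1] exI[of _ 0] exI[of _ "-1"]) simp
  next
    case 3
    then have "\<forall>l<n. X $$ (l, j) = X $$ (l, k)" using c ijk by metis
    then show ?thesis by (intro exI[of _ 0] exI[of _ 1] exI[of _ "-1"]) simp
  next
    case 4
    let ?cs = "[Matrix.col X i, Matrix.col X j, Matrix.col X k]"
    let ?A = "mat_of_cols n ?cs"
    have A: "?A \<in> carrier_mat n 3" using mat_of_cols_carrier(1)[of n ?cs] by (simp add: numeral_3_eq_3)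
    have cs: "set ?cs \<subseteq> carrier_vec n" using X by auto
    have cA: "cols ?A = ?cs" by (rule cols_mat_of_cols[OF cs])
    have sub: "set ?cs \<subseteq> set (cols X)" using X ijk by (auto simp: cols_def)
    have "card (set ?cs) = 3" using 4 distinct_card[OF 4] by simp
    then have "lin_dep (set ?cs)" using rank_ge_card_indpt[OF X sub] r by force
    then obtain v where v: "v \<in> carrier_vec 3" "v \<noteq> 0\<^sub>v 3" "?A *\<^sub>v v = 0\<^sub>v n"
      using lin_depE[OF A] cA 4 by metis
    have "v $ 0 * X $$ (l, i) + v $ 1 * X $$ (l, j) + v $ 2 * X $$ (l, k) = 0" if l: "l < n" for l
    proof -
      have "0 = (?A *\<^sub>v v) $ l" using v(3) l by simp
      also have "\<dots> = (\<Sum>p<3. ?A $$ (l, p) * v $ p)"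
        using l v(1) by (simp add: scalar_prod_def atLeast0LessThan)
      also have "\<dots> = X $$ (l, i) * v $ 0 + X $$ (l, j) * v $ 1 + X $$ (l, k) * v $ 2"
        using l c ijk by (simp add: eval_nat_numeral mat_of_cols_def)
      finally show ?thesis by (simp add: mult.commute)
    qed
    moreover have "v $ 0 \<noteq> 0 \<or> v $ 1 \<noteq> 0 \<or> v $ 2 \<noteq> 0"
    proof (rule ccontr)
      assume z: "\<not> ?thesis"
      have "v = 0\<^sub>v 3"
      proof (rule eq_vecI)
        fix p assume "p < dim_vec (0\<^sub>v 3 :: real Matrix.vec)"
        then have "p = 0 \<or> p = 1 \<or> p = 2" by auto
        then show "v $ p = 0\<^sub>v 3 $ p" using z by auto
      qed (use v(1) in simp)
      with v(2) show False by simp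
    qed
    ultimately show ?thesis by blast
  qed
qed

text \<open>
  If some entry \<open>x\<close> at \<open>(i, j)\<close> has absolute value below 1, the columns
  \<open>i\<close> and \<open>j\<close> are independent and all columns are combinations of them;
  the coefficients are the coordinates of planar vectors with respect to two unit vectors with inner
  product \<open>x\<close>. Otherwise all Gram vectors are equal or opposite to the first one.
\<close>

lemma planar_of_rank_2:
  assumes X: "X \<in> sdp_feasible n" and r: "vec_space.rank n X \<le> 2"
  obtains z :: "nat \<Rightarrow> complex" where "\<And>i. i < n \<Longrightarrow> norm (z i) = 1" "\<And>i j. i < n \<Longrightarrow> j < n \<Longrightarrow> X $$ (i, j) = inner (z i) (z j)"
proof -
  note P = sdp_feasible_psd_on[OF X]
  have C: "X \<in> carrier_mat n n" using X by (simp add: sdp_feasible_def)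
  define k where "k i j = X $$ (i, j)" for i j
  have k1: "k i i = 1" if "i < n" for i using P(2) that by (simp add: k_def)
  have ks: "k i j = k j i" if "i < n" "j < n" for i j using P(1) that by (auto simp: psd_on_def k_def)
  have ple: "\<bar>k i j\<bar> \<le> 1" if "i < n" "j < n" for i j
    using psd_on_entry_le_1[OF P(1), of i j] P(2) that by (simp add: k_def)
  have "\<exists>z :: nat \<Rightarrow> complex. \<forall>i<n. \<forall>j<n. k i j = inner (z i) (z j)"
  proof (cases "\<exists>i<n. \<exists>j<n. \<bar>k i j\<bar> < 1")
    case True
    then obtain i j where ij: "i < n" "j < n" "\<bar>k i j\<bar> < 1" by auto
    define x where "x = k i j"
    have x2: "x\<^sup>2 < 1" using ij(3) by (simp add: x_def abs_square_less_1)
    have "\<exists>p q. \<forall>l<n. k l m = p * k l i + q * k l j" if m: "m < n" for m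
    proof -
      obtain \<alpha> \<beta> \<gamma> where abc: "\<alpha> \<noteq> 0 \<or> \<beta> \<noteq> 0 \<or> \<gamma> \<noteq> 0"
        "\<forall>l<n. \<alpha> * k l i + \<beta> * k l j + \<gamma> * k l m = 0"
        using three_columns_dependent[OF C r ij(1,2) m] unfolding k_def by blast
      have "\<gamma> \<noteq> 0"
      proof
        assume g: "\<gamma> = 0"
        have "\<alpha> + \<beta> * x = 0" using abc(2) ij(1) k1[OF ij(1)] g by (auto simp: x_def)
        moreover have "\<alpha> * x + \<beta> = 0" using abc(2) ij(2) k1[OF ij(2)] ks[OF ij(2,1)] g by (auto simp: x_def)
        ultimately have "\<beta> * (1 - x\<^sup>2) = 0" by (simp add: eq_neg_iff_add_eq_0[symmetric] power2_eq_square algebra_simps)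
        then have "\<beta> = 0" using x2 by simp
        then show False using \<open>\<alpha> + \<beta> * x = 0\<close> abc(1) g by simp
      qed
      then have "\<forall>l<n. k l m = (- \<alpha> / \<gamma>) * k l i + (- \<beta> / \<gamma>) * k l j"
        using abc(2) by (simp add: field_simps) (metis add.commute add_eq_0_iff)
      then show ?thesis by blast
    qed
    then have "\<forall>m. \<exists>pq. m < n \<longrightarrow> (\<forall>l<n. k l m = fst pq * k l i + snd pq * k l j)" by (metis fst_conv snd_conv)
    from choice[OF this] obtain pq where pq: "\<forall>m<n. \<forall>l<n. k l m = fst (pq m) * k l i + snd (pq m) * k l j" by blast
    define p q where "p m = fst (pq m)" and "q m = snd (pq m)" for m
    have pq: "k l m = p m * k l i + q m * k l j" if "m < n" "l < n" for l m using pq that by (simp add: p_def q_def)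
    define z where "z m = Complex (p m + q m * x) (q m * sqrt (1 - x\<^sup>2))" for m
    have "k l m = inner (z l) (z m)" if lm: "l < n" "m < n" for l m
    proof -
      have 1: "k l i = p l + q l * x" using pq[OF lm(1) ij(1)] ks[OF lm(1) ij(1)] k1[OF ij(1)] by (simp add: x_def)
      have 2: "k l j = p l * x + q l" using pq[OF lm(1) ij(2)] ks[OF lm(1) ij(2)] ks[OF ij(1,2)] k1[OF ij(2)] by (simp add: x_def)
      have "inner (z l) (z m) = (p l + q l * x) * (p m + q m * x) + q l * q m * (sqrt (1 - x\<^sup>2))\<^sup>2"
        by (simp add: z_def inner_complex_def power2_eq_square)
      also have "(sqrt (1 - x\<^sup>2))\<^sup>2 = 1 - x\<^sup>2" using x2 by simp
      also have "(p l + q l * x) * (p m + q m * x) + q l * q m * (1 - x\<^sup>2) = p m * (p l + q l * x) + q m * (p l * x + q l)"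
        by (simp add: algebra_simps power2_eq_square)
      finally show ?thesis using pq[OF lm(2,1)] 1 2 by simp
    qed
    then show ?thesis by blast
  next
    case False
    show ?thesis
    proof (cases "n = 0")
      case False
      then have n0: "0 < n" by simp
      obtain f where f: "\<forall>i\<in>{..<n}. \<forall>j\<in>{..<n}. k i j = (\<Sum>l<card {..<n}. f i l * f j l)"
        using gram_coordinates[OF _ P(1)] by (auto simp: k_def)
      then have f: "k i j = (\<Sum>l<n. f i l * f j l)" if "i < n" "j < n" for i j using that by simp
      have fm: "f m l = k 0 m * f 0 l" if m: "m < n" "l < n" for m l
      proof -
        have "\<bar>k 0 m\<bar> \<ge> 1" using \<open>\<not> (\<exists>i<n. \<exists>j<n. \<bar>k i j\<bar> < 1)\<close> m(1) n0 by force
        then have "1 \<le> (k 0 m)\<^sup>2" by (metis abs_le_square_iff abs_one one_power2)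
        have "(\<Sum>l<n. (f m l - k 0 m * f 0 l)\<^sup>2) = (\<Sum>l<n. f m l * f m l) - 2 * k 0 m * (\<Sum>l<n. f 0 l * f m l) + (k 0 m)\<^sup>2 * (\<Sum>l<n. f 0 l * f 0 l)"
          by (simp add: power2_eq_square algebra_simps sum.distrib sum_subtractf sum_distrib_left)
        also have "\<dots> = 1 - (k 0 m)\<^sup>2"
          using f[OF m(1) m(1)] f[OF n0 m(1)] f[OF n0 n0] k1[OF m(1)] k1[OF n0] by (simp add: power2_eq_square)
        finally have "(\<Sum>l<n. (f m l - k 0 m * f 0 l)\<^sup>2) \<le> 0" using \<open>1 \<le> (k 0 m)\<^sup>2\<close> by simp
        then have "(\<Sum>l<n. (f m l - k 0 m * f 0 l)\<^sup>2) = 0" by (intro antisym sum_nonneg) auto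
        then have "(f m l - k 0 m * f 0 l)\<^sup>2 = 0" using m(2) by (simp add: sum_nonneg_eq_0_iff)
        then show ?thesis by simp
      qed
      have "k l m = inner (complex_of_real (k 0 l)) (complex_of_real (k 0 m))" if lm: "l < n" "m < n" for l m
      proof -
        have "k l m = (\<Sum>p<n. (k 0 l * f 0 p) * (k 0 m * f 0 p))" 
          unfolding f[OF lm] by (rule sum.cong[OF refl]) (metis fm lm lessThan_iff)
        also have "\<dots> = k 0 l * k 0 m * (\<Sum>p<n. f 0 p * f 0 p)" by (simp add: sum_distrib_left mult_ac)
        also have "\<dots> = k 0 l * k 0 m" using f[OF n0 n0] k1[OF n0] by simp
        finally show ?thesis by (simp add: inner_complex_def)
      qed
      then show ?thesis by (intro exI[of _ "\<lambda>m. complex_of_real (k 0 m)"] allI impI)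
    qed simp
  qed
  then obtain z :: "nat \<Rightarrow> complex" where z: "\<forall>i<n. \<forall>j<n. k i j = inner (z i) (z j)" by blast
  show thesis
  proof (rule that[of z])
    fix i assume "i < n" then show "norm (z i) = 1" using z k1 by (simp add: norm_eq_1)
  qed (use z in \<open>simp add: k_def\<close>)
qed

text \<open>
  The property behind extreme Gram dimension at most two, free of the least number.
\<close>

definition planar_opt :: "nat ugraph \<Rightarrow> bool" where
  "planar_opt G \<longleftrightarrow> (\<forall>w. \<exists>X. sdp_optimal G w X \<and> vec_space.rank (card (pverts G)) X \<le> 2)"

lemma egd_le_2_iff:
  assumes sg: "simple_graph G" and V: "pverts G = {..<n}" and n: "n \<ge> 1"
  shows "egd G \<le> 2 \<longleftrightarrow> planar_opt G"
proof -
  interpret fin_graph "pverts G" "parcs G" by fact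
  let ?P = "\<lambda>r. 1 \<le> r \<and> (\<forall>w. \<exists>X. sdp_optimal G w X \<and> vec_space.rank (card (pverts G)) X \<le> r)"
  have "?P n"
  proof (intro conjI allI n)
    fix w
    obtain X where X: "sdp_optimal G w X" using sdp_optimal_exists[OF V finE, where w = w] EV unfolding V by blast
    then have "X \<in> carrier_mat n n" by (simp add: sdp_optimal_def sdp_feasible_def V)
    then have "vec_space.rank n X \<le> n" by (rule vec_space.rank_le_nc)
    then show "\<exists>X. sdp_optimal G w X \<and> vec_space.rank (card (pverts G)) X \<le> n" using X V by auto
  qed
  then have e: "?P (egd G)" unfolding egd_def by (rule LeastI)
  show ?thesis
  proof
    assume "egd G \<le> 2"
    then show "planar_opt G" unfolding planar_opt_def using e by (meson le_trans)
  next
    assume "planar_opt G"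
    then have "?P 2" by (simp add: planar_opt_def)
    then show "egd G \<le> 2" unfolding egd_def by (rule Least_le)
  qed
qed

text \<open>
  The semidefinite program weighs every edge once, while the arguments about branch sets give
  weights to arcs in either direction.
\<close>

lemma sdp_value_symmetrize:
  fixes W :: "nat \<times> nat \<Rightarrow> real"
  assumes sg: "simple_graph G" and "\<And>i j. (i, j) \<in> parcs G \<Longrightarrow> X $$ (i, j) = X $$ (j, i)"
  shows "sdp_value G (\<lambda>(i, j). W (i, j) + W (j, i)) X = (\<Sum>e\<in>parcs G. W e * X $$ e)"
proof -
  interpret fin_graph "pverts G" "parcs G" by fact
  let ?L = "{(i, j) \<in> parcs G. i < j}" and ?U = "{(i, j) \<in> parcs G. j < i}"
  have fin: "finite ?L" "finite ?U" using finE by (auto intro: finite_subset[OF _ finE])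
  have "parcs G = ?L \<union> ?U"
  proof
    show "parcs G \<subseteq> ?L \<union> ?U"
    proof
      fix e assume e: "e \<in> parcs G"
      obtain i j where ij: "e = (i, j)" by force
      then have "i \<noteq> j" using e by auto
      then show "e \<in> ?L \<union> ?U" using e ij by auto
    qed
  qed auto
  then have "(\<Sum>e\<in>parcs G. W e * X $$ e) = (\<Sum>e\<in>?L. W e * X $$ e) + (\<Sum>e\<in>?U. W e * X $$ e)"
    using sum.union_disjoint[OF fin, of "\<lambda>e. W e * X $$ e"] by force
  also have "(\<Sum>e\<in>?U. W e * X $$ e) = (\<Sum>e\<in>?L. W (prod.swap e) * X $$ (prod.swap e))"
    by (rule sum.reindex_bij_witness[of _ prod.swap prod.swap]) (use edge_sym in auto)
  also have "\<dots> = (\<Sum>e\<in>?L. W (prod.swap e) * X $$ e)"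
  proof (rule sum.cong[OF refl])
    fix e assume e: "e \<in> ?L"
    obtain i j where ij: "e = (i, j)" by force
    show "W (prod.swap e) * X $$ (prod.swap e) = W (prod.swap e) * X $$ e"
      using assms(2)[of i j] e ij by simp
  qed
  also have "(\<Sum>e\<in>?L. W e * X $$ e) + (\<Sum>e\<in>?L. W (prod.swap e) * X $$ e) =
      sdp_value G (\<lambda>(i, j). W (i, j) + W (j, i)) X"
    unfolding sdp_value_def sum.distrib[symmetric] by (rule sum.cong[OF refl]) (auto simp: distrib_right)
  finally show ?thesis by simp
qed

text \<open>
  A planar optimal solution beats every configuration of unit vectors in space, because their Gram
  matrix is feasible.
\<close>

lemma planar_opt_config:
  fixes W :: "nat \<times> nat \<Rightarrow> real"
  assumes sg: "simple_graph G" and V: "pverts G = {..<n}" and po: "planar_opt G"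
  shows "\<exists>z :: nat \<Rightarrow> complex. (\<forall>v\<in>pverts G. norm (z v) = 1) \<and>
     (\<forall>Y :: nat \<Rightarrow> complex \<times> real. (\<forall>v\<in>pverts G. norm (Y v) = 1) \<longrightarrow>
       (\<Sum>e\<in>parcs G. W e * inner (Y (fst e)) (Y (snd e))) \<le> (\<Sum>e\<in>parcs G. W e * inner (z (fst e)) (z (snd e))))"
proof -
  interpret fin_graph "pverts G" "parcs G" by fact
  let ?w = "\<lambda>(i, j). W (i, j) + W (j, i)"
  obtain X where X: "sdp_optimal G ?w X" "vec_space.rank n X \<le> 2"
    using po V unfolding planar_opt_def by auto
  have Xf: "X \<in> sdp_feasible n" using X(1) V by (simp add: sdp_optimal_def)
  obtain z :: "nat \<Rightarrow> complex" where z: "\<And>i. i < n \<Longrightarrow> norm (z i) = 1" "\<And>i j. i < n \<Longrightarrow> j < n \<Longrightarrow> X $$ (i, j) = inner (z i) (z j)"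
    using planar_of_rank_2[OF Xf X(2)] by blast
  have lt: "i < n" "j < n" if "(i, j) \<in> parcs G" for i j using edge_in[OF that] V by auto
  have vX: "sdp_value G ?w X = (\<Sum>e\<in>parcs G. W e * inner (z (fst e)) (z (snd e)))"
  proof -
    have "sdp_value G ?w X = (\<Sum>e\<in>parcs G. W e * X $$ e)"
      by (rule sdp_value_symmetrize[OF sg]) (use z(2) lt in \<open>auto simp: inner_commute\<close>)
    also have "\<dots> = (\<Sum>e\<in>parcs G. W e * inner (z (fst e)) (z (snd e)))"
      by (rule sum.cong[OF refl]) (use z(2) lt in auto)
    finally show ?thesis .
  qed
  show ?thesis
  proof (intro exI[of _ z] conjI allI impI ballI)
    fix v assume "v \<in> pverts G" then show "norm (z v) = 1" using z(1) V by simp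
  next
    fix Y :: "nat \<Rightarrow> complex \<times> real" assume Y: "\<forall>v\<in>pverts G. norm (Y v) = 1"
    let ?Y = "Matrix.mat n n (\<lambda>(i, j). inner (Y i) (Y j))"
    have "?Y \<in> sdp_feasible n" by (rule sdp_feasible_inner) (use Y V in simp)
    then have "sdp_value G ?w ?Y \<le> sdp_value G ?w X" using X(1) V by (simp add: sdp_optimal_def)
    moreover have "sdp_value G ?w ?Y = (\<Sum>e\<in>parcs G. W e * ?Y $$ e)"
      by (rule sdp_value_symmetrize[OF sg]) (use lt in \<open>auto simp: inner_commute\<close>)
    moreover have "\<dots> = (\<Sum>e\<in>parcs G. W e * inner (Y (fst e)) (Y (snd e)))"
      by (rule sum.cong[OF refl]) (use lt in auto)
    ultimately show "(\<Sum>e\<in>parcs G. W e * inner (Y (fst e)) (Y (snd e))) \<le> (\<Sum>e\<in>parcs G. W e * inner (z (fst e)) (z (snd e)))"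
      using vX by simp
  qed
qed

lemma model_sub_arcs: "model EM VM E V \<beta> \<Longrightarrow> EM' \<subseteq> EM \<Longrightarrow> model EM' VM E V \<beta>"
  by (auto simp: model_def)

text \<open>
  In both cases the optimum over vectors in space is attained, and the gap to the plane would pass
  from the minor to \<open>G\<close>.
\<close>

theorem excluded_of_planar_opt:
  assumes sg: "simple_graph G" and V: "pverts G = {..<n}" and po: "planar_opt G"
  shows "\<not> is_minor F3 G" "\<not> is_minor H3 G"
proof -
  interpret fin_graph "pverts G" "parcs G" by fact
  note planar = planar_opt_config[OF sg V po]
  show "\<not> is_minor F3 G"
  proof
    assume "is_minor F3 G"
    then obtain \<beta> where "model (parcs F3) (pverts F3) (parcs G) (pverts G) \<beta>" using model_of_minor[OF _ sg] by blast
    then have m: "model F3_arcs (pverts F3) (parcs G) (pverts G) \<beta>"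
      by (rule model_sub_arcs) (simp add: F3_arcs_def F3_simps)
    show False
    proof (rule gap_contradiction[OF finE m, where y = F3_config and \<epsilon> = "1 / 8" and WM = F3_weight])
      fix z :: "nat \<Rightarrow> complex" assume z: "\<And>x. x \<in> pverts F3 \<Longrightarrow> norm (z x) = 1"
      have "norm (z i) = 1" if "i \<in> {1, 2, 3, 12, 13, 23}" for i by (rule z) (use that in \<open>simp add: F3_simps\<close>)
      from F3_gap[OF this] show "(\<Sum>a\<in>F3_arcs. F3_weight a * inner (z (fst a)) (z (snd a))) + 1 / 8
          \<le> (\<Sum>a\<in>F3_arcs. F3_weight a * inner (F3_config (fst a)) (F3_config (snd a)))"
        unfolding F3_config_value .
    qed (use planar EV norm_F3_config in \<open>auto simp: F3_arcs_def F3_simps irrefl_def\<close>)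
  qed
  show "\<not> is_minor H3 G"
  proof
    assume "is_minor H3 G"
    then obtain \<beta> where "model (parcs H3) (pverts H3) (parcs G) (pverts G) \<beta>" using model_of_minor[OF _ sg] by blast
    then have m: "model H3_arcs (pverts H3) (parcs G) (pverts G) \<beta>"
      by (rule model_sub_arcs) (simp add: H3_arcs_def H3_simps)
    show False
    proof (rule gap_contradiction[OF finE m, where y = H3_config and \<epsilon> = "1 / 300" and WM = H3_weight])
      fix z :: "nat \<Rightarrow> complex" assume z: "\<And>x. x \<in> pverts H3 \<Longrightarrow> norm (z x) = 1"
      have "norm (z i) = 1" if "i \<in> {1, 2, 3, 12, 13, 23}" for i by (rule z) (use that in \<open>simp add: H3_simps\<close>)
      from H3_gap[OF this] show "(\<Sum>a\<in>H3_arcs. H3_weight a * inner (z (fst a)) (z (snd a))) + 1 / 300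
          \<le> (\<Sum>a\<in>H3_arcs. H3_weight a * inner (H3_config (fst a)) (H3_config (snd a)))"
        unfolding H3_config_value .
    qed (use planar EV norm_H3_config in \<open>auto simp: H3_arcs_def H3_simps irrefl_def\<close>)
  qed
qed

text \<open>
  Some optimal solution \<open>X\<close> exists; a planar configuration whose value is at least that
  of \<open>X\<close> is optimal as well, and its Gram matrix has rank at most two.
\<close>

theorem planar_opt_of_tree_minor:
  assumes sg: "simple_graph G" and V: "pverts G = {..<n}" and tm: "tree_minor G 2"
  shows "planar_opt G"
  unfolding planar_opt_def
proof
  fix w
  interpret fin_graph "pverts G" "parcs G" by fact
  obtain T :: "nat ugraph" where T: "undirected_tree T" "is_minor G (strong_product T (complete_graph 2))"
    using tm by (auto simp: tree_minor_def)
  obtain \<beta> where "model (parcs G) (pverts G) (parcs (strong_product T (complete_graph 2))) (pverts (strong_product T (complete_graph 2))) \<beta>"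
    by (rule model_of_minor[OF T(2) simple_strong_product[OF undirected_tree_simple[OF T(1)]]])
  then have m: "model (parcs G) (pverts G) (parcs (strong_product T (complete_graph 2))) (pverts T \<times> {..<2}) \<beta>"
    by (simp add: strong_product_simps(1))
  have arcs: "t = t' \<or> (t, t') \<in> parcs T" if "((t, s), (t', s')) \<in> parcs (strong_product T (complete_graph 2))" for t s t' s'
    using that by (auto simp: strong_product_simps)
  obtain X where X: "sdp_optimal G w X" using sdp_optimal_exists[OF V finE, where w = w] EV unfolding V by blast
  then have Xf: "X \<in> sdp_feasible n" using V by (simp add: sdp_optimal_def)
  note P = sdp_feasible_psd_on[OF Xf]
  let ?I = "{(i, j) \<in> parcs G. i < j}"
  have fI: "finite ?I" by (rule finite_subset[OF _ finE]) auto
  have ends: "fst e \<in> pverts G \<and> snd e \<in> pverts G \<and> (fst e, snd e) \<in> parcs G" if "e \<in> ?I" for e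
    using that edge_in by auto
  have P1: "psd_on (pverts G) (\<lambda>i j. X $$ (i, j))" "\<And>v. v \<in> pverts G \<Longrightarrow> X $$ (v, v) = 1" using P V by auto
  obtain z :: "nat \<Rightarrow> complex" where z: "\<And>v. v \<in> pverts G \<Longrightarrow> norm (z v) = 1"
    "(\<Sum>e\<in>?I. w e * X $$ (fst e, snd e)) \<le> (\<Sum>e\<in>?I. w e * inner (z (fst e)) (z (snd e)))"
    by (rule planar_config_of_model[OF grown_tree_of_undirected_tree[OF T(1)] m arcs finV P1 fI ends, where w = w]) (assumption | rule that)+
  let ?Z = "Matrix.mat n n (\<lambda>(i, j). inner (z i) (z j))"
  have Zf: "?Z \<in> sdp_feasible n" by (rule sdp_feasible_inner) (use z(1) V in simp)
  have "sdp_value G w X \<le> sdp_value G w ?Z"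
  proof -
    have "sdp_value G w ?Z = (\<Sum>e\<in>?I. w e * inner (z (fst e)) (z (snd e)))"
      unfolding sdp_value_def by (rule sum.cong[OF refl]) (use edge_in V in auto)
    then show ?thesis using z(2) by (simp add: sdp_value_def)
  qed
  then have "sdp_optimal G w ?Z" using X Zf V unfolding sdp_optimal_def by (auto intro: order_trans)
  then show "\<exists>X. sdp_optimal G w X \<and> vec_space.rank (card (pverts G)) X \<le> 2"
    using rank_planar[of n z] V by auto
qed

theorem theorem5p2:
  fixes G :: "nat ugraph" and n :: nat
  assumes "pair_graph G" and "pverts G = {..<n}" and "n \<ge> 6"
    and "two_connected G"
    and "\<not> complete_bipartite_digraph 3 3 (with_proj G)"
  shows "(egd G \<le> 2 \<longleftrightarrow> \<not> is_minor F3 G \<and> \<not> is_minor H3 G) \<and>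
         (\<not> is_minor F3 G \<and> \<not> is_minor H3 G \<longleftrightarrow> la_strong G \<le> 2) \<and>
         (la_strong G \<le> 2 \<longleftrightarrow>
            (\<exists>T :: nat ugraph. undirected_tree T \<and>
               is_minor G (strong_product T (complete_graph 2))))"
proof -
  have sg: "simple_graph G" using assms(1) by (simp add: simple_graph_iff)
  have n1: "n \<ge> 1" using assms(3) by simp
  have "egd G \<le> 2 \<longleftrightarrow> planar_opt G" by (rule egd_le_2_iff[OF sg assms(2) n1])
  moreover have "la_strong G \<le> 2 \<longleftrightarrow> tree_minor G 2" by (rule la_strong_le_2_iff[OF sg assms(2) n1])
  moreover have "planar_opt G \<Longrightarrow> \<not> is_minor F3 G \<and> \<not> is_minor H3 G"
    using excluded_of_planar_opt[OF sg assms(2)] by blast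
  moreover have "\<not> is_minor F3 G \<and> \<not> is_minor H3 G \<Longrightarrow> tree_minor G 2"
    using tree_minor_of_excluded[OF sg assms(4) _ assms(5)] assms(2,3) by simp
  moreover have "tree_minor G 2 \<Longrightarrow> planar_opt G" by (rule planar_opt_of_tree_minor[OF sg assms(2)])
  ultimately show ?thesis unfolding tree_minor_def[symmetric] by blast
qed

end
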